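(* Let $S\subset\mathbb P^4$ be the del Pezzo quartic surface, i.e. the blow-up of $\mathbb P^2$ at five general points embedded in $\mathbb P^4$ by the linear system $|3h-e_1-\cdots-e_5|$. For all positive odd integers $d_1=2k+1$ and $d_2=2\ell+1$ there exist smooth curves $C_1,C_2$ on $S$ such that $\deg(C_1)=d_1$, $\deg(C_2)=d_2$ and $$|C_1\cap C_2|=\tfrac12(d_1-1)(d_2-1)+1 .$$
   Context: We work over $\mathbb C$. $h$ is the pullback of the class of a line in $\mathbb P^2$ and $e_1,\dots,e_5$ are the classes of the exceptional divisors over the five blown-up points. Degrees are taken in $\mathbb P^4$, and $|C_1\cap C_2|$ counts intersection points without multiplicity. *)

theory Defs
  imports "HOL-Analysis.Analysis"
begin

section \<open>Projective geometry over the complex numbers\<close>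

text \<open>The points of the projective space of \<^typ>\<open>complex ^ 'n\<close> are the one-dimensional
  linear subspaces. The projective dimension is \<open>CARD('n) - 1\<close>.\<close>

definition proj_space :: "(complex ^ 'n) set set" where
  "proj_space = {vec.span {v} | v. v \<noteq> 0}"

definition proj_lines :: "(complex ^ 'n) set set" where
  "proj_lines = {L. vec.subspace L \<and> vec.dim L = 2}"

text \<open>Homogeneous polynomials are represented by their polynomial functions; as the field is
  infinite, nothing is lost.\<close>

definition is_form :: "nat \<Rightarrow> (complex ^ 'n \<Rightarrow> complex) \<Rightarrow> bool" where
  "is_form d f \<longleftrightarrow> (\<exists>c :: ('n \<Rightarrow> nat) \<Rightarrow> complex.
     f = (\<lambda>v. \<Sum>\<alpha> | (\<Sum>i\<in>UNIV. \<alpha> i) = d. c \<alpha> * (\<Prod>i\<in>UNIV. (v $ i) ^ \<alpha> i)))"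

definition homogeneous :: "(complex ^ 'n \<Rightarrow> complex) \<Rightarrow> bool" where
  "homogeneous f \<longleftrightarrow> (\<exists>d. is_form d f)"

definition dir_deriv :: "(complex ^ 'n \<Rightarrow> complex) \<Rightarrow> complex ^ 'n \<Rightarrow> complex ^ 'n \<Rightarrow> complex" where
  "dir_deriv f v w = deriv (\<lambda>z. f (v + z *s w)) 0"

definition vanishes_on :: "(complex ^ 'n \<Rightarrow> complex) \<Rightarrow> (complex ^ 'n) set set \<Rightarrow> bool" where
  "vanishes_on f X \<longleftrightarrow> (\<forall>P\<in>X. \<forall>v\<in>P. f v = 0)"

definition zero_locus :: "(complex ^ 'n \<Rightarrow> complex) set \<Rightarrow> (complex ^ 'n) set set" where
  "zero_locus F = {P \<in> proj_space. \<forall>f\<in>F. \<forall>v\<in>P. f v = 0}"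

definition zariski_closed :: "(complex ^ 'n) set set \<Rightarrow> bool" where
  "zariski_closed X \<longleftrightarrow> (\<exists>F. (\<forall>f\<in>F. homogeneous f) \<and> X = zero_locus F)"

definition zariski_irreducible :: "(complex ^ 'n) set set \<Rightarrow> bool" where
  "zariski_irreducible X \<longleftrightarrow> X \<noteq> {} \<and>
     (\<forall>A B. zariski_closed A \<longrightarrow> zariski_closed B \<longrightarrow> X \<subseteq> A \<union> B \<longrightarrow> X \<subseteq> A \<or> X \<subseteq> B)"

definition has_irreducible_chain :: "(complex ^ 'n) set set \<Rightarrow> nat \<Rightarrow> bool" where
  "has_irreducible_chain X n \<longleftrightarrow> (\<exists>Z :: nat \<Rightarrow> (complex ^ 'n) set set.
     (\<forall>i\<le>n. zariski_closed (Z i) \<and> zariski_irreducible (Z i) \<and> Z i \<subseteq> X) \<and>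
     (\<forall>i<n. Z i \<subset> Z (Suc i)))"

text \<open>Krull dimension of a closed set.\<close>

definition has_dimension :: "(complex ^ 'n) set set \<Rightarrow> nat \<Rightarrow> bool" where
  "has_dimension X n \<longleftrightarrow> has_irreducible_chain X n \<and> \<not> has_irreducible_chain X (Suc n)"

text \<open>The Zariski tangent space, at \<open>v\<close>, of the affine cone over \<open>X\<close>. Its dimension exceeds that
  of the tangent space of \<open>X\<close> at the point spanned by \<open>v\<close> by one.\<close>

definition cone_tangent_space ::
    "(complex ^ 'n) set set \<Rightarrow> complex ^ 'n \<Rightarrow> (complex ^ 'n) set" where
  "cone_tangent_space X v =
     {w. \<forall>f. homogeneous f \<longrightarrow> vanishes_on f X \<longrightarrow> dir_deriv f v w = 0}"

text \<open>Curves are irreducible, and smoothness is the Jacobian criterion on the full homogeneous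
  ideal of the curve.\<close>

definition smooth_curve :: "(complex ^ 'n) set set \<Rightarrow> bool" where
  "smooth_curve C \<longleftrightarrow> zariski_closed C \<and> zariski_irreducible C \<and> has_dimension C 1 \<and>
     (\<forall>v. v \<noteq> 0 \<longrightarrow> vec.span {v} \<in> C \<longrightarrow> vec.dim (cone_tangent_space C v) = 2)"

definition hyperplane :: "complex ^ 'n \<Rightarrow> (complex ^ 'n) set set" where
  "hyperplane a = {P \<in> proj_space. \<forall>v\<in>P. (\<Sum>i\<in>UNIV. a $ i * v $ i) = 0}"

text \<open>The degree of a curve is the number of points in which a general hyperplane meets it.
  ``General'' means: outside a proper Zariski closed subset of the dual projective space.\<close>

definition has_degree :: "(complex ^ 'n) set set \<Rightarrow> nat \<Rightarrow> bool" where
  "has_degree C d \<longleftrightarrow> (\<exists>Z. zariski_closed Z \<and> Z \<subset> proj_space \<and>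
     (\<forall>a. a \<noteq> 0 \<longrightarrow> vec.span {a} \<notin> Z \<longrightarrow>
        finite (C \<inter> hyperplane a) \<and> card (C \<inter> hyperplane a) = d))"


section \<open>The quartic del Pezzo surface\<close>

text \<open>General position of five points means that no three of them are collinear. This is exactly
  the condition for \<open>3h - e\<^sub>1 - \<dots> - e\<^sub>5\<close> to be very ample.\<close>

definition general_points :: "(5 \<Rightarrow> (complex ^ 3) set) \<Rightarrow> bool" where
  "general_points p \<longleftrightarrow> inj p \<and> range p \<subseteq> proj_space \<and>
     (\<forall>L\<in>proj_lines. card {i. p i \<subseteq> L} \<le> 2)"

text \<open>The blow-up of the plane at one point \<open>q\<close> is the set of pairs of a point \<open>x\<close> and a line
  through \<open>q\<close> and \<open>x\<close>. The blow-up at five distinct points is the fibre product over the plane of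
  the five individual blow-ups. The fibre over \<open>x = p i\<close> is the exceptional curve of class
  \<open>e\<^sub>i\<close>: the line \<open>L i\<close> through \<open>p i\<close> varies freely there, all other data being determined.\<close>

definition blowup ::
    "(5 \<Rightarrow> (complex ^ 3) set) \<Rightarrow> ((complex ^ 3) set \<times> (5 \<Rightarrow> (complex ^ 3) set)) set" where
  "blowup p = {(x, L). x \<in> proj_space \<and> (\<forall>i. L i \<in> proj_lines \<and> p i \<subseteq> L i \<and> x \<subseteq> L i)}"

text \<open>The global sections of \<open>3h - e\<^sub>1 - \<dots> - e\<^sub>5\<close> are the cubic forms vanishing at the five
  points.\<close>

definition cubics_through :: "(5 \<Rightarrow> (complex ^ 3) set) \<Rightarrow> (complex ^ 3 \<Rightarrow> complex) set" where
  "cubics_through p = {g. is_form 3 g \<and> vanishes_on g (range p)}"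

definition cubics_basis ::
    "(5 \<Rightarrow> (complex ^ 3) set) \<Rightarrow> (5 \<Rightarrow> complex ^ 3 \<Rightarrow> complex) \<Rightarrow> bool" where
  "cubics_basis p f \<longleftrightarrow> (\<forall>j. f j \<in> cubics_through p) \<and>
     (\<forall>g\<in>cubics_through p. \<exists>!c :: 5 \<Rightarrow> complex. g = (\<lambda>v. \<Sum>j\<in>UNIV. c j * f j v))"

text \<open>The morphism to projective 4-space given by the basis \<open>f\<close>. Away from the exceptional curves
  a section is evaluated as the cubic form itself. At the point \<open>(p i, L)\<close> of an exceptional curve,
  the value of a section is obtained by dividing the pulled back cubic by a local equation of
  the curve, that is, by differentiating the cubic at \<open>p i\<close> in the direction \<open>L i\<close>. Exactly one
  of the two sets below contributes a nonzero vector: the first is empty for \<open>x\<close> not among the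
  points \<open>p i\<close>, and the second is \<open>{0}\<close> otherwise.\<close>

definition anticanonical_map ::
    "(5 \<Rightarrow> (complex ^ 3) set) \<Rightarrow> (5 \<Rightarrow> complex ^ 3 \<Rightarrow> complex) \<Rightarrow>
     (complex ^ 3) set \<times> (5 \<Rightarrow> (complex ^ 3) set) \<Rightarrow> (complex ^ 5) set" where
  "anticanonical_map p f = (\<lambda>(x, L). vec.span
     ({(\<chi> j. dir_deriv (f j) v w) | i v w. x = p i \<and> v \<in> x \<and> w \<in> L i} \<union>
      {(\<chi> j. f j v) | v. v \<in> x}))"

definition del_pezzo_quartic ::
    "(5 \<Rightarrow> (complex ^ 3) set) \<Rightarrow> (5 \<Rightarrow> complex ^ 3 \<Rightarrow> complex) \<Rightarrow> (complex ^ 5) set set" where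
  "del_pezzo_quartic p f = anticanonical_map p f ` blowup p"

end

(* Let x0 = U W m, x1 = V W m, x2 = U q, x3 = V q, x4 = U V m, where W, U, V are the coordinates of the
   plane dual to p1, p2, p3, m is the line through p4, p5 and q the conic through all five points.
   With x5 = W q, which is a linear combination of x0, ..., x4, the surface S is
   x0 x3 = x1 x2 = x4 x5. The ratios (x0 : x1) = (x2 : x3) and (x0 : x2) = (x1 : x3) are the conic
   bundles F = h - e_1 and F' = 2h - e_2 - ... - e_5, with F F' = 2. Projecting the conics of the first
   bundle from one line which is a section yields rational curves C1 in a class k F + L1, for the second
   bundle one gets C2 in l F' + L2, where L1, L2 are lines with L1 L2 = 1 and L1 F' = L2 F = 0. Hence
   C1 C2 = 2 k l + 1, the number of roots of a binary form R which has simple roots for general C1.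

   A curve that is a section of a ruling of the quadric cone x0 x3 = x1 x2 and misses the vertex has
   explicit equations, from which closedness and smoothness can be read off. For the degree, the bad
   hyperplanes are those where the discriminant of the hyperplane section vanishes. *)

theory Submission
  imports Defs "Subresultants.Subresultant_Gcd"
    "HOL-Computational_Algebra.Fundamental_Theorem_Algebra"
    "HOL-Computational_Algebra.Field_as_Ring"
begin

no_notation Matrix.vec_index (infixl \<open>$\<close> 100)

section \<open>Forms\<close>

text \<open>The lines are \<open>L1 = h - e_2 - e_3\<close> (the line \<open>W = 0\<close>) and
  \<open>L2 = e_3\<close>. The conics of the first bundle are projected from the line
  \<open>m = 0\<close>, those of the second from \<open>U = 0\<close>. A section is then given by a
  slope \<open>h / g\<close>, with \<open>h\<close> of degree \<open>k\<close> and \<open>g\<close>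
  of degree \<open>k - 1\<close>. General position is reduced to the choice of one number.
  \<open>C2\<close> is an arbitrary section; for \<open>C1\<close> the slope is
  \<open>c * (s - z * t) ^ k / (s - z' * t) ^ (k - 1)\<close>, and only \<open>c\<close> varies. Two
  conditions have to hold: the parametrisation of \<open>C1\<close> has no common zero, and
  \<open>R\<close> has simple roots. Each fails for finitely many \<open>c\<close>, because
  \<open>R\<close> is affine linear in \<open>c\<close> and a pencil of binary forms without base
  points has finitely many members with a multiple root. The surface is given as an image of the
  blow-up, so to place the curves on it every solution of its equations needs an explicit preimage.
  The relation for \<open>x5\<close> is the identity \<open>q * m = m * q\<close> with the outer
  factors expanded. The formula for the preimage degenerates on the exceptional curves and on the
  conic, which accounts for the case distinctions there.\<close>

lemma finite_exponents: "finite {\<alpha> :: 'n::finite \<Rightarrow> nat. (\<Sum>i\<in>UNIV. \<alpha> i) = d}"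
proof (rule finite_subset)
  show "{\<alpha> :: 'n \<Rightarrow> nat. (\<Sum>i\<in>UNIV. \<alpha> i) = d} \<subseteq> (UNIV :: 'n set) \<rightarrow>\<^sub>E {..d}"
    by (auto intro!: member_le_sum)
qed (auto intro: finite_PiE)

lemma is_form_const_mult:
  assumes "is_form d f"
  shows "is_form d (\<lambda>v. c * f v)"
proof -
  from assms obtain a where a: "f = (\<lambda>v. \<Sum>\<alpha> | (\<Sum>i\<in>UNIV. \<alpha> i) = d. a \<alpha> * (\<Prod>i\<in>UNIV. (v $ i) ^ \<alpha> i))"
    by (auto simp: is_form_def)
  show ?thesis unfolding is_form_def a
    by (rule exI[of _ "\<lambda>\<alpha>. c * a \<alpha>"]) (simp add: sum_distrib_left mult.assoc)
qed

lemma is_form_zero: "is_form d (\<lambda>v. 0)"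
  unfolding is_form_def by (rule exI[of _ "\<lambda>_. 0"]) simp

lemma is_form_add:
  assumes "is_form d f" "is_form d g"
  shows "is_form d (\<lambda>v. f v + g v)"
proof -
  from assms obtain a b where
    a: "f = (\<lambda>v. \<Sum>\<alpha> | (\<Sum>i\<in>UNIV. \<alpha> i) = d. a \<alpha> * (\<Prod>i\<in>UNIV. (v $ i) ^ \<alpha> i))" and
    b: "g = (\<lambda>v. \<Sum>\<alpha> | (\<Sum>i\<in>UNIV. \<alpha> i) = d. b \<alpha> * (\<Prod>i\<in>UNIV. (v $ i) ^ \<alpha> i))"
    unfolding is_form_def by blast
  show ?thesis unfolding is_form_def a b
    by (rule exI[of _ "\<lambda>\<alpha>. a \<alpha> + b \<alpha>"]) (simp add: sum.distrib distrib_right)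
qed

lemma is_form_diff:
  assumes "is_form d f" "is_form d g"
  shows "is_form d (\<lambda>v. f v - g v)"
  using is_form_add[OF assms(1) is_form_const_mult[OF assms(2), of "-1"]] by simp

lemma is_form_if:
  assumes "c \<Longrightarrow> is_form d f" "\<not> c \<Longrightarrow> is_form d g"
  shows "is_form d (\<lambda>v. if c then f v else g v)"
  using assms by (cases c) auto

lemma is_form_sum:
  assumes "\<And>x. x \<in> A \<Longrightarrow> is_form d (f x)"
  shows "is_form d (\<lambda>v. \<Sum>x\<in>A. f x v)"
  using assms
  by (induction A rule: infinite_finite_induct) (auto intro: is_form_zero is_form_add)

lemma is_form_monomial:
  assumes "(\<Sum>i\<in>UNIV. \<beta> i) = d"
  shows "is_form d (\<lambda>v. \<Prod>i\<in>UNIV. (v $ i) ^ \<beta> i)"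
  unfolding is_form_def
proof (rule exI[of _ "\<lambda>\<alpha>. if \<alpha> = \<beta> then 1 else 0"], rule ext)
  fix v :: "complex ^ 'a"
  let ?m = "\<lambda>\<alpha>. \<Prod>i\<in>UNIV. (v $ i) ^ \<alpha> i"
  have "(\<Sum>\<alpha> | (\<Sum>i\<in>UNIV. \<alpha> i) = d. (if \<alpha> = \<beta> then 1 else 0) * ?m \<alpha>)
      = (\<Sum>\<alpha> | (\<Sum>i\<in>UNIV. \<alpha> i) = d. if \<alpha> = \<beta> then ?m \<alpha> else 0)"
    by (rule sum.cong) auto
  also have "\<dots> = ?m \<beta>"
    using assms by (subst sum.delta[OF finite_exponents]) simp
  finally show "?m \<beta> = (\<Sum>\<alpha> | (\<Sum>i\<in>UNIV. \<alpha> i) = d. (if \<alpha> = \<beta> then 1 else 0) * ?m \<alpha>)"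
    by simp
qed

lemma is_form_mult:
  assumes "is_form d f" "is_form e g"
  shows "is_form (d + e) (\<lambda>v. f v * g v)"
proof -
  from assms obtain a b where
    a: "f = (\<lambda>v. \<Sum>\<alpha> | (\<Sum>i\<in>UNIV. \<alpha> i) = d. a \<alpha> * (\<Prod>i\<in>UNIV. (v $ i) ^ \<alpha> i))" and
    b: "g = (\<lambda>v. \<Sum>\<alpha> | (\<Sum>i\<in>UNIV. \<alpha> i) = e. b \<alpha> * (\<Prod>i\<in>UNIV. (v $ i) ^ \<alpha> i))"
    unfolding is_form_def by blast
  have "is_form (d + e) (\<lambda>v. \<Sum>\<alpha> | (\<Sum>i\<in>UNIV. \<alpha> i) = d. \<Sum>\<beta> | (\<Sum>i\<in>UNIV. \<beta> i) = e.
      (a \<alpha> * b \<beta>) * (\<Prod>i\<in>UNIV. (v $ i) ^ (\<alpha> i + \<beta> i)))"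
    by (intro is_form_sum is_form_const_mult is_form_monomial) (auto simp: sum.distrib)
  also have "(\<lambda>v. \<Sum>\<alpha> | (\<Sum>i\<in>UNIV. \<alpha> i) = d. \<Sum>\<beta> | (\<Sum>i\<in>UNIV. \<beta> i) = e.
      (a \<alpha> * b \<beta>) * (\<Prod>i\<in>UNIV. (v $ i) ^ (\<alpha> i + \<beta> i))) = (\<lambda>v. f v * g v)"
    unfolding a b by (simp add: sum_product power_add prod.distrib mult_ac)
  finally show ?thesis .
qed

lemma is_form_const: "is_form 0 (\<lambda>v. c)"
  using is_form_const_mult[OF is_form_monomial[of "\<lambda>_. 0" 0], of c] by simp

lemma is_form_power:
  assumes "is_form d f"
  shows "is_form (n * d) (\<lambda>v. f v ^ n)"
  using assms by (induction n) (auto intro: is_form_const is_form_mult)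

lemma is_form_prod:
  assumes "finite A" "\<And>x. x \<in> A \<Longrightarrow> is_form (e x) (f x)"
  shows "is_form (\<Sum>x\<in>A. e x) (\<lambda>v. \<Prod>x\<in>A. f x v)"
  using assms by (induction A) (auto intro: is_form_const is_form_mult)

lemma is_form_coord: "is_form 1 (\<lambda>v. v $ i)"
proof -
  have *: "(\<Sum>j\<in>UNIV. if j = i then 1 else 0) = (1::nat)"
    by simp
  have "(\<Prod>j\<in>UNIV. (v $ j) ^ (if j = i then 1 else 0)) = v $ i" for v :: "complex ^ 'a"
    by (simp add: if_distrib[of "\<lambda>n. _ ^ n"] prod.If_cases)
  with is_form_monomial[OF *] show ?thesis by simp
qed

lemma is_form_1_iff: "is_form 1 f \<longleftrightarrow> (\<exists>c. f = (\<lambda>v. \<Sum>i\<in>UNIV. c i * v $ i))"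
  (is "_ \<longleftrightarrow> ?R")
proof
  assume "is_form 1 f"
  then obtain a where a: "f = (\<lambda>v. \<Sum>\<alpha> | (\<Sum>i\<in>UNIV. \<alpha> i) = 1. a \<alpha> * (\<Prod>i\<in>UNIV. (v $ i) ^ \<alpha> i))"
    unfolding is_form_def by blast
  let ?u = "\<lambda>i j :: 'a. if j = i then 1 else 0 :: nat"
  have *: "{\<alpha>. (\<Sum>i\<in>UNIV. \<alpha> i) = (1::nat)} = range ?u"
  proof (intro equalityI subsetI)
    fix \<alpha> :: "'a \<Rightarrow> nat" assume "\<alpha> \<in> {\<alpha>. (\<Sum>i\<in>UNIV. \<alpha> i) = 1}"
    then obtain i where "\<alpha> i = 1" "\<forall>j. i \<noteq> j \<longrightarrow> \<alpha> j = 0"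
      using sum_eq_1_iff[of "UNIV::'a set" \<alpha>] by auto
    then have "\<alpha> = ?u i" by auto
    then show "\<alpha> \<in> range ?u" by blast
  qed auto
  have inj: "inj ?u" by (rule injI, drule_tac x = x in fun_cong) (auto split: if_splits)
  have "f = (\<lambda>v. \<Sum>i\<in>UNIV. a (?u i) * v $ i)"
    unfolding a * sum.reindex[OF inj] o_def
    by (simp add: if_distrib[of "\<lambda>n. _ ^ n"] prod.If_cases)
  then show ?R by (intro exI[of _ "\<lambda>i. a (?u i)"])
next
  assume ?R
  then show "is_form 1 f"
    by (auto intro!: is_form_sum is_form_const_mult is_form_coord simp del: One_nat_def)
qed

lemma is_form_linear:
  assumes "is_form 1 f"
  shows "f (x + y) = f x + f y" and "f (c *s x) = c * f x" and "f 0 = 0"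
    and "f (x - y) = f x - f y"
proof -
  from assms obtain a where a: "f = (\<lambda>v. \<Sum>i\<in>UNIV. a i * v $ i)"
    unfolding is_form_1_iff by blast
  show "f (x + y) = f x + f y" "f (c *s x) = c * f x" "f 0 = 0"
    "f (x - y) = f x - f y"
    unfolding a
    by (simp_all add: algebra_simps sum.distrib sum_distrib_left sum_subtractf)
qed

lemma is_form_smult:
  assumes "is_form d f"
  shows "f (c *s v) = c ^ d * f v"
proof -
  from assms obtain a where a: "f = (\<lambda>v. \<Sum>\<alpha> | (\<Sum>i\<in>UNIV. \<alpha> i) = d. a \<alpha> * (\<Prod>i\<in>UNIV. (v $ i) ^ \<alpha> i))"
    unfolding is_form_def by blast
  have "(\<Prod>i\<in>UNIV. ((c *s v) $ i) ^ \<alpha> i) = c ^ d * (\<Prod>i\<in>UNIV. (v $ i) ^ \<alpha> i)"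
    if "(\<Sum>i\<in>UNIV. \<alpha> i) = d" for \<alpha>
    using that by (simp add: power_mult_distrib prod.distrib power_sum[symmetric])
  then show ?thesis unfolding a sum_distrib_left
    by (intro sum.cong) auto
qed

lemma span_singleton_iff: "w \<in> vec.span {v} \<longleftrightarrow> (\<exists>c. w = c *s v)"
  by (auto simp: vec.span_singleton)

lemma proj_point_iff:
  "vec.span {v} \<in> proj_space \<longleftrightarrow> v \<noteq> 0"
proof
  assume "vec.span {v} \<in> proj_space"
  then obtain w where w: "w \<noteq> 0" "vec.span {v} = vec.span {w}" by (auto simp: proj_space_def)
  then have "w \<in> vec.span {v}" by (simp add: vec.span_base)
  then show "v \<noteq> 0" using w by (auto simp: span_singleton_iff)
qed (auto simp: proj_space_def)

lemma form_vanishes_on_span: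
  assumes "homogeneous f" "v \<noteq> 0"
  shows "(\<forall>w\<in>vec.span {v}. f w = 0) \<longleftrightarrow> f v = 0"
proof
  assume "\<forall>w\<in>vec.span {v}. f w = 0"
  then show "f v = 0" by (simp add: vec.span_base)
next
  assume *: "f v = 0"
  obtain d where "is_form d f" using assms by (auto simp: homogeneous_def)
  with * show "\<forall>w\<in>vec.span {v}. f w = 0"
    by (auto simp: span_singleton_iff is_form_smult)
qed

lemma span_in_zero_locus_iff:
  assumes "\<forall>f\<in>F. homogeneous f" "v \<noteq> 0"
  shows "vec.span {v} \<in> zero_locus F \<longleftrightarrow> (\<forall>f\<in>F. f v = 0)"
  using assms form_vanishes_on_span[OF _ assms(2)]
  unfolding zero_locus_def mem_Collect_eq proj_point_iff by blast

lemma span_eq_iff: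
  assumes "v \<noteq> 0"
  shows "vec.span {v} = vec.span {w} \<longleftrightarrow> (\<exists>c. c \<noteq> 0 \<and> w = c *s v)"
proof
  assume *: "vec.span {v} = vec.span {w}"
  then have "w \<in> vec.span {v}" "v \<in> vec.span {w}" by (metis vec.span_base singletonI)+
  then show "\<exists>c. c \<noteq> 0 \<and> w = c *s v" using assms by (auto simp: span_singleton_iff)
next
  assume "\<exists>c. c \<noteq> 0 \<and> w = c *s v"
  then obtain c where c: "c \<noteq> 0" "w = c *s v" by blast
  have "a *s v = (a / c) *s w" "a *s w = (a * c) *s v" for a
    using c by auto
  then show "vec.span {v} = vec.span {w}"
    unfolding vec.span_singleton by blast
qed

section \<open>Discriminants\<close>

lemma is_form_det:
  assumes "\<And>a. M a \<in> carrier_mat n n"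
    and "\<And>i j. i < n \<Longrightarrow> j < n \<Longrightarrow> is_form 1 (\<lambda>a. M a $$ (i, j))"
  shows "is_form n (\<lambda>a :: complex ^ 'n. Determinant.det (M a))"
proof -
  have "is_form n (\<lambda>a. \<Sum>p | p permutes {0..<n}. signof p * (\<Prod>i = 0..<n. M a $$ (i, p i)))"
  proof (intro is_form_sum is_form_const_mult)
    fix p assume "p \<in> {p. p permutes {0..<n}}"
    then have p: "p permutes {0..<n}" by simp
    have "is_form (\<Sum>i=0..<n. 1) (\<lambda>a. \<Prod>i = 0..<n. M a $$ (i, p i))"
      by (intro is_form_prod assms(2)) (use permutes_in_image[OF p] in auto)
    then show "is_form n (\<lambda>a. \<Prod>i = 0..<n. M a $$ (i, p i))" by simp
  qed
  then show ?thesis by (simp add: det_def'[OF assms(1)])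
qed

text \<open>The Sylvester determinant is taken for the fixed formal degrees \<open>Suc n\<close> and
  \<open>n\<close>, so that it remains a form in \<open>a\<close> where the degree of
  \<open>q a\<close> drops; at full degree it is the resultant of \<open>q a\<close> and its
  derivative. The extra factor \<open>coeff (q a) (Suc n)\<close> makes \<open>D\<close> vanish also
  when a root moves to infinity.\<close>

lemma discriminant_form:
  fixes q :: "complex ^ 'n \<Rightarrow> complex poly"
  assumes deg: "\<And>a. degree (q a) \<le> Suc n"
    and coeff: "\<And>i. is_form 1 (\<lambda>a. coeff (q a) i)"
  obtains D where "homogeneous D"
    and "\<And>a. D a \<noteq> 0 \<longleftrightarrow> degree (q a) = Suc n \<and> rsquarefree (q a)"
proof -
  define R where "R a = resultant_sub (Suc n) n (q a) (pderiv (q a))" for a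
  define D where "D a = coeff (q a) (Suc n) * R a" for a
  have 1: "is_form (Suc n + n) R"
    unfolding R_def resultant_sub_def
  proof (intro is_form_det)
    fix i j assume ij: "i < Suc n + n" "j < Suc n + n"
    show "is_form 1 (\<lambda>a. sylvester_mat_sub (Suc n) n (q a) (pderiv (q a)) $$ (i, j))"
      unfolding sylvester_mat_sub_index[OF ij]
      unfolding coeff_pderiv by (intro is_form_if assms(2) is_form_zero is_form_const_mult)
  qed (rule sylvester_mat_sub_carrier)
  have "is_form (1 + (Suc n + n)) D"
    unfolding D_def by (intro is_form_mult coeff 1)
  then have "homogeneous D" by (auto simp: homogeneous_def)
  moreover have "D a \<noteq> 0 \<longleftrightarrow> degree (q a) = Suc n \<and> rsquarefree (q a)" for a
  proof -
    have dq: "coeff (q a) (Suc n) \<noteq> 0 \<longleftrightarrow> degree (q a) = Suc n"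
      using deg[of a] le_degree[of "q a" "Suc n"] leading_coeff_0_iff[of "q a"] by (metis degree_0 le_antisym nat.distinct(1))
    have "R a \<noteq> 0 \<longleftrightarrow> rsquarefree (q a)" if d: "degree (q a) = Suc n"
    proof -
      have "R a = resultant (q a) (pderiv (q a))"
        unfolding R_def resultant_sub by (simp add: d degree_pderiv)
      then have "R a \<noteq> 0 \<longleftrightarrow> degree (gcd (q a) (pderiv (q a))) = 0"
        by (simp add: resultant_0_gcd)
      also have "\<dots> \<longleftrightarrow> (\<forall>x. \<not> (poly (q a) x = 0 \<and> poly (pderiv (q a)) x = 0))"
      proof
        assume *: "degree (gcd (q a) (pderiv (q a))) = 0"
        have "gcd (q a) (pderiv (q a)) \<noteq> 0" using d by auto
        then have "\<not> [:- x, 1:] dvd gcd (q a) (pderiv (q a))" for x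
          using * dvd_imp_degree_le[of "[:- x, 1:]" "gcd (q a) (pderiv (q a))"] by auto
        then show "\<forall>x. \<not> (poly (q a) x = 0 \<and> poly (pderiv (q a)) x = 0)"
          by (simp add: poly_eq_0_iff_dvd)
      next
        assume *: "\<forall>x. \<not> (poly (q a) x = 0 \<and> poly (pderiv (q a)) x = 0)"
        show "degree (gcd (q a) (pderiv (q a))) = 0"
        proof (rule ccontr)
          assume "degree (gcd (q a) (pderiv (q a))) \<noteq> 0"
          then obtain x where "poly (gcd (q a) (pderiv (q a))) x = 0"
            using fundamental_theorem_of_algebra[of "gcd (q a) (pderiv (q a))"] by (auto simp: constant_degree)
          then have "[:- x, 1:] dvd q a" "[:- x, 1:] dvd pderiv (q a)"
            unfolding poly_eq_0_iff_dvd by (rule dvd_trans, simp)+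
          then show False using * by (simp add: poly_eq_0_iff_dvd)
        qed
      qed
      also have "\<dots> \<longleftrightarrow> rsquarefree (q a)" by (simp add: rsquarefree_roots)
      finally show ?thesis .
    qed
    then show ?thesis unfolding D_def using dq by auto
  qed
  ultimately show ?thesis by (rule that)
qed

lemma card_roots_rsquarefree:
  fixes p :: "complex poly"
  assumes "rsquarefree p"
  shows "finite {x. poly p x = 0}" and "card {x. poly p x = 0} = degree p"
proof -
  have p: "p \<noteq> 0" using assms by (simp add: rsquarefree_def)
  show "finite {x. poly p x = 0}" using p by (rule poly_roots_finite)
  have "degree p = size (proots p)" by (rule size_proots_complex[symmetric])
  also have "\<dots> = (\<Sum>x\<in>set_mset (proots p). count (proots p) x)" by (rule size_multiset_overloaded_eq)
  also have "\<dots> = (\<Sum>x\<in>set_mset (proots p). 1)"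
    using assms p by (intro sum.cong) (auto simp: rsquarefree_root_order)
  also have "\<dots> = card {x. poly p x = 0}" using p by (simp add: set_count_proots)
  finally show "card {x. poly p x = 0} = degree p" ..
qed

section \<open>Binary forms\<close>

text \<open>The formal degree \<open>n\<close> is kept apart from the degree of the dehomogenisation
  \<open>p\<close>: when the latter drops, roots have moved to \<open>(1 : 0)\<close>, and
  \<open>coeff p n\<close> is the value there. Zeros on the projective line thereby become roots of
  \<open>p\<close> and possibly one more point.\<close>

definition binary_form :: "nat \<Rightarrow> (complex \<Rightarrow> complex \<Rightarrow> complex) \<Rightarrow> bool" where
  "binary_form n P \<longleftrightarrow> (\<exists>p. degree p \<le> n \<and>
     (\<forall>s t. P s t = (if t = 0 then coeff p n * s ^ n else t ^ n * poly p (s / t))))"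

lemma poly_sum_le_degree:
  fixes p :: "complex poly"
  assumes "degree p \<le> n"
  shows "poly p x = (\<Sum>i\<le>n. coeff p i * x ^ i)"
  unfolding poly_altdef using assms
  by (intro sum.mono_neutral_left) (auto simp: coeff_eq_0)

lemma binary_form_sum_formula:
  fixes p :: "complex poly"
  assumes "degree p \<le> n"
  shows "(if t = 0 then coeff p n * s ^ n else t ^ n * poly p (s / t))
     = (\<Sum>i\<le>n. coeff p i * s ^ i * t ^ (n - i))"
proof (cases "t = 0")
  case True
  have "(\<Sum>i\<le>n. coeff p i * s ^ i * t ^ (n - i)) = (\<Sum>i\<le>n. if i = n then coeff p i * s ^ i else 0)"
    using True by (intro sum.cong) auto
  then show ?thesis using True by simp
next
  case False
  have "t ^ n * (coeff p i * (s / t) ^ i) = coeff p i * s ^ i * t ^ (n - i)" if "i \<le> n" for i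
    using that False by (simp add: power_divide power_diff)
  then show ?thesis using False
    unfolding poly_sum_le_degree[OF assms] by (auto simp: sum_distrib_left intro!: sum.cong)
qed

lemma binary_form_imp_sum:
  assumes "binary_form n P"
  obtains c where "\<And>s t. P s t = (\<Sum>i\<le>n. c i * s ^ i * t ^ (n - i))"
proof -
  from assms obtain p where p: "degree p \<le> n"
    "\<And>s t. P s t = (if t = 0 then coeff p n * s ^ n else t ^ n * poly p (s / t))"
    unfolding binary_form_def by blast
  show ?thesis by (rule that[of "coeff p"]) (simp only: p(2) binary_form_sum_formula[OF p(1)])
qed

lemma binary_form_polyE:
  assumes "binary_form n P"
  obtains p where "degree p \<le> n" "\<And>r. P r 1 = poly p r" "P 1 0 = coeff p n"
  using assms unfolding binary_form_def by force

lemma binary_form_scale: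
  assumes "binary_form n P"
  shows "P (c * s) (c * t) = c ^ n * P s t"
proof -
  obtain a where a: "\<And>s t. P s t = (\<Sum>i\<le>n. a i * s ^ i * t ^ (n - i))"
    using binary_form_imp_sum[OF assms] by blast
  have "c ^ i * c ^ (n - i) = c ^ n" if "i \<le> n" for i
    using that by (simp flip: power_add)
  then show ?thesis unfolding a sum_distrib_left
    by (intro sum.cong refl) (auto simp: power_mult_distrib mult_ac)
qed

lemma binary_form_const: "binary_form 0 (\<lambda>s t. c)"
  unfolding binary_form_def by (rule exI[of _ "[:c:]"]) simp

lemma binary_form_fst: "binary_form 1 (\<lambda>s t. s)"
  unfolding binary_form_def by (rule exI[of _ "[:0, 1:]"]) simp

lemma binary_form_snd: "binary_form 1 (\<lambda>s t. t)"
  unfolding binary_form_def by (rule exI[of _ 1]) simp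

lemma binary_form_zero: "binary_form n (\<lambda>s t. 0)"
  unfolding binary_form_def by (rule exI[of _ 0]) simp

lemma binary_form_add:
  assumes "binary_form n P" "binary_form n Q"
  shows "binary_form n (\<lambda>s t. P s t + Q s t)"
proof -
  from assms obtain p q where "degree p \<le> n"
    "\<And>s t. P s t = (if t = 0 then coeff p n * s ^ n else t ^ n * poly p (s / t))"
    "degree q \<le> n" "\<And>s t. Q s t = (if t = 0 then coeff q n * s ^ n else t ^ n * poly q (s / t))"
    unfolding binary_form_def by blast
  then show ?thesis unfolding binary_form_def
    by (intro exI[of _ "p + q"]) (auto simp: algebra_simps degree_add_le)
qed

lemma coeff_mult_top:
  fixes p q :: "'a :: comm_semiring_0 poly"
  assumes "degree p \<le> m" "degree q \<le> n"
  shows "coeff (p * q) (m + n) = coeff p m * coeff q n"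
proof (cases "degree p = m \<and> degree q = n")
  case True
  then show ?thesis by (metis coeff_mult_degree_sum)
next
  case False
  then have lt: "degree p < m \<or> degree q < n" using assms by auto
  have "degree (p * q) < m + n"
    using degree_mult_le[of p q] assms lt by linarith
  then show ?thesis using lt by (auto simp: coeff_eq_0)
qed

lemma binary_form_mult:
  assumes "binary_form m P" "binary_form n Q"
  shows "binary_form (m + n) (\<lambda>s t. P s t * Q s t)"
proof -
  from assms obtain p q where "degree p \<le> m"
    "\<And>s t. P s t = (if t = 0 then coeff p m * s ^ m else t ^ m * poly p (s / t))"
    "degree q \<le> n" "\<And>s t. Q s t = (if t = 0 then coeff q n * s ^ n else t ^ n * poly q (s / t))"
    unfolding binary_form_def by blast
  then show ?thesis unfolding binary_form_def
    by (intro exI[of _ "p * q"])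
       (auto simp: power_add mult_ac coeff_mult_top intro: order.trans[OF degree_mult_le])
qed

lemma binary_form_cmult:
  assumes "binary_form n P"
  shows "binary_form n (\<lambda>s t. c * P s t)"
  using binary_form_mult[OF binary_form_const assms] by simp

lemma binary_form_diff:
  assumes "binary_form n P" "binary_form n Q"
  shows "binary_form n (\<lambda>s t. P s t - Q s t)"
  using binary_form_add[OF assms(1) binary_form_cmult[OF assms(2), of "-1"]] by simp

lemma binary_form_sum:
  assumes "\<And>x. x \<in> A \<Longrightarrow> binary_form n (f x)"
  shows "binary_form n (\<lambda>s t. \<Sum>x\<in>A. f x s t)"
  using assms by (induction A rule: infinite_finite_induct)
    (auto intro: binary_form_zero binary_form_add)

lemma binary_form_power:
  assumes "binary_form n P"
  shows "binary_form (k * n) (\<lambda>s t. P s t ^ k)"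
  using assms by (induction k) (auto intro: binary_form_const binary_form_mult)

lemma binary_form_prod:
  assumes "finite A" "\<And>x. x \<in> A \<Longrightarrow> binary_form (e x) (f x)"
  shows "binary_form (\<Sum>x\<in>A. e x) (\<lambda>s t. \<Prod>x\<in>A. f x s t)"
  using assms by (induction A) (auto intro: binary_form_const binary_form_mult)

lemma is_form_binary_form:
  assumes "binary_form n P" "is_form d f" "is_form d g"
  shows "is_form (n * d) (\<lambda>v. P (f v) (g v))"
proof -
  obtain a where a: "\<And>s t. P s t = (\<Sum>i\<le>n. a i * s ^ i * t ^ (n - i))"
    using binary_form_imp_sum[OF assms(1)] by blast
  have "is_form (n * d) (\<lambda>v. a i * f v ^ i * g v ^ (n - i))" if "i \<le> n" for i
  proof -
    have "is_form (i * d + (n - i) * d) (\<lambda>v. a i * (f v ^ i * g v ^ (n - i)))"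
      by (intro is_form_const_mult is_form_mult is_form_power assms)
    moreover have "i * d + (n - i) * d = n * d"
      using that by (simp flip: add_mult_distrib)
    ultimately show ?thesis by (simp add: mult.assoc)
  qed
  then show ?thesis unfolding a by (auto intro: is_form_sum)
qed

lemma binary_form_is_form:
  assumes "is_form e f" "\<And>i. binary_form d (\<lambda>s t. x s t $ i)"
  shows "binary_form (e * d) (\<lambda>s t. f (x s t))"
proof -
  from assms obtain a where a: "f = (\<lambda>v. \<Sum>\<alpha> | (\<Sum>i\<in>UNIV. \<alpha> i) = e. a \<alpha> * (\<Prod>i\<in>UNIV. (v $ i) ^ \<alpha> i))"
    unfolding is_form_def by blast
  have "binary_form (e * d) (\<lambda>s t. a \<alpha> * (\<Prod>i\<in>UNIV. (x s t $ i) ^ \<alpha> i))"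
    if "(\<Sum>i\<in>UNIV. \<alpha> i) = e" for \<alpha>
  proof -
    have "binary_form (\<Sum>i\<in>UNIV. \<alpha> i * d) (\<lambda>s t. \<Prod>i\<in>UNIV. (x s t $ i) ^ \<alpha> i)"
      by (intro binary_form_prod binary_form_power assms) auto
    then show ?thesis using that by (auto simp flip: sum_distrib_right intro: binary_form_cmult)
  qed
  then show ?thesis unfolding a by (auto intro: binary_form_sum)
qed

lemma binary_form_differentiable:
  assumes "binary_form n P"
  shows "\<exists>D. ((\<lambda>z. P (s0 + z * s1) (t0 + z * t1)) has_field_derivative D) (at z)"
proof -
  obtain a where a: "\<And>s t. P s t = (\<Sum>i\<le>n. a i * s ^ i * t ^ (n - i))"
    using binary_form_imp_sum[OF assms] by blast
  have "(\<lambda>z. P (s0 + z * s1) (t0 + z * t1)) field_differentiable at z"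
    unfolding a by (intro derivative_intros)
  then show ?thesis by (simp add: field_differentiable_def)
qed

text \<open>Bertini's theorem for a pencil on the projective line. Without base points the pencil is
  the map \<open>- p / q\<close>, and the members with a multiple root lie over its critical values.
  The critical points are zeros of the Wronskian \<open>W\<close>, hence finite in number; one more
  value of \<open>c\<close> may be lost to a root at infinity.\<close>

lemma generic_member_squarefree:
  fixes p q :: "complex poly"
  assumes nc: "\<And>x. poly p x = 0 \<Longrightarrow> poly q x = 0 \<Longrightarrow> False"
    and deg: "degree p \<le> n" "degree q \<le> n" and top: "coeff p n \<noteq> 0 \<or> coeff q n \<noteq> 0"
  shows "finite {c. \<not> (degree (p + Polynomial.smult c q) = n \<and> rsquarefree (p + Polynomial.smult c q))}"
    (is "finite {c. \<not> ?good c}")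
proof -
  define W where "W = pderiv p * q - p * pderiv q"
  have cop: "coprime p q"
  proof (rule coprimeI)
    fix c assume c: "c dvd p" "c dvd q"
    show "is_unit c"
    proof (rule ccontr)
      assume "\<not> is_unit c"
      moreover have "c \<noteq> 0" using c top by auto
      ultimately have "degree c \<noteq> 0" by (simp add: is_unit_iff_degree)
      then obtain x where "poly c x = 0"
        using fundamental_theorem_of_algebra[of c] by (auto simp: constant_degree)
      then have "[:- x, 1:] dvd p" "[:- x, 1:] dvd q"
        using c unfolding poly_eq_0_iff_dvd by (auto intro: dvd_trans)
      then show False using nc by (simp add: poly_eq_0_iff_dvd)
    qed
  qed
  have pd: "degree p = 0" if "p dvd pderiv p" for p :: "complex poly"
  proof (rule ccontr)
    assume "degree p \<noteq> 0"
    then have "pderiv p \<noteq> 0" by (simp add: pderiv_eq_0_iff)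
    then have "degree p \<le> degree (pderiv p)" using that by (rule dvd_imp_degree_le[rotated])
    then show False using \<open>degree p \<noteq> 0\<close> by (simp add: degree_pderiv)
  qed
  \<comment> \<open>For \<open>W = 0\<close> coprimality gives \<open>p dvd pderiv p\<close> and
    \<open>q dvd pderiv q\<close>, so both are constant, against \<open>top\<close> when
    \<open>n\<close> is positive.\<close>
  have W0: "W \<noteq> 0" if n: "n \<noteq> 0"
  proof
    assume "W = 0"
    then have eq: "pderiv p * q = p * pderiv q" by (simp add: W_def)
    have "p dvd pderiv p * q" "q dvd p * pderiv q" using eq by (metis dvd_triv_left dvd_triv_right)+
    then have "p dvd pderiv p" "q dvd pderiv q"
      using cop by (auto simp: coprime_dvd_mult_left_iff coprime_dvd_mult_right_iff coprime_commute)
    then have "degree p = 0" "degree q = 0" by (auto dest: pd)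
    then show False using top n by (auto simp: coeff_eq_0)
  qed
  have "finite {c. coeff p n + c * coeff q n = 0}"
  proof (cases "coeff q n = 0")
    case False
    then have "{c. coeff p n + c * coeff q n = 0} \<subseteq> {- coeff p n / coeff q n}"
      by (auto simp: field_simps add_eq_0_iff)
    then show ?thesis by (rule finite_subset) simp
  qed (use top in auto)
  \<comment> \<open>For \<open>n = 0\<close> the Wronskian is zero and every point would be a root;
    the guard \<open>n \<noteq> 0\<close> empties the set, as nonzero constants have no multiple
    roots anyway.\<close>
  moreover have "finite ((\<lambda>x. - poly p x / poly q x) ` {x. n \<noteq> 0 \<and> poly W x = 0})"
    using W0 poly_roots_finite[of W] by (intro finite_imageI) (cases "n = 0", auto)
  moreover have "{c. \<not> ?good c} \<subseteq> {c. coeff p n + c * coeff q n = 0} \<union>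
      (\<lambda>x. - poly p x / poly q x) ` {x. n \<noteq> 0 \<and> poly W x = 0}"
  proof
    fix c assume "c \<in> {c. \<not> ?good c}"
    then have bad: "\<not> ?good c" by simp
    define P where "P = p + Polynomial.smult c q"
    have degP: "degree P \<le> n" unfolding P_def
      using deg by (intro degree_add_le) (auto intro: order.trans[OF degree_smult_le])
    show "c \<in> {c. coeff p n + c * coeff q n = 0} \<union>
      (\<lambda>x. - poly p x / poly q x) ` {x. n \<noteq> 0 \<and> poly W x = 0}"
    proof (cases "coeff P n = 0")
      case True
      then show ?thesis by (simp add: P_def)
    next
      case False
      then have dP: "degree P = n" using degP le_degree[of P n] by simp
      with bad have "\<not> rsquarefree P" by (simp add: P_def)
      then obtain x where x: "poly P x = 0" "poly (pderiv P) x = 0"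
        by (auto simp: rsquarefree_roots)
      have 1: "poly p x = - (c * poly q x)"
        using x(1) by (simp add: P_def add_eq_0_iff)
      have 2: "poly (pderiv p) x = - (c * poly (pderiv q) x)"
        using x(2) by (simp add: P_def pderiv_add pderiv_smult add_eq_0_iff)
      have "n \<noteq> 0"
      proof
        assume "n = 0"
        then have "P = [:coeff P 0:]" using dP by (metis degree_eq_zeroE coeff_pCons_0)
        then have "poly P x = coeff P 0" by (metis poly_pCons mult_zero_right add.right_neutral poly_0)
        with x False \<open>n = 0\<close> show False by simp
      qed
      moreover have "poly W x = 0" by (simp add: W_def 1 2 algebra_simps)
      moreover have "poly q x \<noteq> 0" using nc[of x] 1 by auto
      then have "c = - poly p x / poly q x" by (simp add: 1)
      ultimately show ?thesis by blast
    qed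
  qed
  ultimately show ?thesis by (meson finite_Un finite_subset)
qed

section \<open>Closed sets\<close>

lemma zariski_closed_Un:
  assumes "zariski_closed A" "zariski_closed B"
  shows "zariski_closed (A \<union> B)"
proof -
  obtain F G where F: "\<forall>f\<in>F. homogeneous f" "A = zero_locus F"
    and G: "\<forall>g\<in>G. homogeneous g" "B = zero_locus G"
    using assms by (auto simp: zariski_closed_def)
  define H where "H = {(\<lambda>v. f v * g v) | f g. f \<in> F \<and> g \<in> G}"
  have H: "\<forall>h\<in>H. homogeneous h"
    using F(1) G(1) unfolding H_def homogeneous_def by (blast intro: is_form_mult)
  have "P \<in> A \<union> B \<longleftrightarrow> P \<in> zero_locus H" for P
  proof (cases "P \<in> proj_space")
    case True
    then obtain v where v: "P = vec.span {v}" "v \<noteq> 0" by (auto simp: proj_space_def)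
    have "(\<exists>f\<in>F. f v \<noteq> 0) \<and> (\<exists>g\<in>G. g v \<noteq> 0) \<longleftrightarrow> (\<exists>h\<in>H. h v \<noteq> 0)"
      unfolding H_def by force
    then show ?thesis
      unfolding v(1) Un_iff F(2) G(2) span_in_zero_locus_iff[OF F(1) v(2)]
        span_in_zero_locus_iff[OF G(1) v(2)] span_in_zero_locus_iff[OF H v(2)]
      by blast
  next
    case False
    then show ?thesis by (auto simp: F G zero_locus_def)
  qed
  then show ?thesis using H by (auto simp: zariski_closed_def)
qed

lemma zariski_closed_point:
  assumes "P \<in> proj_space"
  shows "zariski_closed {P}"
proof -
  obtain v where v: "P = vec.span {v}" "v \<noteq> 0" using assms by (auto simp: proj_space_def)
  obtain i where i: "v $ i \<noteq> 0" using v(2) by (auto simp: Finite_Cartesian_Product.vec_eq_iff)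
  \<comment> \<open>The two by two minors of \<open>v\<close> and \<open>x\<close> that involve a
    column with nonzero entry of \<open>v\<close>.\<close>
  define F where "F = range (\<lambda>j x. v $ i * x $ j - v $ j * x $ i)"
  have F: "\<forall>f\<in>F. homogeneous f"
    unfolding F_def homogeneous_def
    by (auto intro!: exI[of _ 1] is_form_diff is_form_const_mult is_form_coord
        simp del: One_nat_def)
  have "Q \<in> {P} \<longleftrightarrow> Q \<in> zero_locus F" for Q
  proof (cases "Q \<in> proj_space")
    case True
    then obtain w where w: "Q = vec.span {w}" "w \<noteq> 0" by (auto simp: proj_space_def)
    have "Q = P \<longleftrightarrow> (\<exists>c. c \<noteq> 0 \<and> w = c *s v)"
      using span_eq_iff[OF v(2), of w] by (auto simp: v w)
    also have "\<dots> \<longleftrightarrow> (\<forall>j. v $ i * w $ j = v $ j * w $ i)"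
    proof
      assume *: "\<forall>j. v $ i * w $ j = v $ j * w $ i"
      have "w = (w $ i / v $ i) *s v"
        using * i by (simp add: Finite_Cartesian_Product.vec_eq_iff field_simps)
      moreover from this have "w $ i / v $ i \<noteq> 0" using w(2) by (metis vec.scale_eq_0_iff)
      ultimately show "\<exists>c. c \<noteq> 0 \<and> w = c *s v" by blast
    qed auto
    also have "\<dots> \<longleftrightarrow> Q \<in> zero_locus F"
      unfolding w(1) span_in_zero_locus_iff[OF F w(2)] by (auto simp: F_def)
    finally show ?thesis by simp
  next
    case False
    then show ?thesis using assms by (auto simp: zero_locus_def)
  qed
  then show ?thesis using F by (auto simp: zariski_closed_def)
qed

lemma zariski_closed_finite:
  assumes "finite X" "X \<subseteq> proj_space"
  shows "zariski_closed X"
  using assms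
proof (induction X)
  case empty
  have "homogeneous (\<lambda>v :: complex ^ 'a. 1)" using is_form_const by (auto simp: homogeneous_def)
  moreover have "{} = zero_locus {\<lambda>v :: complex ^ 'a. 1}"
    by (auto simp: zero_locus_def proj_space_def intro: vec.span_base)
  ultimately show ?case by (auto simp: zariski_closed_def)
next
  case (insert P X)
  then show ?case using zariski_closed_Un[OF zariski_closed_point[of P]] by auto
qed

lemma finite_irreducible:
  assumes "finite X" "X \<subseteq> proj_space" "zariski_irreducible X"
  obtains P where "X = {P}"
proof -
  obtain P where P: "P \<in> X" using assms(3) by (auto simp: zariski_irreducible_def)
  have "zariski_closed {P}" "zariski_closed (X - {P})"
    using P assms by (auto intro!: zariski_closed_finite)
  moreover have "X \<subseteq> {P} \<union> (X - {P})" by auto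
  ultimately have "X \<subseteq> {P} \<or> X \<subseteq> X - {P}"
    using assms(3) unfolding zariski_irreducible_def by blast
  then have "X = {P}" using P by auto
  then show ?thesis by (rule that)
qed

text \<open>Irreducibility holds because an infinite set is not a union of two finite ones. In a
  chain of length two the middle member would be a proper closed subset, hence finite, hence by
  irreducibility a single point; nothing nonempty fits strictly below it.\<close>

lemma cofinite_curve:
  assumes closed: "zariski_closed C" and inf: "infinite C" and sub: "C \<subseteq> proj_space"
    and fin: "\<And>A. zariski_closed A \<Longrightarrow> \<not> C \<subseteq> A \<Longrightarrow> finite (A \<inter> C)"
  shows "zariski_irreducible C" and "has_dimension C 1"
proof -
  show irr: "zariski_irreducible C"
    unfolding zariski_irreducible_def
  proof (intro conjI allI impI)
    show "C \<noteq> {}" using inf by auto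
    fix A B assume AB: "zariski_closed A" "zariski_closed B" "C \<subseteq> A \<union> B"
    show "C \<subseteq> A \<or> C \<subseteq> B"
    proof (rule ccontr)
      assume "\<not> (C \<subseteq> A \<or> C \<subseteq> B)"
      then have "finite ((A \<inter> C) \<union> (B \<inter> C))" using fin AB by auto
      moreover have "(A \<inter> C) \<union> (B \<inter> C) = C" using AB by auto
      ultimately show False using inf by simp
    qed
  qed
  obtain P where P: "P \<in> C" using inf by (metis finite.emptyI ex_in_conv)
  have "has_irreducible_chain C 1"
    unfolding has_irreducible_chain_def
  proof (intro exI[of _ "\<lambda>i. if i = 0 then {P} else C"] conjI allI impI)
    fix i :: nat assume "i < 1"
    moreover have "{P} \<noteq> C" using inf by auto
    ultimately show "(if i = 0 then {P} else C) \<subset> (if Suc i = 0 then {P} else C)"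
      using P by auto
  qed (use P sub closed irr in \<open>auto intro: zariski_closed_point simp: zariski_irreducible_def\<close>)
  moreover have "\<not> has_irreducible_chain C (Suc 1)"
  proof
    assume "has_irreducible_chain C (Suc 1)"
    then obtain Z where Z: "\<forall>i\<le>Suc 1. zariski_closed (Z i) \<and> zariski_irreducible (Z i) \<and> Z i \<subseteq> C"
      "\<forall>i<Suc 1. Z i \<subset> Z (Suc i)" unfolding has_irreducible_chain_def by blast
    have Z01: "Z 0 \<subset> Z 1" and Z12: "Z 1 \<subset> Z (Suc 1)" using Z(2) by auto
    have Z1: "zariski_closed (Z 1)" "zariski_irreducible (Z 1)" "Z 1 \<subseteq> C" "Z (Suc 1) \<subseteq> C"
      using Z(1) by auto
    have "\<not> C \<subseteq> Z 1" using Z12 Z1 by blast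
    then have "finite (Z 1)" using fin[of "Z 1"] Z1 by (metis inf.absorb1)
    then obtain P where "Z 1 = {P}" using finite_irreducible Z1 sub by (metis order.trans)
    then have "Z 0 = {}" using Z01 by auto
    moreover have "zariski_irreducible (Z 0)" using Z(1) by auto
    ultimately show False by (simp add: zariski_irreducible_def)
  qed
  ultimately show "has_dimension C 1" by (simp add: has_dimension_def)
qed

section \<open>Tangent spaces\<close>

text \<open>\<open>G\<close> does not depend on the path. In this shape the statement passes through
  sums and products, and it serves two ends: straight lines give linearity of
  \<open>dir_deriv\<close> in the direction, arbitrary paths give the chain rule along a
  parametrised curve.\<close>

lemma form_gradient:
  fixes f :: "complex ^ 'n \<Rightarrow> complex"
  assumes "is_form d f"
  shows "\<exists>G. \<forall>\<gamma> \<gamma>' z. (\<forall>i. ((\<lambda>x. \<gamma> x $ i) has_field_derivative \<gamma>' $ i) (at z)) \<longrightarrow>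
     ((\<lambda>x. f (\<gamma> x)) has_field_derivative (\<Sum>i\<in>UNIV. G (\<gamma> z) i * \<gamma>' $ i)) (at z)"
    (is "?grad f")
proof -
  have sum: "?grad (\<lambda>v. \<Sum>x\<in>A. f x v)" if "\<And>x. x \<in> A \<Longrightarrow> ?grad (f x)"
    for A and f :: "'x \<Rightarrow> complex ^ 'n \<Rightarrow> complex"
  proof -
    from that have "\<forall>x. \<exists>G. x \<in> A \<longrightarrow> (\<forall>\<gamma> \<gamma>' z. (\<forall>i. ((\<lambda>x. \<gamma> x $ i) has_field_derivative \<gamma>' $ i) (at z)) \<longrightarrow>
     ((\<lambda>y. f x (\<gamma> y)) has_field_derivative (\<Sum>i\<in>UNIV. G (\<gamma> z) i * \<gamma>' $ i)) (at z))" by blast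
    then obtain G where "\<And>x. x \<in> A \<Longrightarrow> (\<forall>\<gamma> \<gamma>' z. (\<forall>i. ((\<lambda>x. \<gamma> x $ i) has_field_derivative \<gamma>' $ i) (at z)) \<longrightarrow>
     ((\<lambda>y. f x (\<gamma> y)) has_field_derivative (\<Sum>i\<in>UNIV. G x (\<gamma> z) i * \<gamma>' $ i)) (at z))" by metis
    then have "\<forall>\<gamma> \<gamma>' z. (\<forall>i. ((\<lambda>x. \<gamma> x $ i) has_field_derivative \<gamma>' $ i) (at z)) \<longrightarrow>
     ((\<lambda>y. \<Sum>x\<in>A. f x (\<gamma> y)) has_field_derivative (\<Sum>x\<in>A. \<Sum>i\<in>UNIV. G x (\<gamma> z) i * \<gamma>' $ i)) (at z)"
      by (auto intro!: DERIV_sum)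
    then show ?thesis
      by (intro exI[of _ "\<lambda>v i. \<Sum>x\<in>A. G x v i"])
         (simp add: sum_distrib_right sum.swap[of _ A])
  qed
  have mult: "?grad (\<lambda>v. f v * g v)" if "?grad f" "?grad g" for f g :: "complex ^ 'n \<Rightarrow> complex"
  proof -
    from that obtain G H where
     "\<forall>\<gamma> \<gamma>' z. (\<forall>i. ((\<lambda>x. \<gamma> x $ i) has_field_derivative \<gamma>' $ i) (at z)) \<longrightarrow>
     ((\<lambda>y. f (\<gamma> y)) has_field_derivative (\<Sum>i\<in>UNIV. G (\<gamma> z) i * \<gamma>' $ i)) (at z)"
     "\<forall>\<gamma> \<gamma>' z. (\<forall>i. ((\<lambda>x. \<gamma> x $ i) has_field_derivative \<gamma>' $ i) (at z)) \<longrightarrow>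
     ((\<lambda>y. g (\<gamma> y)) has_field_derivative (\<Sum>i\<in>UNIV. H (\<gamma> z) i * \<gamma>' $ i)) (at z)" by blast
    then have "\<forall>\<gamma> \<gamma>' z. (\<forall>i. ((\<lambda>x. \<gamma> x $ i) has_field_derivative \<gamma>' $ i) (at z)) \<longrightarrow>
     ((\<lambda>y. f (\<gamma> y) * g (\<gamma> y)) has_field_derivative ((\<Sum>i\<in>UNIV. G (\<gamma> z) i * \<gamma>' $ i) * g (\<gamma> z)
        + (\<Sum>i\<in>UNIV. H (\<gamma> z) i * \<gamma>' $ i) * f (\<gamma> z))) (at z)"
      by (auto intro!: DERIV_mult)
    then show ?thesis
      by (intro exI[of _ "\<lambda>v i. G v i * g v + H v i * f v"])
         (simp add: sum_distrib_left sum_distrib_right sum.distrib algebra_simps)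
  qed
  have const: "?grad (\<lambda>v. c)" for c :: complex
    by (rule exI[of _ "\<lambda>_ _. 0"]) auto
  have coord: "?grad (\<lambda>v. v $ j)" for j :: 'n
    by (rule exI[of _ "\<lambda>_ i. if i = j then 1 else 0"])
       (auto simp: if_distrib[of "\<lambda>c. c * _"] cong: if_cong)
  have power: "?grad (\<lambda>v. v $ j ^ k)" for j :: 'n and k
  proof (induction k)
    case (Suc k)
    show ?case unfolding power_Suc by (rule mult[OF coord Suc])
  qed (simp only: power_0 const)
  have prod: "?grad (\<lambda>v. \<Prod>i\<in>A. v $ i ^ \<alpha> i)" for A :: "'n set" and \<alpha>
    using finite[of A]
  proof (induction A)
    case (insert j A)
    show ?case unfolding prod.insert[OF insert(1,2)] by (rule mult[OF power insert(3)])
  qed (simp only: prod.empty const)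
  from assms obtain a where a: "f = (\<lambda>v. \<Sum>\<alpha> | (\<Sum>i\<in>UNIV. \<alpha> i) = d. a \<alpha> * (\<Prod>i\<in>UNIV. (v $ i) ^ \<alpha> i))"
    unfolding is_form_def by blast
  show ?thesis unfolding a by (intro sum mult const prod)
qed

lemma dir_deriv_form:
  assumes "homogeneous f"
  obtains G where "\<And>v w. dir_deriv f v w = (\<Sum>i\<in>UNIV. G v i * w $ i)"
    and "\<And>\<gamma> \<gamma>' z. (\<And>i. ((\<lambda>x. \<gamma> x $ i) has_field_derivative \<gamma>' $ i) (at z)) \<Longrightarrow>
     ((\<lambda>x. f (\<gamma> x)) has_field_derivative dir_deriv f (\<gamma> z) \<gamma>') (at z)"
proof -
  from assms obtain d where "is_form d f" by (auto simp: homogeneous_def)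
  from form_gradient[OF this] obtain G where "\<forall>\<gamma> \<gamma>' z. (\<forall>i. ((\<lambda>x. \<gamma> x $ i) has_field_derivative \<gamma>' $ i) (at z)) \<longrightarrow>
     ((\<lambda>x. f (\<gamma> x)) has_field_derivative (\<Sum>i\<in>UNIV. G (\<gamma> z) i * \<gamma>' $ i)) (at z)" ..
  then have G: "\<And>\<gamma> \<gamma>' z. (\<And>i. ((\<lambda>x. \<gamma> x $ i) has_field_derivative \<gamma>' $ i) (at z)) \<Longrightarrow>
     ((\<lambda>x. f (\<gamma> x)) has_field_derivative (\<Sum>i\<in>UNIV. G (\<gamma> z) i * \<gamma>' $ i)) (at z)"
    by blast
  have "((\<lambda>z. f (v + z *s w)) has_field_derivative (\<Sum>i\<in>UNIV. G (v + 0 *s w) i * w $ i)) (at 0)" for v w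
    by (rule G) (auto intro!: derivative_eq_intros)
  then have 1: "dir_deriv f v w = (\<Sum>i\<in>UNIV. G v i * w $ i)" for v w
    unfolding dir_deriv_def by (auto dest: DERIV_imp_deriv)
  show ?thesis by (rule that[of G]) (use 1 G in auto)
qed

lemma dir_deriv_chain:
  assumes "homogeneous f" "\<And>i. ((\<lambda>x. \<gamma> x $ i) has_field_derivative \<gamma>' $ i) (at z)"
  shows "((\<lambda>x. f (\<gamma> x)) has_field_derivative dir_deriv f (\<gamma> z) \<gamma>') (at z)"
  by (rule dir_deriv_form[OF assms(1)]) (use assms(2) in simp)

lemma dir_deriv_add_scale:
  assumes "homogeneous f"
  shows "dir_deriv f v (s *s x + t *s y) = s * dir_deriv f v x + t * dir_deriv f v y"
  by (rule dir_deriv_form[OF assms]) (simp add: sum_distrib_left sum.distrib algebra_simps)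

lemma subspace_cone_tangent_space: "vec.subspace (cone_tangent_space X v)"
proof (rule vec.subspaceI)
  show "0 \<in> cone_tangent_space X v"
    by (auto simp: cone_tangent_space_def dir_deriv_def)
next
  fix x y c assume xy: "x \<in> cone_tangent_space X v"
  show "c *s x \<in> cone_tangent_space X v"
    unfolding cone_tangent_space_def
  proof (intro CollectI allI impI)
    fix f assume f: "homogeneous f" "vanishes_on f X"
    have "dir_deriv f v x = 0" using xy f by (auto simp: cone_tangent_space_def)
    moreover have "dir_deriv f v (c *s x) = c * dir_deriv f v x"
      using dir_deriv_add_scale[OF f(1), of v c x 0] by simp
    ultimately show "dir_deriv f v (c *s x) = 0" by simp
  qed
  assume y: "y \<in> cone_tangent_space X v"
  show "x + y \<in> cone_tangent_space X v"
    unfolding cone_tangent_space_def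
  proof (intro CollectI allI impI)
    fix f assume f: "homogeneous f" "vanishes_on f X"
    have "dir_deriv f v x = 0" "dir_deriv f v y = 0" using xy y f by (auto simp: cone_tangent_space_def)
    moreover have "dir_deriv f v (x + y) = dir_deriv f v x + dir_deriv f v y"
      using dir_deriv_add_scale[OF f(1), of v 1 x 1 y] by simp
    ultimately show "dir_deriv f v (x + y) = 0" by simp
  qed
qed

lemma tangent_to_curve:
  assumes "\<And>i. ((\<lambda>x. \<gamma> x $ i) has_field_derivative \<gamma>' $ i) (at z)"
    and "\<And>f x. homogeneous f \<Longrightarrow> vanishes_on f X \<Longrightarrow> f (\<gamma> x) = 0"
  shows "\<gamma>' \<in> cone_tangent_space X (\<gamma> z)"
  unfolding cone_tangent_space_def
proof (intro CollectI allI impI)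
  fix f assume f: "homogeneous f" "vanishes_on f X"
  have "((\<lambda>x. f (\<gamma> x)) has_field_derivative dir_deriv f (\<gamma> z) \<gamma>') (at z)"
    using f(1) assms(1) by (rule dir_deriv_chain)
  then have "((\<lambda>x. 0) has_field_derivative dir_deriv f (\<gamma> z) \<gamma>') (at z)"
    using assms(2)[OF f] by simp
  then show "dir_deriv f (\<gamma> z) \<gamma>' = 0"
    using DERIV_const DERIV_unique by blast
qed

text \<open>The pair \<open>(f, g)\<close> maps \<open>T\<close> isomorphically onto the plane:
  \<open>rigid\<close> is injectivity, and the nonzero determinant on \<open>v\<close> and
  \<open>w\<close> gives surjectivity.\<close>

lemma dim_2_criterion:
  fixes T :: "(complex ^ 'n) set"
  assumes T: "vec.subspace T" "v \<in> T" "w \<in> T"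
    and lin: "is_form 1 f" "is_form 1 g"
    and v: "f v \<noteq> 0 \<or> g v \<noteq> 0" and w: "f v * g w \<noteq> g v * f w"
    and rigid: "\<And>x. x \<in> T \<Longrightarrow> f x = 0 \<Longrightarrow> g x = 0 \<Longrightarrow> x = 0"
  shows "vec.dim T = 2"
proof -
  note l = is_form_linear[OF lin(1)] is_form_linear[OF lin(2)]
  define \<Delta> where "\<Delta> = f v * g w - g v * f w"
  have \<Delta>: "\<Delta> \<noteq> 0" using w by (simp add: \<Delta>_def)
  have "T \<subseteq> vec.span {v, w}"
  proof
    fix x assume x: "x \<in> T"
    \<comment> \<open>Cramer's rule for the combination of \<open>v\<close> and \<open>w\<close> on
      which \<open>f\<close> and \<open>g\<close> take the same values as on
      \<open>x\<close>.\<close>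
    define a where "a = (f x * g w - g x * f w) / \<Delta>"
    define b where "b = (f v * g x - g v * f x) / \<Delta>"
    define y where "y = x - (a *s v + b *s w)"
    have "y \<in> T" unfolding y_def using T x
      by (simp add: vec.subspace_add vec.subspace_diff vec.subspace_scale)
    moreover have "f y * \<Delta> = f x * \<Delta> - (a * \<Delta>) * f v - (b * \<Delta>) * f w"
      "g y * \<Delta> = g x * \<Delta> - (a * \<Delta>) * g v - (b * \<Delta>) * g w"
      unfolding y_def by (simp_all add: l algebra_simps)
    then have "f y * \<Delta> = 0" "g y * \<Delta> = 0"
      using \<Delta> by (simp_all add: a_def b_def) (simp_all add: \<Delta>_def algebra_simps)
    then have "f y = 0" "g y = 0" using \<Delta> by auto
    ultimately have "y = 0" by (rule rigid)
    then have "x = a *s v + b *s w" by (simp add: y_def)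
    then show "x \<in> vec.span {v, w}"
      by (simp add: vec.span_add vec.span_scale vec.span_base)
  qed
  moreover have "v \<noteq> w" using w by auto
  moreover have "vec.independent {v, w}"
  proof (rule vec.independent_insertI)
    show "v \<notin> vec.span {w}"
      using w by (auto simp: span_singleton_iff l)
    have "w \<noteq> 0" using w by (auto simp: l)
    then show "vec.independent {w}" by simp
  qed
  ultimately show ?thesis
    using T by (intro vec.dim_unique[of "{v, w}"]) auto
qed

section \<open>Curves parametrised by a ruling of a quadric cone\<close>

locale linear_coords =
  fixes pt :: "complex \<Rightarrow> complex \<Rightarrow> complex \<Rightarrow> complex \<Rightarrow> complex \<Rightarrow> complex ^ 5"
    and l0 l1 l2 l3 l4 :: "complex ^ 5 \<Rightarrow> complex"
  assumes l_form: "is_form 1 l0" "is_form 1 l1" "is_form 1 l2" "is_form 1 l3" "is_form 1 l4"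
    and l_pt [simp]: "l0 (pt y0 y1 y2 y3 y4) = y0" "l1 (pt y0 y1 y2 y3 y4) = y1"
      "l2 (pt y0 y1 y2 y3 y4) = y2" "l3 (pt y0 y1 y2 y3 y4) = y3" "l4 (pt y0 y1 y2 y3 y4) = y4"
    and pt_l: "pt (l0 x) (l1 x) (l2 x) (l3 x) (l4 x) = x"
begin

lemmas l_linear = is_form_linear[OF l_form(1)] is_form_linear[OF l_form(2)]
  is_form_linear[OF l_form(3)] is_form_linear[OF l_form(4)] is_form_linear[OF l_form(5)]

lemma coords_eqI:
  assumes "l0 x = l0 y" "l1 x = l1 y" "l2 x = l2 y" "l3 x = l3 y" "l4 x = l4 y"
  shows "x = y"
  by (metis assms pt_l)

lemma coords_eq_0_iff: "x = 0 \<longleftrightarrow> l0 x = 0 \<and> l1 x = 0 \<and> l2 x = 0 \<and> l3 x = 0 \<and> l4 x = 0"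
  using coords_eqI[of x 0] by (auto simp: l_linear)

lemma pt_scale: "c *s pt y0 y1 y2 y3 y4 = pt (c * y0) (c * y1) (c * y2) (c * y3) (c * y4)"
  by (rule coords_eqI) (simp_all add: l_linear)

lemma pt_expand: "pt y0 y1 y2 y3 y4 = y0 *s pt 1 0 0 0 0 + y1 *s pt 0 1 0 0 0 + y2 *s pt 0 0 1 0 0
    + y3 *s pt 0 0 0 1 0 + y4 *s pt 0 0 0 0 1"
  by (rule coords_eqI) (simp_all add: l_linear)

lemma functional_with_values:
  obtains a :: "complex ^ 5" where
    "\<And>x. (\<Sum>i\<in>UNIV. a $ i * x $ i) = b0 * l0 x + b1 * l1 x + b2 * l2 x + b3 * l3 x + b4 * l4 x"
proof -
  have "is_form 1 (\<lambda>x. b0 * l0 x + b1 * l1 x + b2 * l2 x + b3 * l3 x + b4 * l4 x)"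
    by (intro is_form_add is_form_const_mult l_form)
  then obtain c where "(\<lambda>x. b0 * l0 x + b1 * l1 x + b2 * l2 x + b3 * l3 x + b4 * l4 x)
      = (\<lambda>x. \<Sum>i\<in>UNIV. c i * x $ i)" unfolding is_form_1_iff by blast
  then have "(\<Sum>i\<in>UNIV. (\<chi> i. c i) $ i * x $ i)
      = b0 * l0 x + b1 * l1 x + b2 * l2 x + b3 * l3 x + b4 * l4 x" for x
    by (simp add: fun_eq_iff)
  then show ?thesis by (rule that)
qed

end

text \<open>The cone \<open>y0 * y3 = y1 * y2\<close> is swept out by the planes
  \<open>(y0 : y1) = (y2 : y3) = (s : t)\<close> through its vertex \<open>pt 0 0 0 0 1\<close>. The
  curve picks one point, not the vertex, in each of these planes. \<open>Q\<close> is one more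
  equation of the curve, there to exclude the vertex.\<close>

locale ruled_curve = linear_coords +
  fixes n :: nat and \<alpha> \<beta> \<gamma> :: "complex \<Rightarrow> complex \<Rightarrow> complex" and Q :: "complex ^ 5 \<Rightarrow> complex"
  assumes bf: "binary_form n \<alpha>" "binary_form n \<beta>" "binary_form (Suc n) \<gamma>"
    and no_common_zero: "s \<noteq> 0 \<or> t \<noteq> 0 \<Longrightarrow> \<alpha> s t = 0 \<Longrightarrow> \<beta> s t = 0 \<Longrightarrow> False"
    and Q_form: "homogeneous Q"
    and Q_curve: "Q (pt (s * \<alpha> s t) (t * \<alpha> s t) (s * \<beta> s t) (t * \<beta> s t) (\<gamma> s t)) = 0"
    and Q_vertex: "Q (pt 0 0 0 0 1) \<noteq> 0"
begin

definition param :: "complex \<Rightarrow> complex \<Rightarrow> complex ^ 5" where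
  "param s t = pt (s * \<alpha> s t) (t * \<alpha> s t) (s * \<beta> s t) (t * \<beta> s t) (\<gamma> s t)"

definition curve :: "(complex ^ 5) set set" where
  "curve = {vec.span {param s t} | s t. s \<noteq> 0 \<or> t \<noteq> 0}"

lemma curveI: "s \<noteq> 0 \<or> t \<noteq> 0 \<Longrightarrow> vec.span {param s t} \<in> curve"
  unfolding curve_def by blast

lemma bf_scale:
  "\<alpha> (c * s) (c * t) = c ^ n * \<alpha> s t" "\<beta> (c * s) (c * t) = c ^ n * \<beta> s t"
  "\<gamma> (c * s) (c * t) = c ^ Suc n * \<gamma> s t"
  using bf by (auto simp: binary_form_scale)

lemma param_scale: "param (c * s) (c * t) = c ^ Suc n *s param s t"
  unfolding param_def pt_scale bf_scale by (simp add: mult_ac)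

lemma param_nonzero:
  assumes "s \<noteq> 0 \<or> t \<noteq> 0"
  shows "param s t \<noteq> 0"
  using no_common_zero[OF assms] assms by (auto simp: coords_eq_0_iff param_def)

lemma binary_form_param: "binary_form (Suc n) (\<lambda>s t. param s t $ i)"
proof -
  have 1: "binary_form (1 + n) (\<lambda>s t. s * \<alpha> s t)" "binary_form (1 + n) (\<lambda>s t. t * \<alpha> s t)"
    "binary_form (1 + n) (\<lambda>s t. s * \<beta> s t)" "binary_form (1 + n) (\<lambda>s t. t * \<beta> s t)"
    by (intro binary_form_mult bf binary_form_fst binary_form_snd)+
  have "binary_form (Suc n) (\<lambda>s t. pt 1 0 0 0 0 $ i * (s * \<alpha> s t) + pt 0 1 0 0 0 $ i * (t * \<alpha> s t)
      + pt 0 0 1 0 0 $ i * (s * \<beta> s t) + pt 0 0 0 1 0 $ i * (t * \<beta> s t) + pt 0 0 0 0 1 $ i * \<gamma> s t)"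
    by (intro binary_form_add binary_form_cmult bf 1[simplified])
  also have "(\<lambda>s t. pt 1 0 0 0 0 $ i * (s * \<alpha> s t) + pt 0 1 0 0 0 $ i * (t * \<alpha> s t)
      + pt 0 0 1 0 0 $ i * (s * \<beta> s t) + pt 0 0 0 1 0 $ i * (t * \<beta> s t) + pt 0 0 0 0 1 $ i * \<gamma> s t)
      = (\<lambda>s t. param s t $ i)"
    unfolding param_def by (subst (6) pt_expand) (simp add: mult_ac)
  finally show ?thesis .
qed

lemma param_eq_imp:
  assumes "param s t = c *s param s' t'" "s \<noteq> 0 \<or> t \<noteq> 0"
  shows "s * t' = t * s'"
proof -
  have "l0 (param s t) = c * l0 (param s' t')" "l1 (param s t) = c * l1 (param s' t')"
    "l2 (param s t) = c * l2 (param s' t')" "l3 (param s t) = c * l3 (param s' t')"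
    by (simp_all add: assms(1) l_linear)
  then have "s * \<alpha> s t = c * (s' * \<alpha> s' t')" "t * \<alpha> s t = c * (t' * \<alpha> s' t')"
    "s * \<beta> s t = c * (s' * \<beta> s' t')" "t * \<beta> s t = c * (t' * \<beta> s' t')"
    by (simp_all add: param_def)
  then have "\<alpha> s t * (s * t' - t * s') = 0" "\<beta> s t * (s * t' - t * s') = 0"
    by (auto simp: algebra_simps)
  then show ?thesis using no_common_zero[OF assms(2)] by (metis eq_iff_diff_eq_0 mult_eq_0_iff)
qed

lemma inj_affine_param: "inj (\<lambda>r. vec.span {param r 1})"
proof (rule injI)
  fix r r' assume "vec.span {param r 1} = vec.span {param r' 1}"
  then obtain c where "param r' 1 = c *s param r 1"
    using span_eq_iff[OF param_nonzero[of r 1]] by auto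
  from param_eq_imp[OF this] show "r = r'" by simp
qed

lemma curve_points:
  "curve = insert (vec.span {param 1 0}) (range (\<lambda>r. vec.span {param r 1}))"
proof (intro equalityI subsetI)
  fix P assume "P \<in> curve"
  then obtain s t where st: "P = vec.span {param s t}" "s \<noteq> 0 \<or> t \<noteq> 0" by (auto simp: curve_def)
  have *: "vec.span {param x y} = vec.span {param (c * x) (c * y)}" if "c \<noteq> 0" "x \<noteq> 0 \<or> y \<noteq> 0" for c x y
    using that by (subst span_eq_iff[OF param_nonzero])
      (auto simp: param_scale simp del: power_Suc intro!: exI[of _ "c ^ Suc n"])
  show "P \<in> insert (vec.span {param 1 0}) (range (\<lambda>r. vec.span {param r 1}))"
  proof (cases "t = 0")
    case True
    then show ?thesis using *[of s 1 0] st by simp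
  next
    case False
    then show ?thesis using *[of t "s / t" 1] st by auto
  qed
qed (auto intro!: curveI)

lemma infinite_curve: "infinite curve"
  using finite_imageD[OF _ inj_affine_param] infinite_UNIV_char_0 unfolding curve_points by auto

lemma curve_subset: "curve \<subseteq> proj_space"
  using param_nonzero by (auto simp: curve_def proj_point_iff)

lemma form_on_curve:
  assumes "homogeneous f" "s \<noteq> 0 \<or> t \<noteq> 0"
  shows "(\<forall>v\<in>vec.span {param s t}. f v = 0) \<longleftrightarrow> f (param s t) = 0"
  using assms by (intro form_vanishes_on_span param_nonzero)

text \<open>A form that does not vanish on the whole curve pulls back to a nonzero binary form,
  which has finitely many zeros.\<close>

lemma finite_closed_Int_curve:
  assumes "zariski_closed A" "\<not> curve \<subseteq> A"
  shows "finite (A \<inter> curve)"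
proof -
  obtain F where F: "\<forall>f\<in>F. homogeneous f" "A = zero_locus F"
    using assms by (auto simp: zariski_closed_def)
  obtain s0 t0 where 0: "s0 \<noteq> 0 \<or> t0 \<noteq> 0" "vec.span {param s0 t0} \<notin> A"
    using assms(2) by (auto simp: curve_def)
  then obtain f where f: "f \<in> F" "f (param s0 t0) \<noteq> 0"
    using span_in_zero_locus_iff[OF F(1) param_nonzero[OF 0(1)]] F(2) by auto
  then obtain e where "is_form e f" using F(1) by (auto simp: homogeneous_def)
  then have bf: "binary_form (e * Suc n) (\<lambda>s t. f (param s t))"
    by (intro binary_form_is_form binary_form_param)
  then obtain p where p: "degree p \<le> e * Suc n"
    "\<And>s t. f (param s t) = (if t = 0 then coeff p (e * Suc n) * s ^ (e * Suc n)
       else t ^ (e * Suc n) * poly p (s / t))"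
    unfolding binary_form_def by blast
  have "p \<noteq> 0" using f(2) p(2)[of s0 t0] by (auto split: if_splits)
  then have fin: "finite {r. poly p r = 0}" by (rule poly_roots_finite)
  have "A \<inter> curve \<subseteq> insert (vec.span {param 1 0}) ((\<lambda>r. vec.span {param r 1}) ` {r. poly p r = 0})"
  proof
    fix P assume P: "P \<in> A \<inter> curve"
    then consider "P = vec.span {param 1 0}" | r where "P = vec.span {param r 1}"
      unfolding curve_points by auto
    then show "P \<in> insert (vec.span {param 1 0}) ((\<lambda>r. vec.span {param r 1}) ` {r. poly p r = 0})"
    proof cases
      case 2
      have "f (param r 1) = 0"
        using P f(1) unfolding 2 F(2) by (auto simp: span_in_zero_locus_iff[OF F(1) param_nonzero])
      then have "poly p r = 0" using p(2)[of r 1] by simp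
      then show ?thesis using 2 by auto
    qed auto
  qed
  then show ?thesis using fin by (meson finite.insertI finite_imageI finite_subset)
qed

text \<open>If \<open>(s, t) = (l0, l1)\<close> then \<open>\<alpha> s t *s x = param s t\<close> on the zero set of the three
  forms after \<open>Q\<close>; the last three play the same role for \<open>(s, t) = (l2, l3)\<close>.\<close>

definition equations :: "(complex ^ 5 \<Rightarrow> complex) set" where
  "equations = {Q,
     \<lambda>x. \<beta> (l0 x) (l1 x) * l0 x - \<alpha> (l0 x) (l1 x) * l2 x,
     \<lambda>x. \<beta> (l0 x) (l1 x) * l1 x - \<alpha> (l0 x) (l1 x) * l3 x,
     \<lambda>x. \<gamma> (l0 x) (l1 x) - \<alpha> (l0 x) (l1 x) * l4 x,
     \<lambda>x. \<alpha> (l2 x) (l3 x) * l2 x - \<beta> (l2 x) (l3 x) * l0 x,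
     \<lambda>x. \<alpha> (l2 x) (l3 x) * l3 x - \<beta> (l2 x) (l3 x) * l1 x,
     \<lambda>x. \<gamma> (l2 x) (l3 x) - \<beta> (l2 x) (l3 x) * l4 x}"

lemma homogeneous_equations: "\<forall>f\<in>equations. homogeneous f"
proof -
  have 1: "homogeneous (\<lambda>x. P (f x) (g x) * h x - P' (f x) (g x) * h' x)"
    if "binary_form n P" "binary_form n P'" "is_form 1 f" "is_form 1 g" "is_form 1 h" "is_form 1 h'"
    for P P' f g h h'
    unfolding homogeneous_def using that
    by (intro exI[of _ "n * 1 + 1"] is_form_diff is_form_mult is_form_binary_form)
  have 2: "homogeneous (\<lambda>x. \<gamma> (f x) (g x) - P (f x) (g x) * h x)"
    if "binary_form n P" "is_form 1 f" "is_form 1 g" "is_form 1 h" for P f g h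
    unfolding homogeneous_def
  proof (intro exI[of _ "n * 1 + 1"] is_form_diff)
    show "is_form (n * 1 + 1) (\<lambda>x. \<gamma> (f x) (g x))"
      using is_form_binary_form[OF bf(3) that(2,3)] by simp
  qed (use that in \<open>intro is_form_mult is_form_binary_form\<close>)
  show ?thesis
    unfolding equations_def
    using Q_form 1[OF bf(2,1) l_form(1,2,1,3)] 1[OF bf(2,1) l_form(1,2,2,4)] 2[OF bf(1) l_form(1,2,5)]
      1[OF bf(1,2) l_form(3,4,3,1)] 1[OF bf(1,2) l_form(3,4,4,2)] 2[OF bf(2) l_form(3,4,5)]
    by simp
qed

text \<open>At \<open>param s t\<close> the pair \<open>(l0, l1)\<close> is
  \<open>\<alpha> s t\<close> times \<open>(s, t)\<close>, and \<open>(l2, l3)\<close> is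
  \<open>\<beta> s t\<close> times \<open>(s, t)\<close>. Scaling by these factors turns each
  equation into an identity.\<close>

lemma equations_param: "\<forall>f\<in>equations. f (param s t) = 0"
  unfolding equations_def param_def
  using bf_scale[of "\<alpha> s t" s t] bf_scale[of "\<beta> s t" s t] Q_curve
  by (auto simp: mult_ac)

lemma curve_eq_zero_locus: "curve = zero_locus equations"
proof (intro equalityI subsetI)
  fix P assume "P \<in> curve"
  then show "P \<in> zero_locus equations"
    using span_in_zero_locus_iff[OF homogeneous_equations param_nonzero] equations_param
    by (auto simp: curve_def)
next
  fix P assume P: "P \<in> zero_locus equations"
  then obtain x where x: "P = vec.span {x}" "x \<noteq> 0" by (auto simp: zero_locus_def proj_space_def)
  have "\<forall>f\<in>equations. f x = 0"
    using P span_in_zero_locus_iff[OF homogeneous_equations x(2)] x(1) by simp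
  then have e: "Q x = 0"
     "\<beta> (l0 x) (l1 x) * l0 x = \<alpha> (l0 x) (l1 x) * l2 x"
     "\<beta> (l0 x) (l1 x) * l1 x = \<alpha> (l0 x) (l1 x) * l3 x"
     "\<gamma> (l0 x) (l1 x) = \<alpha> (l0 x) (l1 x) * l4 x"
     "\<alpha> (l2 x) (l3 x) * l2 x = \<beta> (l2 x) (l3 x) * l0 x"
     "\<alpha> (l2 x) (l3 x) * l3 x = \<beta> (l2 x) (l3 x) * l1 x"
     "\<gamma> (l2 x) (l3 x) = \<beta> (l2 x) (l3 x) * l4 x"
    by (simp_all add: equations_def)
  have on_curve: "P \<in> curve" if "s \<noteq> 0 \<or> t \<noteq> 0" "c *s x = param s t" for s t c
  proof -
    have "c \<noteq> 0" using that param_nonzero by force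
    then have "vec.span {x} = vec.span {param s t}"
      using x(2) that by (subst span_eq_iff) auto
    then show ?thesis using that x by (auto simp: curve_def)
  qed
  consider "l0 x \<noteq> 0 \<or> l1 x \<noteq> 0" | "l2 x \<noteq> 0 \<or> l3 x \<noteq> 0"
    | "l0 x = 0" "l1 x = 0" "l2 x = 0" "l3 x = 0" by blast
  then show "P \<in> curve"
  proof cases
    case 1
    have "\<alpha> (l0 x) (l1 x) *s x = param (l0 x) (l1 x)"
      by (rule coords_eqI) (use e in \<open>simp_all add: param_def l_linear mult.commute\<close>)
    with 1 show ?thesis by (rule on_curve)
  next
    case 2
    have "\<beta> (l2 x) (l3 x) *s x = param (l2 x) (l3 x)"
      by (rule coords_eqI) (use e in \<open>simp_all add: param_def l_linear mult.commute\<close>)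
    with 2 show ?thesis by (rule on_curve)
  next
    \<comment> \<open>Only the vertex of the cone is left, where neither pair of coordinates yields
      a parameter.\<close>
    case 3
    obtain d where "is_form d Q" using Q_form by (auto simp: homogeneous_def)
    moreover have "x = l4 x *s pt 0 0 0 0 1"
      by (rule coords_eqI) (simp_all add: 3 l_linear)
    ultimately have "Q x = l4 x ^ d * Q (pt 0 0 0 0 1)" by (metis is_form_smult)
    then have "l4 x = 0" using e(1) Q_vertex by simp
    then show ?thesis using x(2) 3 by (simp add: coords_eq_0_iff)
  qed
qed

lemma equations_vanish:
  assumes "f \<in> equations"
  shows "homogeneous f" "vanishes_on f curve"
  using assms homogeneous_equations unfolding curve_eq_zero_locus
  by (auto simp: vanishes_on_def zero_locus_def)

lemma dir_deriv_affine:
  assumes "\<And>z. f (v + z *s w) = a + b * z"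
  shows "dir_deriv f v w = b"
  unfolding dir_deriv_def assms
  by (rule DERIV_imp_deriv) (auto intro!: derivative_eq_intros)

text \<open>The tangent space of the cone contains the position vector \<open>v\<close> and the
  velocity \<open>w\<close>, and \<open>(l0, l1)\<close> or \<open>(l2, l3)\<close> separates them.
  Conversely, let \<open>x\<close> be a tangent vector on which that pair vanishes. Along
  \<open>v + z *s x\<close> the coefficients of the corresponding three equations are constant, so
  the equations are affine in \<open>z\<close> with slopes proportional to the other three
  coordinates of \<open>x\<close>, which must therefore vanish.\<close>

lemma tangent_space_curve:
  assumes st: "s \<noteq> 0 \<or> t \<noteq> 0" and c: "c \<noteq> 0"
  shows "vec.dim (cone_tangent_space curve (c *s param s t)) = 2"
proof -
  define v where "v = c *s param s t"
  let ?T = "cone_tangent_space curve v"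
  \<comment> \<open>\<open>(s1, t1)\<close> completes \<open>(s, t)\<close> to a basis, so that
    moving in this direction changes the point of the projective line.\<close>
  define s1 where "s1 = (if t = 0 then 0 else 1 :: complex)"
  define t1 where "t1 = (if t = 0 then 1 else 0 :: complex)"
  have det: "s * t1 - t * s1 \<noteq> 0" using st by (auto simp: s1_def t1_def)
  define \<gamma>' where "\<gamma>' z = c *s param (s + z * s1) (t + z * t1)" for z
  have "\<exists>D. ((\<lambda>z. \<gamma>' z $ i) has_field_derivative D) (at 0)" for i
    unfolding \<gamma>'_def vector_smult_component
    by (rule binary_form_differentiable[OF binary_form_cmult[OF binary_form_param]])
  then obtain D where "\<And>i. ((\<lambda>z. \<gamma>' z $ i) has_field_derivative D i) (at 0)" by metis
  then obtain w where w: "\<And>i. ((\<lambda>z. \<gamma>' z $ i) has_field_derivative w $ i) (at 0)"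
    by (metis vec_lambda_beta)
  have cone: "f (a *s param x y) = 0" if "homogeneous f" "vanishes_on f curve" for f a x y
  proof (cases "x \<noteq> 0 \<or> y \<noteq> 0")
    case True
    then have "vec.span {param x y} \<in> curve" by (rule curveI)
    then show ?thesis using that by (auto simp: vanishes_on_def vec.span_scale vec.span_base)
  next
    \<comment> \<open>The origin lies in every point of the curve, seen as a linear subspace. That
      \<open>param 0 0\<close> is the origin uses that the degree \<open>Suc n\<close> of
      \<open>\<gamma>\<close> is positive.\<close>
    case False
    have "vec.span {param 1 0} \<in> curve" by (rule curveI) simp
    moreover have "a *s param x y = 0" using False by (simp add: coords_eq_0_iff l_linear param_def)
       (use bf_scale(3)[of 0 1 1] in simp)
    ultimately show ?thesis using that by (auto simp: vanishes_on_def vec.span_zero)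
  qed
  have wT: "w \<in> ?T"
    using tangent_to_curve[of \<gamma>' w 0 curve, OF w] cone by (simp add: \<gamma>'_def v_def)
  have vT: "v \<in> ?T"
  proof -
    have "dir_deriv f v v = 0" if "homogeneous f" "vanishes_on f curve" for f
    proof (rule dir_deriv_affine[where a = 0])
      fix z
      have "v + z *s v = ((1 + z) * c) *s param s t" by (simp add: v_def algebra_simps)
      then show "f (v + z *s v) = 0 + 0 * z" using cone[OF that] by simp
    qed
    then show ?thesis by (auto simp: cone_tangent_space_def)
  qed
  have lin_deriv: "((\<lambda>z. s * f (\<gamma>' z) - t * g (\<gamma>' z)) has_field_derivative (s * f w - t * g w)) (at 0)"
    if fg: "is_form 1 f" "is_form 1 g" for f g
  proof -
    obtain a b where ab: "f = (\<lambda>x. \<Sum>i\<in>UNIV. a i * x $ i)" "g = (\<lambda>x. \<Sum>i\<in>UNIV. b i * x $ i)"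
      using fg unfolding is_form_1_iff by blast
    show ?thesis unfolding ab by (intro DERIV_diff DERIV_cmult DERIV_sum w)
  qed
  \<comment> \<open>The combination \<open>s * f - t * g\<close> vanishes at the base point; along
    the path it is \<open>c * (s * t1 - t * s1)\<close> times \<open>z * P\<close>, and the factor
    \<open>z\<close> makes its derivative at 0 explicit.\<close>
  have key: "s * f w - t * g w = c * P s t * (s * t1 - t * s1)"
    if fg: "is_form 1 f" "is_form 1 g" "binary_form n P"
      and eq: "\<And>x y. g (param x y) = x * P x y" "\<And>x y. f (param x y) = y * P x y" for f g P
  proof -
    obtain D where D: "((\<lambda>z. P (s + z * s1) (t + z * t1)) has_field_derivative D) (at 0)"
      using binary_form_differentiable[OF fg(3)] by blast
    have "(\<lambda>z. s * f (\<gamma>' z) - t * g (\<gamma>' z))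
        = (\<lambda>z. (c * (s * t1 - t * s1)) * (z * P (s + z * s1) (t + z * t1)))"
      unfolding \<gamma>'_def is_form_linear[OF fg(1)] is_form_linear[OF fg(2)] eq
      by (simp add: algebra_simps)
    moreover have "((\<lambda>z. (c * (s * t1 - t * s1)) * (z * P (s + z * s1) (t + z * t1)))
        has_field_derivative (c * (s * t1 - t * s1)) * P s t) (at 0)"
      by (rule derivative_eq_intros refl D)+ simp
    ultimately show ?thesis using lin_deriv[OF fg(1,2)] DERIV_unique by (fastforce simp: mult_ac)
  qed
  have v_coords: "l0 v = c * s * \<alpha> s t" "l1 v = c * t * \<alpha> s t" "l2 v = c * s * \<beta> s t"
    "l3 v = c * t * \<beta> s t"
    by (simp_all add: v_def l_linear param_def)
  have tangent: "dir_deriv f v x = 0" if "f \<in> equations" "x \<in> ?T" for f x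
    using that equations_vanish[OF that(1)] by (auto simp: cone_tangent_space_def)
  consider "\<alpha> s t \<noteq> 0" | "\<beta> s t \<noteq> 0" using no_common_zero[OF st] by blast
  then have "vec.dim ?T = 2"
  proof cases
    case 1
    have \<alpha>v: "\<alpha> (l0 v) (l1 v) \<noteq> 0"
      using bf_scale(1)[of "c * \<alpha> s t" s t] 1 c by (simp add: v_coords mult_ac)
    show ?thesis
    proof (rule dim_2_criterion[OF subspace_cone_tangent_space vT wT l_form(1,2)])
      show "l0 v \<noteq> 0 \<or> l1 v \<noteq> 0" using 1 c st by (simp add: v_coords)
      have "l0 v * l1 w - l1 v * l0 w = (c * \<alpha> s t) * (s * l1 w - t * l0 w)"
        by (simp add: v_coords algebra_simps)
      also have "s * l1 w - t * l0 w = c * \<alpha> s t * (s * t1 - t * s1)"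
        by (rule key[OF l_form(2,1) bf(1)]) (simp_all add: param_def)
      finally show "l0 v * l1 w \<noteq> l1 v * l0 w" using 1 c det by auto
      fix x assume x: "x \<in> ?T" "l0 x = 0" "l1 x = 0"
      have line: "l0 (v + z *s x) = l0 v" "l1 (v + z *s x) = l1 v" for z
        by (simp_all add: l_linear x)
      have "dir_deriv (\<lambda>x. \<beta> (l0 x) (l1 x) * l0 x - \<alpha> (l0 x) (l1 x) * l2 x) v x
          = - \<alpha> (l0 v) (l1 v) * l2 x"
        by (rule dir_deriv_affine[where a = "\<beta> (l0 v) (l1 v) * l0 v - \<alpha> (l0 v) (l1 v) * l2 v"], unfold line) (simp add: l_linear algebra_simps)
      moreover have "dir_deriv (\<lambda>x. \<beta> (l0 x) (l1 x) * l1 x - \<alpha> (l0 x) (l1 x) * l3 x) v x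
          = - \<alpha> (l0 v) (l1 v) * l3 x"
        by (rule dir_deriv_affine[where a = "\<beta> (l0 v) (l1 v) * l1 v - \<alpha> (l0 v) (l1 v) * l3 v"], unfold line) (simp add: l_linear algebra_simps)
      moreover have "dir_deriv (\<lambda>x. \<gamma> (l0 x) (l1 x) - \<alpha> (l0 x) (l1 x) * l4 x) v x
          = - \<alpha> (l0 v) (l1 v) * l4 x"
        by (rule dir_deriv_affine[where a = "\<gamma> (l0 v) (l1 v) - \<alpha> (l0 v) (l1 v) * l4 v"], unfold line) (simp add: l_linear algebra_simps)
      ultimately have "l2 x = 0" "l3 x = 0" "l4 x = 0"
        using tangent[OF _ x(1)] \<alpha>v by (force simp: equations_def)+
      then show "x = 0" using x by (simp add: coords_eq_0_iff)
    qed
  next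
    case 2
    have \<beta>v: "\<beta> (l2 v) (l3 v) \<noteq> 0"
      using bf_scale(2)[of "c * \<beta> s t" s t] 2 c by (simp add: v_coords mult_ac)
    show ?thesis
    proof (rule dim_2_criterion[OF subspace_cone_tangent_space vT wT l_form(3,4)])
      show "l2 v \<noteq> 0 \<or> l3 v \<noteq> 0" using 2 c st by (simp add: v_coords)
      have "l2 v * l3 w - l3 v * l2 w = (c * \<beta> s t) * (s * l3 w - t * l2 w)"
        by (simp add: v_coords algebra_simps)
      also have "s * l3 w - t * l2 w = c * \<beta> s t * (s * t1 - t * s1)"
        by (rule key[OF l_form(4,3) bf(2)]) (simp_all add: param_def)
      finally show "l2 v * l3 w \<noteq> l3 v * l2 w" using 2 c det by auto
      fix x assume x: "x \<in> ?T" "l2 x = 0" "l3 x = 0"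
      have line: "l2 (v + z *s x) = l2 v" "l3 (v + z *s x) = l3 v" for z
        by (simp_all add: l_linear x)
      have "dir_deriv (\<lambda>x. \<alpha> (l2 x) (l3 x) * l2 x - \<beta> (l2 x) (l3 x) * l0 x) v x
          = - \<beta> (l2 v) (l3 v) * l0 x"
        by (rule dir_deriv_affine[where a = "\<alpha> (l2 v) (l3 v) * l2 v - \<beta> (l2 v) (l3 v) * l0 v"], unfold line) (simp add: l_linear algebra_simps)
      moreover have "dir_deriv (\<lambda>x. \<alpha> (l2 x) (l3 x) * l3 x - \<beta> (l2 x) (l3 x) * l1 x) v x
          = - \<beta> (l2 v) (l3 v) * l1 x"
        by (rule dir_deriv_affine[where a = "\<alpha> (l2 v) (l3 v) * l3 v - \<beta> (l2 v) (l3 v) * l1 v"], unfold line) (simp add: l_linear algebra_simps)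
      moreover have "dir_deriv (\<lambda>x. \<gamma> (l2 x) (l3 x) - \<beta> (l2 x) (l3 x) * l4 x) v x
          = - \<beta> (l2 v) (l3 v) * l4 x"
        by (rule dir_deriv_affine[where a = "\<gamma> (l2 v) (l3 v) - \<beta> (l2 v) (l3 v) * l4 v"], unfold line) (simp add: l_linear algebra_simps)
      ultimately have "l0 x = 0" "l1 x = 0" "l4 x = 0"
        using tangent[OF _ x(1)] \<beta>v by (force simp: equations_def)+
      then show "x = 0" using x by (simp add: coords_eq_0_iff)
    qed
  qed
  then show ?thesis by (simp add: v_def)
qed

theorem smooth_curve: "smooth_curve curve"
proof -
  have closed: "zariski_closed curve"
    unfolding zariski_closed_def using homogeneous_equations curve_eq_zero_locus by blast
  have "vec.dim (cone_tangent_space curve v) = 2" if v: "v \<noteq> 0" "vec.span {v} \<in> curve" for v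
  proof -
    obtain s t where st: "vec.span {v} = vec.span {param s t}" "s \<noteq> 0 \<or> t \<noteq> 0"
      using v(2) unfolding curve_def by blast
    then obtain c where "c \<noteq> 0" "v = c *s param s t"
      using span_eq_iff[OF param_nonzero[OF st(2)], of v] by metis
    then show ?thesis using tangent_space_curve[OF st(2)] by simp
  qed
  then show ?thesis
    unfolding smooth_curve_def
    using closed cofinite_curve[OF closed infinite_curve curve_subset finite_closed_Int_curve] by blast
qed

text \<open>A hyperplane section of the curve is a binary form of degree \<open>n + 1\<close>; its discriminant is
  a form in the coefficients of the hyperplane. That it is not identically zero is seen on the
  tangent hyperplanes of the quadric cone, which cut out \<open>(s - z t) (\<alpha> + c \<beta>)\<close>.\<close>

theorem has_degree: "has_degree curve (Suc n)"
proof -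
  have "\<exists>p. degree p \<le> Suc n \<and> (\<forall>s t. param s t $ i =
      (if t = 0 then coeff p (Suc n) * s ^ Suc n else t ^ Suc n * poly p (s / t)))" for i
    using binary_form_param[of i] unfolding binary_form_def .
  then obtain p where p: "\<And>i. degree (p i) \<le> Suc n"
    "\<And>i s t. param s t $ i =
      (if t = 0 then coeff (p i) (Suc n) * s ^ Suc n else t ^ Suc n * poly (p i) (s / t))"
    by metis
  \<comment> \<open>The hyperplane section with coefficient vector \<open>a\<close>, dehomogenised
    at \<open>t = 1\<close>; it is linear in \<open>a\<close>.\<close>
  define q where "q a = (\<Sum>i\<in>UNIV. Polynomial.smult (a $ i) (p i))" for a :: "complex ^ 5"
  have q_deg: "degree (q a) \<le> Suc n" for a
    unfolding q_def by (intro degree_sum_le) (auto intro: order.trans[OF degree_smult_le] p)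
  have q_coeff: "is_form 1 (\<lambda>a. coeff (q a) i)" for i
  proof -
    have "(\<lambda>a. coeff (q a) i) = (\<lambda>a. \<Sum>j\<in>UNIV. coeff (p j) i * a $ j)"
      by (simp add: q_def coeff_sum mult.commute)
    then show ?thesis unfolding is_form_1_iff by (intro exI[of _ "\<lambda>j. coeff (p j) i"])
  qed
  have q_affine: "(\<Sum>i\<in>UNIV. a $ i * param r 1 $ i) = poly (q a) r" for a r
    by (simp add: p(2) q_def poly_sum)
  have q_top: "(\<Sum>i\<in>UNIV. a $ i * param 1 0 $ i) = coeff (q a) (Suc n)" for a
    by (simp add: p(2) q_def coeff_sum)
  obtain D where D: "homogeneous D" "\<And>a. D a \<noteq> 0 \<longleftrightarrow> degree (q a) = Suc n \<and> rsquarefree (q a)"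
    using discriminant_form[OF q_deg q_coeff] by blast
  have hyp: "vec.span {param s t} \<in> hyperplane a \<longleftrightarrow> (\<Sum>i\<in>UNIV. a $ i * param s t $ i) = 0"
    if "s \<noteq> 0 \<or> t \<noteq> 0" for a s t
  proof -
    have "is_form 1 (\<lambda>v. \<Sum>i\<in>UNIV. a $ i * v $ i)" unfolding is_form_1_iff by blast
    then have "homogeneous (\<lambda>v. \<Sum>i\<in>UNIV. a $ i * v $ i)" by (auto simp: homogeneous_def)
    from form_on_curve[OF this that] show ?thesis
      using param_nonzero[OF that] by (simp add: hyperplane_def proj_point_iff)
  qed
  obtain a where a: "D a \<noteq> 0"
  proof -
    obtain pa where pa: "degree pa \<le> n" "\<And>r. \<alpha> r 1 = poly pa r" "\<alpha> 1 0 = coeff pa n"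
      using binary_form_polyE[OF bf(1)] by blast
    obtain pb where pb: "degree pb \<le> n" "\<And>r. \<beta> r 1 = poly pb r" "\<beta> 1 0 = coeff pb n"
      using binary_form_polyE[OF bf(2)] by blast
    have "finite {c. \<not> (degree (pa + Polynomial.smult c pb) = n \<and> rsquarefree (pa + Polynomial.smult c pb))}"
    proof (rule generic_member_squarefree[OF _ pa(1) pb(1)])
      show "False" if "poly pa x = 0" "poly pb x = 0" for x
        using no_common_zero[of x 1] that pa pb by auto
      show "coeff pa n \<noteq> 0 \<or> coeff pb n \<noteq> 0"
        using no_common_zero[of 1 0] pa pb by auto
    qed
    then obtain c where c: "degree (pa + Polynomial.smult c pb) = n" "rsquarefree (pa + Polynomial.smult c pb)"
      using infinite_UNIV_char_0 ex_new_if_finite by (metis (mono_tags, lifting) mem_Collect_eq)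
    define P where "P = pa + Polynomial.smult c pb"
    have P: "degree P = n" "P \<noteq> 0" "rsquarefree P" using c by (auto simp: P_def rsquarefree_def)
    \<comment> \<open>Avoiding the roots of \<open>P\<close> keeps the product with the new factor
      \<open>[:- z, 1:]\<close> squarefree.\<close>
    obtain z where z: "poly P z \<noteq> 0"
      using poly_roots_finite[OF P(2)] infinite_UNIV_char_0 ex_new_if_finite
      by (metis (mono_tags, lifting) mem_Collect_eq)
    obtain a where a: "\<And>x. (\<Sum>i\<in>UNIV. a $ i * x $ i)
        = 1 * l0 x + (- z) * l1 x + c * l2 x + (- z * c) * l3 x + 0 * l4 x"
      using functional_with_values[of 1 "- z" c "- z * c" 0] by blast
    have "poly (q a) r = poly ([:- z, 1:] * P) r" for r
      unfolding q_affine[symmetric] a by (simp add: param_def P_def pa pb algebra_simps)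
    then have qa: "q a = [:- z, 1:] * P" by (metis poly_eq_poly_eq_iff ext)
    have "degree (q a) = Suc n" unfolding qa using P by (subst degree_mult_eq) auto
    moreover have "rsquarefree (q a)"
      unfolding rsquarefree_roots
    proof (intro allI notI)
      fix x assume "poly (q a) x = 0 \<and> poly (pderiv (q a)) x = 0"
      moreover have "poly (q a) x = (x - z) * poly P x"
        "poly (pderiv (q a)) x = poly P x + (x - z) * poly (pderiv P) x"
        unfolding qa pderiv_mult by (simp_all add: pderiv_pCons algebra_simps)
      ultimately have "(x - z) * poly P x = 0" "poly P x + (x - z) * poly (pderiv P) x = 0"
        by simp_all
      then have "poly P x = 0" "poly (pderiv P) x = 0" using z by auto
      then show False using P(3) by (auto simp: rsquarefree_roots)
    qed
    ultimately show ?thesis using that D(2) by blast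
  qed
  have card: "finite (curve \<inter> hyperplane b) \<and> card (curve \<inter> hyperplane b) = Suc n" if "D b \<noteq> 0" for b
  proof -
    have b: "degree (q b) = Suc n" "rsquarefree (q b)" using D(2) that by auto
    \<comment> \<open>The top coefficient is the value at \<open>(1 : 0)\<close>: the hyperplane
      misses the point at infinity, and all intersections are roots of \<open>q b\<close>.\<close>
    have "coeff (q b) (Suc n) \<noteq> 0" using b(1) by (metis degree_0 leading_coeff_0_iff nat.distinct(1))
    then have "curve \<inter> hyperplane b = (\<lambda>r. vec.span {param r 1}) ` {r. poly (q b) r = 0}"
      unfolding curve_points using hyp[of 1 0 b] hyp[of _ 1 b] by (auto simp: q_affine q_top)
    then show ?thesis
      using card_roots_rsquarefree[OF b(2)] b(1)
      by (simp add: card_image inj_on_subset[OF inj_affine_param])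
  qed
  have one: "\<forall>f\<in>{D}. homogeneous f" using D(1) by simp
  have "D 0 = 0" using D(2)[of 0] by (auto simp: q_def)
  then have a0: "a \<noteq> 0" using a by auto
  show ?thesis
    unfolding has_degree_def
  proof (intro exI[of _ "zero_locus {D}"] conjI allI impI)
    show "zariski_closed (zero_locus {D})" using one by (auto simp: zariski_closed_def)
    show "zero_locus {D} \<subset> proj_space"
      using span_in_zero_locus_iff[OF one a0] a a0 proj_point_iff[of a]
      by (auto simp: zero_locus_def)
    fix b :: "complex ^ 5" assume "b \<noteq> 0" "vec.span {b} \<notin> zero_locus {D}"
    then have "D b \<noteq> 0" using span_in_zero_locus_iff[OF one] by auto
    from card[OF this] show "finite (curve \<inter> hyperplane b)" "card (curve \<inter> hyperplane b) = Suc n"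
      by auto
  qed
qed

end

section \<open>The quartic del Pezzo surface in coordinates\<close>

lemma UNIV_5: "(UNIV :: 5 set) = {1, 2, 3, 4, 5}"
proof -
  have "x = 1 \<or> x = 2 \<or> x = 3 \<or> x = 4 \<or> x = 5" for x :: 5
  proof (induct x)
    case (of_int z)
    then have "z = 0 \<or> z = 1 \<or> z = 2 \<or> z = 3 \<or> z = 4" by fastforce
    then show ?case by auto
  qed
  then show ?thesis by auto
qed

lemma forall_5: "(\<forall>i::5. P i) \<longleftrightarrow> P 1 \<and> P 2 \<and> P 3 \<and> P 4 \<and> P 5"
  using UNIV_5 by (metis UNIV_I insertE emptyE)

lemma sum_5: "sum f (UNIV :: 5 set) = f 1 + f 2 + f 3 + f 4 + f 5"
  unfolding UNIV_5 by (simp add: ac_simps)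

text \<open>The normal form of five points in general position: three coordinate points, the unit
  point and \<open>(a : b : c)\<close>. A nonzero entry of the last says that it lies on no line
  through two coordinate points; distinct entries say that it lies on no line through the unit point
  and a coordinate point.\<close>

locale five_points =
  fixes p :: "5 \<Rightarrow> (complex ^ 3) set" and b1 b2 b3 :: "complex ^ 3"
    and W U V :: "complex ^ 3 \<Rightarrow> complex" and a b c :: complex
  assumes coord_form: "is_form 1 W" "is_form 1 U" "is_form 1 V"
    and coord_basis [simp]: "W b1 = 1" "U b1 = 0" "V b1 = 0" "W b2 = 0" "U b2 = 1" "V b2 = 0"
      "W b3 = 0" "U b3 = 0" "V b3 = 1"
    and points: "p 1 = vec.span {b1}" "p 2 = vec.span {b2}" "p 3 = vec.span {b3}"
      "p 4 = vec.span {b1 + b2 + b3}" "p 5 = vec.span {a *s b1 + b *s b2 + c *s b3}"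
    and abc: "a \<noteq> 0" "b \<noteq> 0" "c \<noteq> 0" "a \<noteq> b" "a \<noteq> c" "b \<noteq> c"
    and inj_p: "inj p"
begin

lemmas coord_linear [simp] = is_form_linear[OF coord_form(1)] is_form_linear[OF coord_form(2)]
  is_form_linear[OF coord_form(3)]

text \<open>\<open>m = 0\<close> is the line through \<open>p 4\<close> and \<open>p 5\<close>, \<open>W = 0\<close> the line through \<open>p 2\<close> and \<open>p 3\<close>, and
  \<open>q = 0\<close> the conic through all five points. Together with \<open>W * q\<close>, the cubics \<open>G\<close> below satisfy
  \<open>G 1 * G 4 = G 2 * G 3 = G 5 * (W * q)\<close>.\<close>

definition m :: "complex ^ 3 \<Rightarrow> complex" where
  "m z = (b - c) * W z + (c - a) * U z + (a - b) * V z"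

definition q :: "complex ^ 3 \<Rightarrow> complex" where
  "q z = c * (b - a) * (W z * U z) + b * (a - c) * (W z * V z) + a * (c - b) * (U z * V z)"

definition G :: "5 \<Rightarrow> complex ^ 3 \<Rightarrow> complex" where
  "G i z = (if i = 1 then U z * (W z * m z) else if i = 2 then V z * (W z * m z)
     else if i = 3 then U z * q z else if i = 4 then V z * q z else U z * (V z * m z))"

lemma G_simps: "G 1 z = U z * (W z * m z)" "G 2 z = V z * (W z * m z)" "G 3 z = U z * q z"
  "G 4 z = V z * q z" "G 5 z = U z * (V z * m z)"
  by (simp_all add: G_def)

lemma range_p: "range p = {p 1, p 2, p 3, p 4, p 5}"
  unfolding UNIV_5 by simp

lemma point_nonzero: "b1 \<noteq> 0" "b2 \<noteq> 0" "b3 \<noteq> 0" "b1 + b2 + b3 \<noteq> 0" "a *s b1 + b *s b2 + c *s b3 \<noteq> 0"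
proof -
  have "W b1 \<noteq> 0" "U b2 \<noteq> 0" "V b3 \<noteq> 0" "W (b1 + b2 + b3) \<noteq> 0" "W (a *s b1 + b *s b2 + c *s b3) \<noteq> 0"
    using abc by simp_all
  then show "b1 \<noteq> 0" "b2 \<noteq> 0" "b3 \<noteq> 0" "b1 + b2 + b3 \<noteq> 0" "a *s b1 + b *s b2 + c *s b3 \<noteq> 0"
    by (metis coord_linear(3,7,11))+
qed

lemma G_cubic: "G i \<in> cubics_through p"
proof -
  have m: "is_form 1 m" unfolding m_def
    by (intro is_form_add is_form_const_mult coord_form)
  have q: "is_form (1 + 1) q" unfolding q_def
    by (intro is_form_add is_form_const_mult is_form_mult coord_form)
  have c3: "is_form (1 + (1 + 1)) (\<lambda>z. A z * (B z * m z))" if "is_form 1 A" "is_form 1 B" for A B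
    by (intro is_form_mult that m)
  have "is_form (1 + (1 + 1)) (G i)"
    unfolding G_def[abs_def] by (intro is_form_if c3 is_form_mult coord_form q)
  then have form: "is_form 3 (G i)" by (simp add: numeral_3_eq_3)
  then have "homogeneous (G i)" by (auto simp: homogeneous_def)
  from form_vanishes_on_span[OF this] have
    "(\<forall>v\<in>vec.span {x}. G i v = 0) \<longleftrightarrow> G i x = 0" if "x \<noteq> 0" for x using that by simp
  moreover have "G i b1 = 0" "G i b2 = 0" "G i b3 = 0" "G i (b1 + b2 + b3) = 0"
    "G i (a *s b1 + b *s b2 + c *s b3) = 0"
    by (simp_all add: G_def m_def q_def) (simp_all add: algebra_simps)
  ultimately have "vanishes_on (G i) (range p)"
    unfolding vanishes_on_def range_p points using point_nonzero by simp
  with form show ?thesis by (simp add: cubics_through_def)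
qed

lemma q_at_points: "x \<in> range p \<Longrightarrow> v \<in> x \<Longrightarrow> q v = 0"
  unfolding range_p points
  by (auto simp: span_singleton_iff q_def) (simp add: algebra_simps)+

text \<open>The relation is restricted to coordinate lines. On \<open>U = 0\<close> only
  \<open>G 2\<close> and \<open>G 4\<close> survive, on \<open>V = 0\<close> only \<open>G 1\<close>
  and \<open>G 3\<close>; two points on each line separate the two cubics. On \<open>W = 0\<close>
  the cubic \<open>G 5\<close> remains.\<close>

lemma G_independent:
  assumes "\<And>z. (\<Sum>i\<in>UNIV. k i * G i z) = 0"
  shows "k i = 0"
proof -
  have *: "k 1 * G 1 z + k 2 * G 2 z + k 3 * G 3 z + k 4 * G 4 z + k 5 * G 5 z = 0" for z
    using assms[of z] by (simp add: sum_5)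
  note d = G_simps m_def q_def
  have "k 2 * (a - c) + k 4 * b * (a - c) = 0" "- k 2 * (2 * b - c - a) + k 4 * b * (a - c) = 0"
    using *[of "b1 + b3"] *[of "b1 - b3"] by (simp_all add: d algebra_simps)
  moreover have "2 * (k 2 * (b - c)) = (k 2 * (a - c) + k 4 * b * (a - c))
      - (- k 2 * (2 * b - c - a) + k 4 * b * (a - c))" by (simp add: algebra_simps)
  ultimately have 2: "k 2 = 0" "k 4 = 0" using abc by auto
  have "k 1 * (b - a) + k 3 * c * (b - a) = 0" "- k 1 * (b - 2 * c + a) + k 3 * c * (b - a) = 0"
    using *[of "b1 + b2"] *[of "b1 - b2"] by (simp_all add: d algebra_simps)
  moreover have "2 * (k 1 * (b - c)) = (k 1 * (b - a) + k 3 * c * (b - a))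
      - (- k 1 * (b - 2 * c + a) + k 3 * c * (b - a))" by (simp add: algebra_simps)
  ultimately have 1: "k 1 = 0" "k 3 = 0" using abc by auto
  have "k 5 * (c - b) = 0" using *[of "b2 + b3"] by (simp add: d 1 2)
  then have "k 5 = 0" using abc by simp
  with 1 2 have "\<forall>i. k i = 0" by (simp add: forall_5)
  then show ?thesis ..
qed

text \<open>The line is spanned by \<open>(1, 1, 1)\<close> and \<open>(a, b, c)\<close>. In the
  coordinates \<open>x\<close>, \<open>y\<close> belonging to these vectors the conic, which passes
  through both points, restricts to a nonzero multiple of \<open>x * y\<close>.\<close>

lemma line_Int_conic:
  assumes "(b - c) * w + (c - a) * u + (a - b) * v = 0"
    and "c * (b - a) * (w * u) + b * (a - c) * (w * v) + a * (c - b) * (u * v) = 0"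
  obtains s where "w = s" "u = s" "v = s" | s where "w = s * a" "u = s * b" "v = s * c"
proof -
  define y where "y = (u - w) / (b - a)"
  define x where "x = w - y * a"
  have w: "w = x + y * a" by (simp add: x_def)
  have "y * (b - a) = u - w" using abc by (simp add: y_def)
  then have u: "u = x + y * b" by (simp add: w algebra_simps)
  have "(a - b) * v = (a - b) * (x + y * c)" using assms(1) unfolding w u by (simp add: algebra_simps)
  then have v: "v = x + y * c" using abc by simp
  have "x * y * ((a - b) * (b - c) * (a - c)) = 0"
    using assms(2) unfolding u v w by (simp add: algebra_simps)
  then have "x = 0 \<or> y = 0" using abc by simp
  then show ?thesis using that(1)[of x] that(2)[of y] u v w by auto
qed

end

section \<open>Values of the anticanonical map off and on the exceptional curves\<close>

text \<open>On an exceptional curve the map is the span of derivatives at all \<open>v\<close> in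
  the point along all \<open>w\<close> in the line. Homogeneity in \<open>v\<close>, and Euler's
  relation, by which the derivative along \<open>v\<close> vanishes at a zero of the cubic, leave
  multiples of a single vector.\<close>

lemma dir_deriv_cubic:
  assumes f: "is_form 3 f"
  shows "dir_deriv f (k *s v) w = k ^ 2 * dir_deriv f v w"
    and "dir_deriv f v v = 3 * f v"
proof -
  have hom: "homogeneous f" using f by (auto simp: homogeneous_def)
  show "dir_deriv f (k *s v) w = k ^ 2 * dir_deriv f v w"
  proof (cases "k = 0")
    case True
    have "(\<lambda>z. f (0 + z *s w)) = (\<lambda>z. z ^ 3 * f w)" using is_form_smult[OF f] by simp
    moreover have "((\<lambda>z. z ^ 3 * f w) has_field_derivative 0) (at 0)"
      by (auto intro!: derivative_eq_intros)
    ultimately show ?thesis using True by (simp add: dir_deriv_def DERIV_imp_deriv)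
  next
    case False
    have "((\<lambda>z. f (v + (z / k) *s w)) has_field_derivative dir_deriv f (v + (0 / k) *s w) ((1 / k) *s w)) (at 0)"
      using False by (intro dir_deriv_chain[OF hom, where \<gamma> = "\<lambda>z. v + (z / k) *s w"])
        (auto intro!: derivative_eq_intros)
    moreover have "dir_deriv f v ((1 / k) *s w) = 1 / k * dir_deriv f v w"
      using dir_deriv_add_scale[OF hom, of v "1 / k" w 0] by simp
    ultimately have "((\<lambda>z. k ^ 3 * f (v + (z / k) *s w)) has_field_derivative k ^ 3 * (1 / k * dir_deriv f v w)) (at 0)"
      by (intro DERIV_cmult) simp
    moreover have "k ^ 3 * f (v + (z / k) *s w) = f (k *s v + z *s w)" for z
    proof -
      have "f (k *s v + z *s w) = f (k *s (v + (z / k) *s w))"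
        using False by (simp add: vec.scale_right_distrib)
      also have "\<dots> = k ^ 3 * f (v + (z / k) *s w)" by (rule is_form_smult[OF f])
      finally show ?thesis ..
    qed
    ultimately show ?thesis using False
      unfolding dir_deriv_def[of f "k *s v"] by (simp add: DERIV_imp_deriv power2_eq_square power3_eq_cube)
  qed
  have "f (v + z *s v) = (1 + z) ^ 3 * f v" for z
    using is_form_smult[OF f, of "1 + z" v] by (simp add: vec.scale_left_distrib)
  then have "(\<lambda>z. f (v + z *s v)) = (\<lambda>z. (1 + z) ^ 3 * f v)" ..
  moreover have "((\<lambda>z. (1 + z) ^ 3 * f v) has_field_derivative 3 * f v) (at 0)"
    by (auto intro!: derivative_eq_intros)
  ultimately show "dir_deriv f v v = 3 * f v" by (simp add: dir_deriv_def DERIV_imp_deriv)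
qed

lemma span_eq_span_singleton:
  assumes "d \<in> A" "A \<subseteq> vec.span {d}"
  shows "vec.span A = vec.span {d}"
proof
  show "vec.span A \<subseteq> vec.span {d}" using assms(2) by (rule vec.span_minimal) (rule vec.subspace_span)
  show "vec.span {d} \<subseteq> vec.span A" using assms(1) by (intro vec.span_mono) simp
qed

lemma span_pair_line:
  assumes "v \<noteq> 0" "w \<notin> vec.span {v}"
  shows "vec.span {v, w} \<in> proj_lines"
proof -
  have "vec.independent {v}" using assms(1) by simp
  with assms(2) have "vec.independent {w, v}" by (rule vec.independent_insertI)
  moreover have "w \<noteq> v" using assms by (auto intro: vec.span_base)
  ultimately have "vec.dim (vec.span {v, w}) = 2"
    using vec.dim_eq_card_independent[of "{v, w}"] by (simp add: insert_commute)
  then show ?thesis by (simp add: proj_lines_def vec.subspace_span)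
qed

lemma span_subset_span_pair:
  "vec.span {v :: complex ^ 'n} \<subseteq> vec.span {v, w}" "vec.span {w} \<subseteq> vec.span {v, w}"
  by (rule vec.span_mono, simp)+

text \<open>Another basis \<open>f\<close> of the cubics changes the surface by a linear map of the
  ambient space. The coordinates \<open>l0\<close> to \<open>l4\<close> absorb it: in them the map
  is always given by \<open>G\<close>.\<close>

locale del_pezzo = five_points + linear_coords +
  fixes f :: "5 \<Rightarrow> complex ^ 3 \<Rightarrow> complex"
  assumes f_cubic: "f j \<in> cubics_through p"
    and f_coords: "l0 (\<chi> j. f j z) = G 1 z" "l1 (\<chi> j. f j z) = G 2 z" "l2 (\<chi> j. f j z) = G 3 z"
      "l3 (\<chi> j. f j z) = G 4 z" "l4 (\<chi> j. f j z) = G 5 z"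
begin

lemma f_form: "is_form 3 (f j)" and f_homogeneous: "homogeneous (f j)"
  and f_vanishes: "x \<in> range p \<Longrightarrow> v \<in> x \<Longrightarrow> f j v = 0"
  using f_cubic[of j] by (auto simp: cubics_through_def homogeneous_def vanishes_on_def)

abbreviation S where "S \<equiv> del_pezzo_quartic p f"

lemma p_points: "\<exists>v. v \<noteq> 0 \<and> p i = vec.span {v}"
proof -
  have "p i \<in> range p" by simp
  then show ?thesis unfolding range_p points using point_nonzero by auto
qed

lemma plane_point_in_S:
  assumes v: "v \<noteq> 0" "vec.span {v} \<notin> range p"
  shows "vec.span {pt (G 1 v) (G 2 v) (G 3 v) (G 4 v) (G 5 v)} \<in> S"
proof -
  obtain e where e: "\<And>i. e i \<noteq> 0" "\<And>i. p i = vec.span {e i}" using p_points by metis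
  define L where "L i = vec.span {e i, v}" for i
  have "v \<notin> vec.span {e i}" for i
  proof
    assume "v \<in> vec.span {e i}"
    then obtain k where k: "v = k *s e i" by (auto simp: span_singleton_iff)
    then have "k \<noteq> 0" using v by auto
    then have "vec.span {e i} = vec.span {v}" using span_eq_iff[OF e(1)] k by blast
    then show False using v(2) e(2)[of i] by (metis rangeI)
  qed
  then have "(vec.span {v}, L) \<in> blowup p"
    using v(1) e by (simp add: blowup_def proj_point_iff L_def span_pair_line span_subset_span_pair)
  moreover have "anticanonical_map p f (vec.span {v}, L) = vec.span {\<chi> j. f j v}"
  proof -
    have "vec.span {\<chi> j. f j x |x. x \<in> vec.span {v}} = vec.span {\<chi> j. f j v}"
    proof (rule span_eq_span_singleton)
      show "(\<chi> j. f j v) \<in> {\<chi> j. f j x |x. x \<in> vec.span {v}}"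
        using vec.span_base[of v "{v}"] by blast
      have "(\<chi> j. f j (k *s v)) = k ^ 3 *s (\<chi> j. f j v)" for k
        by (simp add: Finite_Cartesian_Product.vec_eq_iff is_form_smult[OF f_form])
      then show "{\<chi> j. f j x |x. x \<in> vec.span {v}} \<subseteq> vec.span {\<chi> j. f j v}"
        unfolding span_singleton_iff by (auto simp: span_singleton_iff)
    qed
    moreover have "{(\<chi> j. dir_deriv (f j) x y) | i x y. vec.span {v} = p i \<and> x \<in> vec.span {v} \<and> y \<in> L i} = {}"
      using v(2) by auto
    ultimately show ?thesis unfolding anticanonical_map_def split by (simp only: Un_empty_left)
  qed
  moreover have "(\<chi> j. f j v) = pt (G 1 v) (G 2 v) (G 3 v) (G 4 v) (G 5 v)"
    by (rule coords_eqI) (simp_all add: f_coords)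
  ultimately show ?thesis unfolding del_pezzo_quartic_def by (metis image_eqI)
qed

text \<open>The point of the blow-up is the direction \<open>w\<close> at the base point
  \<open>v\<close>, with the joins of \<open>p i\<close> and \<open>p j\<close> as the other lines.
  That \<open>w\<close> is not a multiple of \<open>v\<close> follows from \<open>nz\<close>, since
  the cubics vanish at \<open>v\<close> and so do their derivatives along \<open>v\<close>.\<close>

lemma exceptional_point_in_S:
  assumes v: "v \<noteq> 0" "p i = vec.span {v}"
    and D: "\<And>j. ((\<lambda>z. G j (v + z *s w)) has_field_derivative D j) (at 0)"
    and nz: "pt (D 1) (D 2) (D 3) (D 4) (D 5) \<noteq> 0"
  shows "vec.span {pt (D 1) (D 2) (D 3) (D 4) (D 5)} \<in> S"
proof -
  define d where "d = (\<chi> j. dir_deriv (f j) v w)"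
  have ld: "l d = deriv (\<lambda>z. l (\<chi> j. f j (v + z *s w))) 0" if lin: "is_form 1 l" for l
  proof -
    obtain k where k: "l = (\<lambda>x. \<Sum>j\<in>UNIV. k j * x $ j)" using lin unfolding is_form_1_iff by blast
    have "((\<lambda>z. f j (v + z *s w)) has_field_derivative dir_deriv (f j) (v + 0 *s w) w) (at 0)" for j
      by (rule dir_deriv_chain[OF f_homogeneous]) (auto intro!: derivative_eq_intros)
    then have "((\<lambda>z. \<Sum>j\<in>UNIV. k j * f j (v + z *s w)) has_field_derivative
        (\<Sum>j\<in>UNIV. k j * dir_deriv (f j) v w)) (at 0)"
      by (intro DERIV_sum DERIV_cmult) simp
    then show ?thesis unfolding k d_def by (simp add: DERIV_imp_deriv)
  qed
  have d_pt: "d = pt (D 1) (D 2) (D 3) (D 4) (D 5)"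
    by (rule coords_eqI) (simp_all add: ld[OF l_form(1)] ld[OF l_form(2)] ld[OF l_form(3)]
        ld[OF l_form(4)] ld[OF l_form(5)] f_coords DERIV_imp_deriv[OF D])
  have fv: "f j v = 0" for j using f_vanishes[of "p i" v] v(2) by (metis rangeI singletonI vec.span_base)
  have D_lin: "(\<chi> j. dir_deriv (f j) (k *s v) (s *s v + t *s w)) = (k ^ 2 * t) *s d" for k s t
    by (simp add: Finite_Cartesian_Product.vec_eq_iff d_def dir_deriv_cubic[OF f_form]
        dir_deriv_add_scale[OF f_homogeneous] fv)
  have w: "w \<notin> vec.span {v}"
  proof
    assume "w \<in> vec.span {v}"
    then obtain k where "w = k *s v + 0 *s w" by (auto simp: span_singleton_iff)
    then have "d = 0" using D_lin[of 1 k 0] by (simp add: d_def)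
    then show False using nz d_pt by simp
  qed
  obtain e where e: "\<And>i. e i \<noteq> 0" "\<And>i. p i = vec.span {e i}" using p_points by metis
  define L where "L j = (if j = i then vec.span {v, w} else vec.span {v, e j})" for j
  have "e j \<notin> vec.span {v}" if "j \<noteq> i" for j
  proof
    assume "e j \<in> vec.span {v}"
    then obtain k where k: "e j = k *s v" by (auto simp: span_singleton_iff)
    then have "k \<noteq> 0" using e(1)[of j] by auto
    then have "p i = p j" using span_eq_iff[OF v(1)] k v e by metis
    then show False using inj_p that by (auto dest: injD)
  qed
  then have "(vec.span {v}, L) \<in> blowup p"
    using v e w by (simp add: blowup_def proj_point_iff L_def span_pair_line span_subset_span_pair)
  moreover have "anticanonical_map p f (vec.span {v}, L) = vec.span {d}"
    unfolding anticanonical_map_def split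
  proof (rule span_eq_span_singleton)
    have "w \<in> L i" by (simp add: L_def vec.span_base)
    then show "d \<in> {(\<chi> j. dir_deriv (f j) x y) | i x y. vec.span {v} = p i \<and> x \<in> vec.span {v} \<and> y \<in> L i}
        \<union> {\<chi> j. f j x |x. x \<in> vec.span {v}}"
      unfolding d_def using v(2) vec.span_base[of v "{v}"] by blast
    have "(\<chi> j. dir_deriv (f j) x y) \<in> vec.span {d}"
      if xy: "vec.span {v} = p i'" "x \<in> vec.span {v}" "y \<in> L i'" for i' x y
    proof -
      have "i' = i" using xy(1) v(2) inj_p by (auto dest: injD)
      then obtain k s t where "x = k *s v" "y = s *s v + t *s w"
        using xy(2,3) by (auto simp: L_def span_singleton_iff vec.span_insert[of v] algebra_simps)
      then show ?thesis using D_lin[of k s t] by (auto simp: span_singleton_iff)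
    qed
    moreover have "(\<chi> j. f j x) = 0" if "x \<in> vec.span {v}" for x
    proof -
      have "f j x = 0" for j using f_vanishes[of "p i" x j] v(2) that by (metis rangeI)
      then show ?thesis by (simp add: Finite_Cartesian_Product.vec_eq_iff)
    qed
    ultimately show "{(\<chi> j. dir_deriv (f j) x y) | i x y. vec.span {v} = p i \<and> x \<in> vec.span {v} \<and> y \<in> L i}
        \<union> {\<chi> j. f j x |x. x \<in> vec.span {v}} \<subseteq> vec.span {d}"
      by (auto simp: vec.span_zero)
  qed
  ultimately show ?thesis unfolding del_pezzo_quartic_def d_pt by (metis image_eqI)
qed


text \<open>The product rule for the five cubics; \<open>dq\<close> is the polar form of the
  quadratic form \<open>q\<close>.\<close>

definition DG :: "5 \<Rightarrow> complex ^ 3 \<Rightarrow> complex ^ 3 \<Rightarrow> complex" where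
  "DG i v w = (let dq = c * (b - a) * (W v * U w + W w * U v) + b * (a - c) * (W v * V w + W w * V v)
       + a * (c - b) * (U v * V w + U w * V v) in
     if i = 1 then U w * (W v * m v) + U v * (W w * m v + W v * m w)
     else if i = 2 then V w * (W v * m v) + V v * (W w * m v + W v * m w)
     else if i = 3 then U w * q v + U v * dq else if i = 4 then V w * q v + V v * dq
     else U w * (V v * m v) + U v * (V w * m v + V v * m w))"

lemma DG: "((\<lambda>z. G i (v + z *s w)) has_field_derivative DG i v w) (at 0)"
  by (cases "i = 1"; cases "i = 2"; cases "i = 3"; cases "i = 4")
    (auto simp: G_def DG_def m_def q_def Let_def intro!: derivative_eq_intros, (simp add: algebra_simps)+)

text \<open>The factor \<open>k\<close> allows directions \<open>w\<close> without
  denominators.\<close>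

lemma exceptional_point:
  assumes "p i = vec.span {v}" "v \<noteq> 0" "pt y0 y1 y2 y3 y4 \<noteq> 0" "k \<noteq> 0"
    and "DG 1 v w = k * y0" "DG 2 v w = k * y1" "DG 3 v w = k * y2" "DG 4 v w = k * y3" "DG 5 v w = k * y4"
  shows "vec.span {pt y0 y1 y2 y3 y4} \<in> S"
proof -
  let ?d = "pt (DG 1 v w) (DG 2 v w) (DG 3 v w) (DG 4 v w) (DG 5 v w)"
  have *: "?d = k *s pt y0 y1 y2 y3 y4" by (simp add: assms pt_scale)
  then have "?d \<noteq> 0" using assms(3,4) by simp
  with exceptional_point_in_S[OF assms(2,1) DG] have "vec.span {?d} \<in> S" by blast
  moreover have "vec.span {pt y0 y1 y2 y3 y4} = vec.span {?d}"
    using span_eq_iff[OF assms(3)] * assms(4) by blast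
  ultimately show ?thesis by simp
qed

lemma exceptional_curve_1:
  assumes "pt y0 y1 0 0 0 \<noteq> 0"
  shows "vec.span {pt y0 y1 0 0 0} \<in> S"
  by (rule exceptional_point[OF points(1) point_nonzero(1) assms, of "b - c" "y0 *s b2 + y1 *s b3"])
    (use abc in \<open>simp_all add: DG_def m_def q_def\<close>)

text \<open>The second hypothesis is the linear relation of the surface at
  \<open>y1 = y3 = y5 = 0\<close>. The factor \<open>c - a\<close> is the value of \<open>m\<close>
  at \<open>b2\<close>.\<close>

lemma exceptional_curve_2:
  assumes "pt y0 0 y2 0 y4 \<noteq> 0" and "a * (b - c) * y4 = c * (b - a) * y0 + (a - c) * y2"
  shows "vec.span {pt y0 0 y2 0 y4} \<in> S"
  by (rule exceptional_point[OF points(2) point_nonzero(2) assms(1), of "c - a" "y0 *s b1 + y4 *s b3"])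
    (use abc assms(2) in \<open>simp_all add: DG_def m_def q_def algebra_simps\<close>)

lemma exceptional_curve_3:
  assumes "pt 0 y1 0 y3 y4 \<noteq> 0" and "a * (b - c) * y4 = b * (a - c) * y1 + (b - a) * y3"
  shows "vec.span {pt 0 y1 0 y3 y4} \<in> S"
  by (rule exceptional_point[OF points(3) point_nonzero(3) assms(1), of "a - b" "y1 *s b1 + y4 *s b2"])
    (use abc assms(2) in \<open>simp_all add: DG_def m_def q_def algebra_simps\<close>)

lemma exceptional_curve_4:
  assumes "pt x x y y x \<noteq> 0"
  shows "vec.span {pt x x y y x} \<in> S"
proof (rule exceptional_point[OF points(4) point_nonzero(4) assms, of "(c - a) * (a - b) * (c - b)"])
  \<comment> \<open>Modulo the base point, \<open>w\<close> may be taken in the span of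
    \<open>b2\<close> and \<open>b3\<close>. The two coefficients solve \<open>m w = k * x\<close>
    and \<open>dq = k * y\<close>, where \<open>k\<close> is the factor given above;
    \<open>m\<close> and \<open>q\<close> vanish at the base point.\<close>
  let ?w = "((a - b) * (c * x - y)) *s b2 + ((c - a) * (y - b * x)) *s b3"
  show "DG 1 (b1 + b2 + b3) ?w = (c - a) * (a - b) * (c - b) * x"
    "DG 2 (b1 + b2 + b3) ?w = (c - a) * (a - b) * (c - b) * x"
    "DG 5 (b1 + b2 + b3) ?w = (c - a) * (a - b) * (c - b) * x"
    "DG 3 (b1 + b2 + b3) ?w = (c - a) * (a - b) * (c - b) * y"
    "DG 4 (b1 + b2 + b3) ?w = (c - a) * (a - b) * (c - b) * y"
    by (simp_all add: DG_def m_def q_def) (simp_all add: algebra_simps)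
qed (use abc in simp)

lemma exceptional_curve_5:
  assumes "pt (a * b * x) (a * c * x) (b * y) (c * y) (b * c * x) \<noteq> 0"
  shows "vec.span {pt (a * b * x) (a * c * x) (b * y) (c * y) (b * c * x)} \<in> S"
proof (rule exceptional_point[OF points(5) point_nonzero(5) assms, of "a * (c - b) * (c - a) * (a - b)"])
  \<comment> \<open>The same two linear equations \<open>m w = k * x\<close> and
    \<open>dq = k * y\<close>, now at \<open>p 5\<close>.\<close>
  let ?w = "((a - b) * (y - a * b * x)) *s b2 + ((c - a) * (a * c * x - y)) *s b3"
  let ?v = "a *s b1 + b *s b2 + c *s b3"
  show "DG 1 ?v ?w = a * (c - b) * (c - a) * (a - b) * (a * b * x)"
    "DG 2 ?v ?w = a * (c - b) * (c - a) * (a - b) * (a * c * x)"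
    "DG 3 ?v ?w = a * (c - b) * (c - a) * (a - b) * (b * y)"
    "DG 4 ?v ?w = a * (c - b) * (c - a) * (a - b) * (c * y)"
    "DG 5 ?v ?w = a * (c - b) * (c - a) * (a - b) * (b * c * x)"
    by (simp_all add: DG_def m_def q_def) (simp_all add: algebra_simps)
qed (use abc in simp)

lemma plane_point:
  assumes "pt y0 y1 y2 y3 y4 \<noteq> 0" "k \<noteq> 0" "z \<noteq> 0" "vec.span {z} \<notin> range p"
    and "G 1 z = k * y0" "G 2 z = k * y1" "G 3 z = k * y2" "G 4 z = k * y3" "G 5 z = k * y4"
  shows "vec.span {pt y0 y1 y2 y3 y4} \<in> S"
proof -
  let ?d = "pt (G 1 z) (G 2 z) (G 3 z) (G 4 z) (G 5 z)"
  have *: "?d = k *s pt y0 y1 y2 y3 y4" by (simp add: assms pt_scale)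
  have "vec.span {?d} \<in> S" by (rule plane_point_in_S) fact+
  moreover have "vec.span {pt y0 y1 y2 y3 y4} = vec.span {?d}"
    using span_eq_iff[OF assms(1)] * assms(2) by blast
  ultimately show ?thesis by simp
qed

lemma G_at_points: "x \<in> range p \<Longrightarrow> v \<in> x \<Longrightarrow> G i v = 0"
  using G_cubic[of i] by (auto simp: cubics_through_def vanishes_on_def)

text \<open>The hyperplane coordinates \<open>U W m\<close>, \<open>V W m\<close>, \<open>U q\<close>, \<open>V q\<close>, \<open>U V m\<close> and the dependent
  \<open>W q\<close> show that \<open>[W : U : V] = [y5 : y2 : y3]\<close> and \<open>[W : U : V] = [1 / y4 : 1 / y1 : 1 / y0]\<close>.\<close>

lemma model_point_in_S:
  assumes nz: "pt y0 y1 y2 y3 y4 \<noteq> 0"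
    and quad: "y0 * y3 = y1 * y2" "y4 * y5 = y0 * y3"
    and lin: "(b - c) * (y5 + a * y4) = c * (b - a) * y0 + b * (a - c) * y1 + (a - c) * y2 + (b - a) * y3"
  shows "vec.span {pt y0 y1 y2 y3 y4} \<in> S"
proof -
  define z where "z = y5 *s b1 + y2 *s b2 + y3 *s b3"
  have z: "W z = y5" "U z = y2" "V z = y3" by (simp_all add: z_def)
  \<comment> \<open>For the cubics, \<open>lin\<close> is the identity \<open>q * m = m * q\<close>,
    where the outer \<open>m\<close> on the left and the outer \<open>q\<close> on the right are
    expanded in \<open>W\<close>, \<open>U\<close>, \<open>V\<close>. Here it expresses
    \<open>m z\<close> without \<open>y2\<close>, \<open>y3\<close> and \<open>y5\<close>.\<close>
  have mz: "m z = c * (b - a) * y0 + b * (a - c) * y1 - a * (b - c) * y4"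
    unfolding m_def z using lin by (simp add: algebra_simps)
  have q1: "q z * y0 = y2 * (y5 * m z)"
  proof -
    have "q z * y0 = c * (b - a) * y5 * y2 * y0 + b * (a - c) * y5 * (y0 * y3) + a * (c - b) * y2 * (y0 * y3)"
      unfolding q_def z by (simp add: algebra_simps)
    also have "\<dots> = c * (b - a) * y5 * y2 * y0 + b * (a - c) * y5 * (y1 * y2) + a * (c - b) * y2 * (y4 * y5)"
      by (simp add: quad)
    finally show ?thesis unfolding mz by (simp add: algebra_simps)
  qed
  have q2: "q z * y1 = y3 * (y5 * m z)"
  proof -
    have "q z * y1 = c * (b - a) * y5 * (y1 * y2) + b * (a - c) * y5 * y3 * y1 + a * (c - b) * y3 * (y1 * y2)"
      unfolding q_def z by (simp add: algebra_simps)
    also have "\<dots> = c * (b - a) * y5 * (y0 * y3) + b * (a - c) * y5 * y3 * y1 + a * (c - b) * y3 * (y4 * y5)"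
      by (simp add: quad)
    finally show ?thesis unfolding mz by (simp add: algebra_simps)
  qed
  have q3: "q z * y4 = y2 * (y3 * m z)"
  proof -
    have "q z * y4 = c * (b - a) * y2 * (y4 * y5) + b * (a - c) * y3 * (y4 * y5) + a * (c - b) * y2 * y3 * y4"
      unfolding q_def z by (simp add: algebra_simps)
    also have "\<dots> = c * (b - a) * y2 * (y0 * y3) + b * (a - c) * y3 * (y1 * y2) + a * (c - b) * y2 * y3 * y4"
      by (simp add: quad)
    finally show ?thesis unfolding mz by (simp add: algebra_simps)
  qed
  \<comment> \<open>\<open>e1\<close> to \<open>e5\<close> are the conditions that cut out the five
    exceptional curves.\<close>
  have e1: ?thesis if "y2 = 0" "y3 = 0" "y4 = 0"
    using exceptional_curve_1[of y0 y1] nz that by simp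
  have e2: ?thesis if "y1 = 0" "y3 = 0" "y5 = 0"
    using exceptional_curve_2[of y0 y2 y4] nz lin that by (simp add: algebra_simps)
  have e3: ?thesis if "y0 = 0" "y2 = 0" "y5 = 0"
    using exceptional_curve_3[of y1 y3 y4] nz lin that by (simp add: algebra_simps)
  have e4: ?thesis if "y0 = y4" "y1 = y4" "y2 = y3"
    using exceptional_curve_4[of y4 y3] nz that by simp
  have e5: ?thesis if "y0 * c = y1 * b" "y0 * c = y4 * a" "y2 = s * b" "y3 = s * c" for s
  proof -
    define x where "x = y0 / (a * b)"
    have "y0 = a * b * x" "y1 = a * c * x" "y4 = b * c * x" "y2 = b * s" "y3 = c * s"
      using that abc by (auto simp: x_def field_simps)
    then show ?thesis using exceptional_curve_5[of x s] nz by simp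
  qed
  \<comment> \<open>Off the conic \<open>q = 0\<close> the point \<open>z\<close> is a preimage,
    with factor \<open>q z\<close>. On the conic and on the line \<open>m = 0\<close> it is
    \<open>p 4\<close> or \<open>p 5\<close>, or its coordinates all vanish; on the conic but off
    the line it is one of \<open>p 1\<close>, \<open>p 2\<close>, \<open>p 3\<close>.\<close>
  show ?thesis
  proof (cases "q z = 0")
    case False
    have "z \<noteq> 0" using False by (auto simp: q_def)
    moreover have "vec.span {z} \<notin> range p"
      using False q_at_points[of "vec.span {z}" z] by (auto intro: vec.span_base)
    ultimately show ?thesis
      by (rule plane_point[OF nz False]) (use q1 q2 q3 in \<open>simp_all add: G_simps z mult_ac\<close>)
  next
    case q0: True
    show ?thesis
    proof (cases "m z = 0")
      case True
      have "(b - c) * y5 + (c - a) * y2 + (a - b) * y3 = 0"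
        "c * (b - a) * (y5 * y2) + b * (a - c) * (y5 * y3) + a * (c - b) * (y2 * y3) = 0"
        using True q0 by (simp_all add: m_def q_def z)
      then consider s where "y5 = s" "y2 = s" "y3 = s" "s \<noteq> 0"
        | s where "y5 = s * a" "y2 = s * b" "y3 = s * c" "s \<noteq> 0" | "y5 = 0" "y2 = 0" "y3 = 0"
        by (metis line_Int_conic mult_zero_left)
      then show ?thesis
      proof cases
        case 1
        then show ?thesis using quad by (intro e4) auto
      next
        case 2
        then have "y0 * c = y1 * b" "y0 * c = y4 * a" using quad by (auto simp: mult_ac)
        then show ?thesis using 2 by (intro e5) auto
      next
        case 3
        show ?thesis
        proof (cases "y0 = 0 \<or> y1 = 0 \<or> y4 = 0")
          case True
          then show ?thesis using e1 e2 e3 3 by auto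
        next
          case False
          \<comment> \<open>For \<open>z = 0\<close> the given point belongs to the conic
            \<open>q = 0\<close>. The other formula for the preimage applies, multiplied by
            \<open>y0 * y1 * y4\<close> to clear denominators.\<close>
          define x where "x = (y0 * y1) *s b1 + (y0 * y4) *s b2 + (y1 * y4) *s b3"
          have x: "W x = y0 * y1" "U x = y0 * y4" "V x = y1 * y4" by (simp_all add: x_def)
          have "q x = y0 * y1 * y4 * (c * (b - a) * y0 + b * (a - c) * y1 - a * (b - c) * y4)"
            unfolding q_def x by (simp add: algebra_simps)
          also have "c * (b - a) * y0 + b * (a - c) * y1 - a * (b - c) * y4 = 0"
            using lin 3 by (simp add: algebra_simps)
          finally have qx: "q x = 0" by simp
          show ?thesis
          proof (cases "m x = 0")
            case False
            let ?k = "y0 * y1 * y4 * m x"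
            have k: "?k \<noteq> 0" using False \<open>\<not> (y0 = 0 \<or> y1 = 0 \<or> y4 = 0)\<close> by simp
            have G: "G 1 x = ?k * y0" by (simp add: G_simps x)
            have "x \<noteq> 0" using False by (auto simp: m_def)
            moreover have "vec.span {x} \<notin> range p"
              using G_at_points[of "vec.span {x}" x 1] k False \<open>\<not> (y0 = 0 \<or> y1 = 0 \<or> y4 = 0)\<close>
              by (auto simp: G intro: vec.span_base)
            ultimately show ?thesis
              by (rule plane_point[OF nz k]) (simp_all add: G_simps x qx 3)
          next
            case True
            have "(b - c) * (y0 * y1) + (c - a) * (y0 * y4) + (a - b) * (y1 * y4) = 0"
              "c * (b - a) * (y0 * y1 * (y0 * y4)) + b * (a - c) * (y0 * y1 * (y1 * y4))
                + a * (c - b) * (y0 * y4 * (y1 * y4)) = 0"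
              using True qx by (simp_all add: m_def q_def x)
            then show ?thesis
            proof (rule line_Int_conic)
              fix s assume "y0 * y1 = s" "y0 * y4 = s" "y1 * y4 = s"
              then show ?thesis using False 3 by (intro e4) auto
            next
              fix s assume s: "y0 * y1 = s * a" "y0 * y4 = s * b" "y1 * y4 = s * c"
              have *: "s * (y0 * c) = y0 * (y1 * y4)" unfolding s(3) by simp
              have **: "s * (y1 * b) = y1 * (y0 * y4)" unfolding s(2) by simp
              have ***: "s * (y4 * a) = y4 * (y0 * y1)" unfolding s(1) by simp
              have "s * (y0 * c) = s * (y1 * b)" "s * (y0 * c) = s * (y4 * a)"
                unfolding * ** *** by simp_all
              moreover have "s \<noteq> 0" using s False by auto
              ultimately show ?thesis using 3 by (intro e5[of 0]) auto
            qed
          qed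
        qed
      qed
    next
      case False
      then have "y2 * y5 = 0" "y3 * y5 = 0" "y2 * y3 = 0" using q1 q2 q3 q0 by auto
      moreover have "y2 \<noteq> 0 \<or> y3 \<noteq> 0 \<or> y5 \<noteq> 0" using False by (auto simp: m_def z)
      ultimately consider "y2 = 0" "y3 = 0" "y5 \<noteq> 0" | "y2 \<noteq> 0" "y3 = 0" "y5 = 0"
        | "y2 = 0" "y3 \<noteq> 0" "y5 = 0" by auto
      then show ?thesis using quad e1 e2 e3 by cases auto
    qed
  qed
qed

end

section \<open>Coordinates adapted to five general points and to a basis of cubics\<close>

lemma dual_basis:
  fixes b :: "'n::finite \<Rightarrow> complex ^ 'n"
  assumes indep: "\<And>k i. (\<Sum>i\<in>UNIV. k i *s b i) = 0 \<Longrightarrow> k i = 0"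
  obtains u where "\<And>i. is_form 1 (u i)" "\<And>x. x = (\<Sum>i\<in>UNIV. u i x *s b i)"
    "\<And>i j. u i (b j) = (if i = j then 1 else 0)"
proof -
  define A :: "complex ^ 'n ^ 'n" where "A = (\<chi> r i. b i $ r)"
  have A: "A *v x = (\<Sum>i\<in>UNIV. x $ i *s b i)" for x
    by (simp add: A_def matrix_vector_mult_def Finite_Cartesian_Product.vec_eq_iff mult.commute)
  have "\<forall>x. A *v x = 0 \<longrightarrow> x = 0"
    using indep by (auto simp: A Finite_Cartesian_Product.vec_eq_iff)
  then obtain B where "B ** A = Finite_Cartesian_Product.mat 1" using matrix_left_invertible_ker by blast
  then have "A ** B = Finite_Cartesian_Product.mat 1" using matrix_left_right_inverse by blast
  then have AB: "A *v (B *v x) = x" for x by (simp add: matrix_vector_mul_assoc)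
  define u where "u i x = (B *v x) $ i" for i x
  have form: "is_form 1 (u i)" for i
    unfolding is_form_1_iff u_def[abs_def] by (intro exI[of _ "\<lambda>j. B $ i $ j"]) (simp add: matrix_vector_mult_def)
  have expand: "x = (\<Sum>i\<in>UNIV. u i x *s b i)" for x
    using AB[of x] by (simp add: A u_def)
  have "u i (b j) = (if i = j then 1 else 0)" for i j
  proof -
    have "(\<Sum>i\<in>UNIV. (u i (b j) - (if i = j then 1 else 0)) *s b i)
        = (\<Sum>i\<in>UNIV. u i (b j) *s b i) - (\<Sum>i\<in>UNIV. if i = j then b i else 0)"
      unfolding sum_subtractf[symmetric] by (intro sum.cong) (auto simp: vec.scale_left_diff_distrib)
    also have "\<dots> = 0" using expand[of "b j"] by simp
    finally show ?thesis using indep[of "\<lambda>i. u i (b j) - (if i = j then 1 else 0)" i] by simp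
  qed
  with form expand show ?thesis by (rule that)
qed

lemma dual_coordinates:
  fixes l :: "'n::finite \<Rightarrow> complex ^ 'n \<Rightarrow> complex"
  assumes form: "\<And>i. is_form 1 (l i)"
    and indep: "\<And>k i. (\<And>x. (\<Sum>i\<in>UNIV. k i * l i x) = 0) \<Longrightarrow> k i = 0"
  obtains v where "\<And>y i. l i (v y) = y i" "\<And>x. v (\<lambda>i. l i x) = x"
proof -
  from form obtain c where c: "\<And>i. l i = (\<lambda>x. \<Sum>j\<in>UNIV. c i j * x $ j)"
    unfolding is_form_1_iff by metis
  define A where "A = (\<chi> i j. c i j)"
  have A: "(A *v x) $ i = l i x" for x i by (simp add: A_def c matrix_vector_mult_def)
  have "k i = 0" if "(\<Sum>i\<in>UNIV. k i *s Finite_Cartesian_Product.row i A) = 0" for k i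
  proof (rule indep)
    fix x
    have 1: "(\<Sum>i\<in>UNIV. k i * c i j) = 0" for j
      using arg_cong[OF that, of "\<lambda>v. v $ j"] by (simp add: Finite_Cartesian_Product.row_def A_def)
    have "(\<Sum>i\<in>UNIV. k i * l i x) = (\<Sum>j\<in>UNIV. (\<Sum>i\<in>UNIV. k i * c i j) * x $ j)"
      unfolding c sum_distrib_left sum_distrib_right by (subst sum.swap) (simp add: mult.assoc)
    then show "(\<Sum>i\<in>UNIV. k i * l i x) = 0" by (simp add: 1)
  qed
  then obtain B where AB: "A ** B = Finite_Cartesian_Product.mat 1" using matrix_right_invertible_independent_rows[of A] by blast
  then have BA: "B ** A = Finite_Cartesian_Product.mat 1" using matrix_left_right_inverse by blast
  show ?thesis
  proof (rule that[of "\<lambda>y. B *v (\<chi> i. y i)"])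
    fix y i
    have "l i (B *v (\<chi> i. y i)) = (A *v (B *v (\<chi> i. y i))) $ i" by (simp add: A)
    then show "l i (B *v (\<chi> i. y i)) = y i" by (simp add: matrix_vector_mul_assoc AB)
  next
    fix x
    have "(\<chi> i. l i x) = A *v x" by (simp add: Finite_Cartesian_Product.vec_eq_iff A)
    then show "B *v (\<chi> i. l i x) = x" by (simp add: matrix_vector_mul_assoc BA)
  qed
qed

lemma general_points_imp_five_points:
  assumes "general_points p"
  obtains b1 b2 b3 W U V a b c where "five_points p b1 b2 b3 W U V a b c"
proof -
  have inj: "inj p" and proj: "range p \<subseteq> proj_space"
    and col: "\<And>L. L \<in> proj_lines \<Longrightarrow> card {i. p i \<subseteq> L} \<le> 2"
    using assms by (auto simp: general_points_def)
  have "\<exists>v. v \<noteq> 0 \<and> p i = vec.span {v}" for i using proj by (auto simp: proj_space_def)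
  then obtain e where e: "\<And>i. e i \<noteq> 0" "\<And>i. p i = vec.span {e i}" by metis
  have combI: "s *s x + t *s y \<in> vec.span {x, y}" for s t and x y :: "complex ^ 3"
    by (simp add: vec.span_add vec.span_scale vec.span_base)
  have "s *s e i + t *s e j \<noteq> e k" if ijk: "i \<noteq> j" "i \<noteq> k" "j \<noteq> k" for i j k s t
  proof
    assume "s *s e i + t *s e j = e k"
    then have k: "e k \<in> vec.span {e i, e j}" using combI by metis
    have "e j \<notin> vec.span {e i}"
    proof
      assume "e j \<in> vec.span {e i}"
      then obtain r where r: "e j = r *s e i" by (auto simp: span_singleton_iff)
      then have "r \<noteq> 0" using e(1)[of j] by auto
      then have "p i = p j" using span_eq_iff[OF e(1)] r e(2) by metis
      then show False using inj ijk by (auto dest: injD)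
    qed
    then have L: "vec.span {e i, e j} \<in> proj_lines" using e(1) by (intro span_pair_line)
    have "p x \<subseteq> vec.span {e i, e j}" if "x \<in> {i, j, k}" for x
      using that k unfolding e(2) by (intro vec.span_minimal vec.subspace_span) (auto intro: vec.span_base)
    then have "{i, j, k} \<subseteq> {x. p x \<subseteq> vec.span {e i, e j}}" by blast
    then have "card {i, j, k} \<le> card {x. p x \<subseteq> vec.span {e i, e j}}" by (intro card_mono) auto
    with col[OF L] ijk show False by simp
  qed note noncol = this
  have neq: "(1::5) \<noteq> 2" "(1::5) \<noteq> 3" "(1::5) \<noteq> 4" "(1::5) \<noteq> 5" "(2::5) \<noteq> 3" "(2::5) \<noteq> 4" "(2::5) \<noteq> 5"
    "(3::5) \<noteq> 4" "(3::5) \<noteq> 5" "(4::5) \<noteq> 5" by simp_all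
  define \<epsilon> :: "3 \<Rightarrow> complex ^ 3" where "\<epsilon> i = (if i = 1 then e 1 else if i = 2 then e 2 else e 3)" for i
  have \<epsilon>: "\<epsilon> 1 = e 1" "\<epsilon> 2 = e 2" "\<epsilon> 3 = e 3" by (simp_all add: \<epsilon>_def)
  have indep: "k i = 0" if "(\<Sum>i\<in>UNIV. k i *s \<epsilon> i) = 0" for k i
  proof -
    have 0: "k 1 *s e 1 + k 2 *s e 2 + k 3 *s e 3 = 0" using that by (simp add: sum_3 \<epsilon>)
    have 3: "k 3 = 0"
    proof (rule ccontr)
      assume "k 3 \<noteq> 0"
      moreover have "k 3 *s e 3 = - (k 1 *s e 1 + k 2 *s e 2)"
        using 0 by (simp only: add_eq_0_iff)
      then have "(1 / k 3) *s (k 3 *s e 3) = (1 / k 3) *s (- (k 1 *s e 1 + k 2 *s e 2))" by simp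
      ultimately have "e 3 = (- k 1 / k 3) *s e 1 + (- k 2 / k 3) *s e 2"
        by (simp add: Finite_Cartesian_Product.vec_eq_iff field_simps)
      then show False using noncol[of 1 2 3] neq by metis
    qed
    have 2: "k 2 = 0"
    proof (rule ccontr)
      assume "k 2 \<noteq> 0"
      moreover have "k 2 *s e 2 = - (k 1 *s e 1)"
        using 0 3 by (simp add: eq_neg_iff_add_eq_0 add.commute)
      then have "(1 / k 2) *s (k 2 *s e 2) = (1 / k 2) *s (- (k 1 *s e 1))" by simp
      ultimately have "e 2 = (- k 1 / k 2) *s e 1 + 0 *s e 3"
        by (simp add: Finite_Cartesian_Product.vec_eq_iff field_simps)
      then show False using noncol[of 1 3 2] neq by metis
    qed
    have "k 1 = 0" using 0 2 3 e(1)[of 1] by simp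
    with 2 3 show ?thesis using exhaust_3[of i] by auto
  qed
  obtain u where u: "\<And>i. is_form 1 (u i)" "\<And>x. x = (\<Sum>i\<in>UNIV. u i x *s \<epsilon> i)"
    "\<And>i j. u i (\<epsilon> j) = (if i = j then 1 else 0)"
    by (rule dual_basis[of \<epsilon>]) (use indep in blast)+
  have ex: "x = u 1 x *s e 1 + u 2 x *s e 2 + u 3 x *s e 3" for x
    using u(2)[of x] by (simp add: sum_3 \<epsilon>)
  have ue: "u i (e 1) = (if i = 1 then 1 else 0)" "u i (e 2) = (if i = 2 then 1 else 0)"
    "u i (e 3) = (if i = 3 then 1 else 0)" for i
    using u(3)[of i 1] u(3)[of i 2] u(3)[of i 3] by (simp_all add: \<epsilon>)
  have nz: "u i (e j) \<noteq> 0" if "j = 4 \<or> j = 5" for i j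
  proof
    assume 0: "u i (e j) = 0"
    have "j \<noteq> 1" "j \<noteq> 2" "j \<noteq> 3" using that by auto
    then show False
      using exhaust_3[of i] ex[of "e j"] 0 noncol[of 1 2 j] noncol[of 1 3 j] noncol[of 2 3 j] neq
      by auto metis+
  qed
  \<comment> \<open>Once the first three vectors are rescaled so that \<open>e 4\<close> becomes
    their sum, these ratios are the coordinates of \<open>e 5\<close>.\<close>
  define r where "r i = u i (e 5) / u i (e 4)" for i
  have r0: "r i \<noteq> 0" for i using nz by (simp add: r_def)
  have e5: "u i (e 5) = r i * u i (e 4)" for i using nz by (simp add: r_def)
  have r_neq: "r i \<noteq> r j" if ij: "i \<noteq> j" for i j
  proof
    assume rij: "r i = r j"
    \<comment> \<open>With two equal ratios only the third basis vector survives in this difference,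
      so its point would be collinear with \<open>p 4\<close> and \<open>p 5\<close>.\<close>
    have "e 5 - r i *s e 4 = (u 1 (e 5) - r i * u 1 (e 4)) *s e 1 + (u 2 (e 5) - r i * u 2 (e 4)) *s e 2
        + (u 3 (e 5) - r i * u 3 (e 4)) *s e 3"
      by (subst (1) ex[of "e 5"], subst (1) ex[of "e 4"])
        (simp add: Finite_Cartesian_Product.vec_eq_iff algebra_simps)
    then have *: "e 5 - r i *s e 4 = ((r 1 - r i) * u 1 (e 4)) *s e 1 + ((r 2 - r i) * u 2 (e 4)) *s e 2
        + ((r 3 - r i) * u 3 (e 4)) *s e 3" by (simp add: e5 left_diff_distrib)
    have "\<exists>k t. k \<in> {1, 2, 3} \<and> e 5 - r i *s e 4 = t *s e k"
      using exhaust_3[of i] exhaust_3[of j] ij rij * by auto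
    then obtain k t where k: "k \<in> {1, 2, 3}" "e 5 - r i *s e 4 = t *s e k" by blast
    from k(2) have "r i *s e 4 + t *s e k = e 5" by (simp add: algebra_simps)
    then show False using noncol[of 4 k 5 "r i" t] k(1) neq by auto
  qed
  define b where "b i = u i (e 4)" for i
  have b0: "b i \<noteq> 0" for i using nz by (simp add: b_def)
  have "five_points p (b 1 *s e 1) (b 2 *s e 2) (b 3 *s e 3) (\<lambda>x. (1 / b 1) * u 1 x) (\<lambda>x. (1 / b 2) * u 2 x)
      (\<lambda>x. (1 / b 3) * u 3 x) (r 1) (r 2) (r 3)"
  proof
    show "is_form 1 (\<lambda>x. (1 / b 1) * u 1 x)" "is_form 1 (\<lambda>x. (1 / b 2) * u 2 x)"
      "is_form 1 (\<lambda>x. (1 / b 3) * u 3 x)" by (intro is_form_const_mult u(1))+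
    have "vec.span {e i} = vec.span {b j *s e i}" for i j
      using span_eq_iff[OF e(1)] b0 by blast
    then show "p 1 = vec.span {b 1 *s e 1}" "p 2 = vec.span {b 2 *s e 2}" "p 3 = vec.span {b 3 *s e 3}"
      using e(2) by metis+
    show "p 4 = vec.span {b 1 *s e 1 + b 2 *s e 2 + b 3 *s e 3}"
      using ex[of "e 4"] e(2)[of 4] by (simp add: b_def)
    have "e 5 = r 1 *s (b 1 *s e 1) + r 2 *s (b 2 *s e 2) + r 3 *s (b 3 *s e 3)"
      using ex[of "e 5"] by (simp add: b_def e5)
    then show "p 5 = vec.span {r 1 *s (b 1 *s e 1) + r 2 *s (b 2 *s e 2) + r 3 *s (b 3 *s e 3)}"
      using e(2)[of 5] by simp
  qed (use b0 r0 r_neq inj in \<open>simp_all add: is_form_linear[OF u(1)] ue\<close>)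
  then show ?thesis by (rule that)
qed

context five_points
begin

text \<open>The rows of the matrix that expresses \<open>G\<close> in the basis \<open>f\<close> are
  independent, because a relation between them would be one between the cubics \<open>G i\<close>.
  Hence the matrix is invertible and its rows serve as coordinates.\<close>

lemma del_pezzo_coordinates:
  assumes "cubics_basis p f"
  obtains pt l0 l1 l2 l3 l4 where "del_pezzo p b1 b2 b3 W U V a b c pt l0 l1 l2 l3 l4 f"
proof -
  from assms have fc: "\<And>j. f j \<in> cubics_through p"
    and basis: "\<And>g. g \<in> cubics_through p \<Longrightarrow> \<exists>k. g = (\<lambda>v. \<Sum>j\<in>UNIV. k j * f j v)"
    unfolding cubics_basis_def by blast+
  from basis[OF G_cubic] obtain k where k: "\<And>i. G i = (\<lambda>v. \<Sum>j\<in>UNIV. k i j * f j v)" by metis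
  define l where "l i x = (\<Sum>j\<in>UNIV. k i j * x $ j)" for i and x :: "complex ^ 5"
  have form: "is_form 1 (l i)" for i unfolding is_form_1_iff l_def[abs_def] by blast
  have lG: "l i (\<chi> j. f j z) = G i z" for i z by (simp add: l_def k)
  obtain v where v: "\<And>y i. l i (v y) = y i" "\<And>x. v (\<lambda>i. l i x) = x"
  proof (rule dual_coordinates[OF form])
    fix c i assume 0: "\<And>x. (\<Sum>i\<in>UNIV. c i * l i x) = 0"
    have "(\<Sum>i\<in>UNIV. c i * G i z) = 0" for z using 0[of "\<chi> j. f j z"] by (simp add: lG)
    then show "c i = 0" by (rule G_independent)
  qed blast
  define pt where "pt y0 y1 y2 y3 y4 = v (\<lambda>i. if i = 1 then y0 else if i = 2 then y1 else if i = 3 then y2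
      else if i = 4 then y3 else y4)" for y0 y1 y2 y3 y4
  have "del_pezzo p b1 b2 b3 W U V a b c pt (l 1) (l 2) (l 3) (l 4) (l 5) f"
  proof
    have "(\<lambda>i. if i = 1 then l 1 x else if i = 2 then l 2 x else if i = 3 then l 3 x
      else if i = 4 then l 4 x else l 5 x) = (\<lambda>i. l i x)" for x
      unfolding fun_eq_iff forall_5 by simp
    then show "pt (l 1 x) (l 2 x) (l 3 x) (l 4 x) (l 5 x) = x" for x
      by (simp add: pt_def v)
  qed (simp_all add: form[simplified] fc lG v pt_def)
  then show ?thesis by (rule that)
qed

end

section \<open>Sections of the two conic bundles\<close>

text \<open>Over \<open>(s : t) = (y0 : y1) = (y2 : y3)\<close> the quadric \<open>y4 * y5 = y0 * y3\<close> with
  \<open>y5 = e * y4 + n0 * y0 + n1 * y1 + n2 * y2 + n3 * y3\<close> cuts out a conic in the coordinates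
  \<open>(y0 / s : y2 / s : y4)\<close>, which passes through \<open>(0 : 1 : 0)\<close>. The section \<open>(g * theta : h * j : h * theta)\<close>
  is its second intersection with the line of slope \<open>h / g\<close> through that point.\<close>

locale conic_section = linear_coords +
  fixes k :: nat and e n0 n1 n2 n3 :: complex and g h :: "complex \<Rightarrow> complex \<Rightarrow> complex"
  assumes e: "e \<noteq> 0"
    and g_form: "binary_form k (\<lambda>s t. s * g s t)" "binary_form k (\<lambda>s t. t * g s t)"
    and h_form: "binary_form k h"
    and coprime: "\<And>s t. s \<noteq> 0 \<or> t \<noteq> 0 \<Longrightarrow> g s t * (s * t * g s t - h s t * (n2 * s + n3 * t)) = 0 \<Longrightarrow>
      h s t * (e * h s t + (n0 * s + n1 * t) * g s t) = 0 \<Longrightarrow> False"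
begin

text \<open>With \<open>y0 = s * A\<close>, \<open>y2 = s * B\<close>, \<open>y4 = C\<close> the
  conic is \<open>C * (e * C + (n0 * s + n1 * t) * A + (n2 * s + n3 * t) * B) = s * t * A *
  B\<close>. On the line \<open>A = g * \<lambda>\<close>, \<open>C = h * \<lambda>\<close> a factor
  \<open>\<lambda>\<close> cancels, and \<open>\<lambda> * h * j = B * theta\<close>
  remains.\<close>

definition theta where "theta s t = s * t * g s t - h s t * (n2 * s + n3 * t)"
definition j where "j s t = e * h s t + (n0 * s + n1 * t) * g s t"

lemma nz: "s \<noteq> 0 \<or> t \<noteq> 0 \<Longrightarrow> g s t * theta s t = 0 \<Longrightarrow> h s t * j s t = 0 \<Longrightarrow> False"
  unfolding theta_def j_def by (rule coprime)

lemma theta_form: "binary_form (Suc k) theta"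
proof -
  have "binary_form (1 + k) (\<lambda>s t. s * (t * g s t))"
    by (intro binary_form_mult g_form binary_form_fst)
  moreover have "binary_form (k + 1) (\<lambda>s t. h s t * (n2 * s + n3 * t))"
    by (intro binary_form_mult binary_form_add binary_form_cmult h_form binary_form_fst binary_form_snd)
  ultimately show ?thesis
    using binary_form_diff[of "Suc k"] unfolding theta_def[abs_def] by (simp add: mult.assoc)
qed

lemma j_form: "binary_form k j"
proof -
  have "binary_form k (\<lambda>s t. e * h s t + (n0 * (s * g s t) + n1 * (t * g s t)))"
    by (intro binary_form_add binary_form_cmult h_form g_form)
  then show ?thesis unfolding j_def[abs_def] by (simp add: algebra_simps)
qed

lemma g_theta_form: "binary_form (2 * k) (\<lambda>s t. g s t * theta s t)"
proof -
  have "binary_form (k + k) (\<lambda>s t. (s * g s t) * (t * g s t) - h s t * (n2 * (s * g s t) + n3 * (t * g s t)))"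
    by (intro binary_form_diff binary_form_mult binary_form_add binary_form_cmult h_form g_form)
  then show ?thesis unfolding theta_def[abs_def] mult_2 by (simp add: algebra_simps)
qed

definition Q :: "complex ^ 5 \<Rightarrow> complex" where
  "Q x = l4 x * (e * l4 x + n0 * l0 x + n1 * l1 x + n2 * l2 x + n3 * l3 x) - l0 x * l3 x"

lemma on_quadric:
  "h s t * theta s t * (e * (h s t * theta s t) + n0 * (s * (g s t * theta s t)) + n1 * (t * (g s t * theta s t))
     + n2 * (s * (h s t * j s t)) + n3 * (t * (h s t * j s t)))
   = s * (g s t * theta s t) * (t * (h s t * j s t))"
  unfolding theta_def j_def by (simp add: algebra_simps)

sublocale ruled_curve pt l0 l1 l2 l3 l4 "2 * k" "\<lambda>s t. g s t * theta s t" "\<lambda>s t. h s t * j s t"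
  "\<lambda>s t. h s t * theta s t" Q
proof
  show "binary_form (2 * k) (\<lambda>s t. g s t * theta s t)" by (rule g_theta_form)
  show "binary_form (2 * k) (\<lambda>s t. h s t * j s t)"
    using binary_form_mult[OF h_form j_form] by (simp add: mult_2)
  show "binary_form (Suc (2 * k)) (\<lambda>s t. h s t * theta s t)"
    using binary_form_mult[OF h_form theta_form] by (simp add: mult_2)
  have "is_form (1 + 1) Q" unfolding Q_def[abs_def]
    by (intro is_form_diff is_form_mult is_form_add is_form_const_mult l_form)
  then show "homogeneous Q" by (auto simp: homogeneous_def)
  show "Q (pt (s * (g s t * theta s t)) (t * (g s t * theta s t)) (s * (h s t * j s t))
      (t * (h s t * j s t)) (h s t * theta s t)) = 0" for s t
    using on_quadric[of s t] by (simp add: Q_def)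
  show "Q (pt 0 0 0 0 1) \<noteq> 0" using e by (simp add: Q_def)
qed (rule nz)

lemma h_nonzero: "s \<noteq> 0 \<or> t \<noteq> 0 \<Longrightarrow> s * t = 0 \<Longrightarrow> h s t \<noteq> 0"
  using nz[of s t] by (auto simp: theta_def)

lemma g_h_nonzero: "s \<noteq> 0 \<or> t \<noteq> 0 \<Longrightarrow> g s t \<noteq> 0 \<or> h s t \<noteq> 0"
  using nz[of s t] by auto

text \<open>\<open>g\<close> has degree \<open>k - 1\<close>, but only \<open>s * g\<close> and
  \<open>t * g\<close> are assumed to be forms, so that \<open>k = 0\<close> with
  \<open>g = 0\<close> is included. The factor \<open>c\<close> on the left avoids the exponent
  \<open>k - 1\<close>.\<close>

lemma g_scale:
  assumes "s \<noteq> 0 \<or> t \<noteq> 0"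
  shows "c * g (c * s) (c * t) = c ^ k * g s t"
proof -
  have "s * (c * g (c * s) (c * t)) = s * (c ^ k * g s t)" "t * (c * g (c * s) (c * t)) = t * (c ^ k * g s t)"
    using binary_form_scale[OF g_form(1), where c = c and s = s and t = t]
      binary_form_scale[OF g_form(2), where c = c and s = s and t = t]
    by (simp_all add: mult_ac)
  then show ?thesis using assms by auto
qed

end

text \<open>The second curve is a section of the other conic bundle \<open>(y0 : y2) = (y1 : y3)\<close>.\<close>

locale section_pair =
  A: conic_section pt l0 l1 l2 l3 l4 k e n0 n1 n2 n3 g h +
  B: conic_section "\<lambda>y0 y1 y2 y3 y4. pt y0 y2 y1 y3 y4" l0 l2 l1 l3 l4 l e n0 n2 n1 n3 g' h'
  for pt l0 l1 l2 l3 l4 k e n0 n1 n2 n3 g h l g' h' +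
  assumes n3: "n3 \<noteq> 0"
begin

text \<open>The point of the second curve at \<open>(\<sigma> : \<tau>)\<close> lies over
  \<open>(\<xi> : \<eta>)\<close> in the first bundle, with \<open>y0 / \<xi> = \<sigma>\<close> and
  \<open>y4 = h' * B.theta\<close>. \<open>R\<close> compares its slope \<open>y4 : \<sigma>\<close>
  with the slope \<open>h : g\<close> of the first curve over
  \<open>(\<xi> : \<eta>)\<close>.\<close>

definition R :: "complex \<Rightarrow> complex \<Rightarrow> complex" where
  "R \<sigma> \<tau> = (let \<xi> = g' \<sigma> \<tau> * B.theta \<sigma> \<tau>; \<eta> = h' \<sigma> \<tau> * B.j \<sigma> \<tau>
     in h' \<sigma> \<tau> * B.theta \<sigma> \<tau> * g \<xi> \<eta> - \<sigma> * h \<xi> \<eta>)"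

text \<open>The point lies on the conic over \<open>(\<xi> : \<eta>)\<close>, and the first curve is
  defined by its slope there. If the slopes agree, the equation of the quadric determines the
  remaining ratio \<open>\<tau> : \<kappa>\<close>.\<close>

lemma point_on_both_iff:
  assumes st: "\<sigma> \<noteq> 0 \<or> \<tau> \<noteq> 0"
  shows "vec.span {B.param \<sigma> \<tau>} \<in> A.curve \<longleftrightarrow> R \<sigma> \<tau> = 0"
proof -
  define \<xi> where "\<xi> = g' \<sigma> \<tau> * B.theta \<sigma> \<tau>"
  define \<eta> where "\<eta> = h' \<sigma> \<tau> * B.j \<sigma> \<tau>"
  define \<rho> where "\<rho> = h' \<sigma> \<tau> * B.theta \<sigma> \<tau>"
  have R: "R \<sigma> \<tau> = \<rho> * g \<xi> \<eta> - \<sigma> * h \<xi> \<eta>" by (simp add: R_def Let_def \<xi>_def \<eta>_def \<rho>_def)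
  have P: "B.param \<sigma> \<tau> = pt (\<sigma> * \<xi>) (\<sigma> * \<eta>) (\<tau> * \<xi>) (\<tau> * \<eta>) \<rho>"
    by (simp add: B.param_def \<xi>_def \<eta>_def \<rho>_def)
  have \<xi>\<eta>: "\<xi> \<noteq> 0 \<or> \<eta> \<noteq> 0" using B.nz[OF st] by (auto simp: \<xi>_def \<eta>_def)
  show ?thesis
  proof
    assume "vec.span {B.param \<sigma> \<tau>} \<in> A.curve"
    then obtain s t where st': "vec.span {A.param s t} = vec.span {B.param \<sigma> \<tau>}" "s \<noteq> 0 \<or> t \<noteq> 0"
      unfolding A.curve_def by blast
    obtain c where c: "c \<noteq> 0" "B.param \<sigma> \<tau> = c *s A.param s t"
      using span_eq_iff[OF A.param_nonzero[OF st'(2)]] st'(1) by blast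
    have eq: "\<sigma> * \<xi> = c * (s * (g s t * A.theta s t))" "\<sigma> * \<eta> = c * (t * (g s t * A.theta s t))"
      "\<tau> * \<xi> = c * (s * (h s t * A.j s t))" "\<tau> * \<eta> = c * (t * (h s t * A.j s t))"
      "\<rho> = c * (h s t * A.theta s t)"
      using arg_cong[OF c(2), of l0] arg_cong[OF c(2), of l1] arg_cong[OF c(2), of l2]
        arg_cong[OF c(2), of l3] arg_cong[OF c(2), of l4]
      by (simp_all add: P A.param_def A.l_linear)
    obtain \<kappa> where \<kappa>: "\<xi> = \<kappa> * s" "\<eta> = \<kappa> * t"
    proof (cases "\<sigma> = 0")
      case False
      then show ?thesis using eq(1,2) by (intro that[of "c * (g s t * A.theta s t) / \<sigma>"]) (simp_all add: field_simps)
    next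
      case True
      then have "\<tau> \<noteq> 0" using st by simp
      then show ?thesis using eq(3,4) by (intro that[of "c * (h s t * A.j s t) / \<tau>"]) (simp_all add: field_simps)
    qed
    have \<kappa>0: "\<kappa> \<noteq> 0" using \<kappa> \<xi>\<eta> by auto
    have "\<sigma> * \<kappa> = c * (g s t * A.theta s t)"
      using eq(1,2) st'(2) unfolding \<kappa> by (auto simp: mult_ac)
    moreover have "\<kappa> * g \<xi> \<eta> = \<kappa> ^ k * g s t" "h \<xi> \<eta> = \<kappa> ^ k * h s t"
      unfolding \<kappa> by (rule A.g_scale[OF st'(2)], rule binary_form_scale[OF A.h_form])
    moreover have "\<kappa> * R \<sigma> \<tau> = \<rho> * (\<kappa> * g \<xi> \<eta>) - (\<sigma> * \<kappa>) * h \<xi> \<eta>"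
      by (simp add: R algebra_simps)
    ultimately have "\<kappa> * R \<sigma> \<tau> = 0" by (simp add: eq(5))
    then show "R \<sigma> \<tau> = 0" using \<kappa>0 by simp
  next
    assume "R \<sigma> \<tau> = 0"
    then have gh: "\<rho> * g \<xi> \<eta> = \<sigma> * h \<xi> \<eta>" by (simp add: R)
    \<comment> \<open>\<open>\<sigma> = \<rho> = 0\<close> would be the centre of projection, where
      the slope is undefined. For \<open>\<sigma> = 0\<close> one has
      \<open>B.theta = - n3 * \<tau> * h'\<close>, which is nonzero.\<close>
    have \<sigma>\<rho>: "\<sigma> \<noteq> 0 \<or> \<rho> \<noteq> 0"
    proof (cases "\<sigma> = 0")
      case True
      then have "h' \<sigma> \<tau> \<noteq> 0" using B.h_nonzero[OF st] by simp
      then show ?thesis using True st n3 by (simp add: \<rho>_def B.theta_def)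
    qed simp
    obtain \<kappa> where \<kappa>: "\<sigma> = \<kappa> * g \<xi> \<eta>" "\<rho> = \<kappa> * h \<xi> \<eta>"
    proof (cases "g \<xi> \<eta> = 0")
      case True
      then have "h \<xi> \<eta> \<noteq> 0" using A.g_h_nonzero[OF \<xi>\<eta>] by simp
      then show ?thesis using gh True by (intro that[of "\<rho> / h \<xi> \<eta>"]) auto
    next
      case False
      then show ?thesis using gh by (intro that[of "\<sigma> / g \<xi> \<eta>"]) (simp_all add: field_simps)
    qed
    have \<kappa>0: "\<kappa> \<noteq> 0" using \<sigma>\<rho> \<kappa> by auto
    have "\<rho> * (e * \<rho> + n0 * (\<sigma> * \<xi>) + n2 * (\<tau> * \<xi>) + n1 * (\<sigma> * \<eta>) + n3 * (\<tau> * \<eta>)) = \<sigma> * \<xi> * (\<tau> * \<eta>)"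
      using B.on_quadric[of \<sigma> \<tau>] by (simp only: \<xi>_def \<eta>_def \<rho>_def)
    then have "\<kappa> * (h \<xi> \<eta> * (\<kappa> * A.j \<xi> \<eta>)) = \<kappa> * (\<tau> * A.theta \<xi> \<eta>)"
      unfolding \<kappa> A.j_def A.theta_def by (simp add: algebra_simps)
    then have *: "\<kappa> * (h \<xi> \<eta> * A.j \<xi> \<eta>) = \<tau> * A.theta \<xi> \<eta>" using \<kappa>0 by (simp add: mult_ac)
    obtain c where c: "\<tau> = c * (h \<xi> \<eta> * A.j \<xi> \<eta>)" "\<kappa> = c * A.theta \<xi> \<eta>"
    proof (cases "A.theta \<xi> \<eta> = 0")
      case True
      then have "h \<xi> \<eta> * A.j \<xi> \<eta> \<noteq> 0" using A.nz[OF \<xi>\<eta>] by auto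
      then show ?thesis using * True \<kappa>0 by simp
    next
      case False
      then show ?thesis using * by (intro that[of "\<kappa> / A.theta \<xi> \<eta>"]) (simp_all add: field_simps)
    qed
    have "c \<noteq> 0" using c \<kappa>0 by auto
    moreover have "\<sigma> = c * (g \<xi> \<eta> * A.theta \<xi> \<eta>)" "\<rho> = c * (h \<xi> \<eta> * A.theta \<xi> \<eta>)"
      using \<kappa> c(2) by (simp_all add: mult_ac)
    then have "B.param \<sigma> \<tau> = c *s A.param \<xi> \<eta>"
      unfolding P A.param_def A.pt_scale using c(1) by (simp add: mult_ac)
    ultimately have "vec.span {A.param \<xi> \<eta>} = vec.span {B.param \<sigma> \<tau>}"
      using span_eq_iff[OF A.param_nonzero[OF \<xi>\<eta>]] by blast
    then show "vec.span {B.param \<sigma> \<tau>} \<in> A.curve" using A.curveI[OF \<xi>\<eta>] by simp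
  qed
qed

lemma card_intersection:
  assumes "R 1 0 \<noteq> 0" "\<And>r. R r 1 = poly P r" "degree P = d" "rsquarefree P"
  shows "finite (A.curve \<inter> B.curve)" "card (A.curve \<inter> B.curve) = d"
proof -
  have "A.curve \<inter> B.curve = (\<lambda>r. vec.span {B.param r 1}) ` {r. poly P r = 0}"
    unfolding B.curve_points using point_on_both_iff[of 1 0] point_on_both_iff[of _ 1] assms(1,2) by auto
  then show "finite (A.curve \<inter> B.curve)" "card (A.curve \<inter> B.curve) = d"
    using card_roots_rsquarefree[OF assms(4)] assms(3)
    by (simp_all add: card_image inj_on_subset[OF B.inj_affine_param])
qed

end

section \<open>Existence of sections, and of a pair with the expected number of common
  points\<close>

context linear_coords
begin

text \<open>This section is the line \<open>y0 = y1 = 0\<close>,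
  \<open>e * y4 + n2 * y2 + n3 * y3 = 0\<close>.\<close>

lemma line_conic_section:
  assumes "e \<noteq> 0"
  shows "conic_section pt l0 l1 l2 l3 l4 0 e n0 n1 n2 n3 (\<lambda>s t. 0) (\<lambda>s t. 1)"
  by unfold_locales (use assms in \<open>auto intro: binary_form_zero binary_form_const\<close>)

lemma finite_affine_zero:
  assumes "a \<noteq> (0::complex)"
  shows "finite {c. c * a + b = 0}"
proof (rule finite_subset)
  show "{c. c * a + b = 0} \<subseteq> {- b / a}" using assms by (auto simp: field_simps add_eq_0_iff)
qed simp

text \<open>Common zeros with \<open>g = 0\<close> or \<open>h = 0\<close> are ruled out by
  \<open>z \<noteq> z'\<close> and \<open>z \<noteq> 0\<close>. The others satisfy
  \<open>theta = j = 0\<close>; eliminating \<open>g\<close> and \<open>h\<close> shows that they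
  can lie only over the two roots of \<open>D\<close>, and each root forbids one value of
  \<open>c\<close>.\<close>

lemma generic_conic_section:
  assumes e: "e \<noteq> 0" and n: "n0 * n2 \<noteq> 0"
  obtains z where "z \<noteq> 0" "z \<noteq> z'"
    "finite {c. \<not> conic_section pt l0 l1 l2 l3 l4 (Suc k) e n0 n1 n2 n3
       (\<lambda>s t. (s - z' * t) ^ k) (\<lambda>s t. c * (s - z * t) ^ Suc k)}"
proof -
  \<comment> \<open>Up to a constant, \<open>s * t\<close> times the homogenised \<open>D\<close> is
    the determinant of the conic over \<open>(s : t)\<close>; the roots of \<open>D\<close> are thus
    parameters of singular conics.\<close>
  define D where "D = [:n1 * n3, e + n0 * n3 + n1 * n2, n0 * n2:]"
  have D: "poly D r = e * r + (n0 * r + n1) * (n2 * r + n3)" for r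
    by (simp add: D_def algebra_simps)
  have D0: "D \<noteq> 0" using n by (simp add: D_def)
  then have fin: "finite {r. poly D r = 0}" by (rule poly_roots_finite)
  \<comment> \<open>With \<open>z\<close> not a root of \<open>D\<close>, the equation in
    \<open>bad r\<close> has a nonzero coefficient of \<open>c\<close> at each root
    \<open>r\<close>.\<close>
  then obtain z where z: "z \<noteq> 0" "z \<noteq> z'" "poly D z \<noteq> 0"
    using ex_new_if_finite[OF infinite_UNIV_char_0, of "{0, z'} \<union> {r. poly D r = 0}"] by auto
  define bad where "bad r = {c. c * (e * (r - z) ^ Suc k) + (n0 * r + n1) * (r - z') ^ k = 0}" for r
  have "finite (bad r)" if "poly D r = 0" for r
    unfolding bad_def using that z e by (intro finite_affine_zero) auto
  with fin have "finite ({0} \<union> (\<Union>r\<in>{r. poly D r = 0}. bad r))" by simp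
  moreover have "{c. \<not> conic_section pt l0 l1 l2 l3 l4 (Suc k) e n0 n1 n2 n3
       (\<lambda>s t. (s - z' * t) ^ k) (\<lambda>s t. c * (s - z * t) ^ Suc k)} \<subseteq> {0} \<union> (\<Union>r\<in>{r. poly D r = 0}. bad r)"
  proof
    fix c assume "c \<in> {c. \<not> conic_section pt l0 l1 l2 l3 l4 (Suc k) e n0 n1 n2 n3
       (\<lambda>s t. (s - z' * t) ^ k) (\<lambda>s t. c * (s - z * t) ^ Suc k)}"
    then have not: "\<not> conic_section pt l0 l1 l2 l3 l4 (Suc k) e n0 n1 n2 n3
       (\<lambda>s t. (s - z' * t) ^ k) (\<lambda>s t. c * (s - z * t) ^ Suc k)" by simp
    show "c \<in> {0} \<union> (\<Union>r\<in>{r. poly D r = 0}. bad r)"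
    proof (rule ccontr)
      assume "c \<notin> {0} \<union> (\<Union>r\<in>{r. poly D r = 0}. bad r)"
      then have c: "c \<noteq> 0" "\<And>r. poly D r = 0 \<Longrightarrow> c * (e * (r - z) ^ Suc k) + (n0 * r + n1) * (r - z') ^ k \<noteq> 0"
        by (auto simp: bad_def)
      have lin: "binary_form 1 (\<lambda>s t. s - x * t)" for x
        by (intro binary_form_diff binary_form_cmult binary_form_fst binary_form_snd)
      have "conic_section pt l0 l1 l2 l3 l4 (Suc k) e n0 n1 n2 n3
         (\<lambda>s t. (s - z' * t) ^ k) (\<lambda>s t. c * (s - z * t) ^ Suc k)"
      proof
        show "e \<noteq> 0" by (rule e)
        show "binary_form (Suc k) (\<lambda>s t. s * (s - z' * t) ^ k)"
          using binary_form_mult[OF binary_form_fst binary_form_power[OF lin, of k z']] by simp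
        show "binary_form (Suc k) (\<lambda>s t. t * (s - z' * t) ^ k)"
          using binary_form_mult[OF binary_form_snd binary_form_power[OF lin, of k z']] by simp
        show "binary_form (Suc k) (\<lambda>s t. c * (s - z * t) ^ Suc k)"
          using binary_form_cmult[OF binary_form_power[OF lin, of "Suc k" z]] by simp
        fix s t
        define G where "G = (s - z' * t) ^ k"
        define H where "H = c * (s - z * t) ^ Suc k"
        assume st: "s \<noteq> 0 \<or> t \<noteq> 0"
          and "(s - z' * t) ^ k * (s * t * (s - z' * t) ^ k - c * (s - z * t) ^ Suc k * (n2 * s + n3 * t)) = 0"
            "c * (s - z * t) ^ Suc k * (e * (c * (s - z * t) ^ Suc k) + (n0 * s + n1 * t) * (s - z' * t) ^ k) = 0"
        then have 0: "G * (s * t * G - H * (n2 * s + n3 * t)) = 0" "H * (e * H + (n0 * s + n1 * t) * G) = 0"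
          by (simp_all only: G_def H_def)
        have GH: "G \<noteq> 0 \<or> H \<noteq> 0"
        proof (rule ccontr)
          assume "\<not> (G \<noteq> 0 \<or> H \<noteq> 0)"
          then have "s = z' * t" "s = z * t" using c(1) by (auto simp: G_def H_def)
          then show False using st z(2) by auto
        qed
        show False
        proof (cases "G = 0 \<or> H = 0")
          case True
          then have "H = 0" "G \<noteq> 0" using 0(2) e GH by auto
          then have "s * t = 0" "s = z * t" using 0(1) c(1) by (auto simp: H_def)
          then show False using st z(1) by auto
        next
          case False
          then have 1: "s * t * G = H * (n2 * s + n3 * t)" and 2: "e * H = - ((n0 * s + n1 * t) * G)"
            using 0 by (simp_all add: add_eq_0_iff2)
          have "G * (e * s * t + (n0 * s + n1 * t) * (n2 * s + n3 * t))
              = e * (s * t * G) + (n0 * s + n1 * t) * G * (n2 * s + n3 * t)" by (simp add: algebra_simps)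
          also have "\<dots> = (e * H + (n0 * s + n1 * t) * G) * (n2 * s + n3 * t)"
            unfolding 1 by (simp add: algebra_simps)
          finally have 3: "e * s * t + (n0 * s + n1 * t) * (n2 * s + n3 * t) = 0" using False 2 by simp
          have t: "t \<noteq> 0"
          proof
            assume "t = 0"
            then have "n0 * n2 * s ^ 2 = 0" using 3 by (simp add: power2_eq_square mult_ac)
            then show False using n st \<open>t = 0\<close> by simp
          qed
          define r where "r = s / t"
          have s: "s = r * t" using t by (simp add: r_def)
          have "t ^ 2 * poly D r = e * s * t + (n0 * s + n1 * t) * (n2 * s + n3 * t)"
            unfolding s D by (simp add: algebra_simps power2_eq_square)
          then have "poly D r = 0" using 3 t by simp
          moreover have "t ^ Suc k * (c * (e * (r - z) ^ Suc k) + (n0 * r + n1) * (r - z') ^ k)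
              = e * H + (n0 * s + n1 * t) * G"
          proof -
            have *: "s - z * t = t * (r - z)" "s - z' * t = t * (r - z')" "n0 * s + n1 * t = t * (n0 * r + n1)"
              by (simp_all add: s algebra_simps)
            show ?thesis unfolding G_def H_def * power_mult_distrib power_Suc
              by (simp only: distrib_left distrib_right mult_ac)
          qed
          ultimately show False using c(2)[of r] 2 t by simp
        qed
      qed
      with not show False by blast
    qed
  qed
  ultimately show ?thesis using that[OF z(1,2)] finite_subset by blast
qed

lemma exists_conic_section:
  assumes "e \<noteq> 0" "n0 * n2 \<noteq> 0"
  obtains g h where "conic_section pt l0 l1 l2 l3 l4 k e n0 n1 n2 n3 g h"
proof (cases k)
  case 0
  then show ?thesis using line_conic_section[OF assms(1)] that by blast
next
  case (Suc k')
  obtain z where "finite {c. \<not> conic_section pt l0 l1 l2 l3 l4 (Suc k') e n0 n1 n2 n3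
       (\<lambda>s t. (s - 0 * t) ^ k') (\<lambda>s t. c * (s - z * t) ^ Suc k')}"
    using generic_conic_section[OF assms] by blast
  from ex_new_if_finite[OF infinite_UNIV_char_0 this] show ?thesis using that unfolding Suc by blast
qed

text \<open>Exchanging \<open>y1\<close> and \<open>y2\<close> preserves
  \<open>y0 * y3 = y1 * y2\<close> and interchanges its two rulings, so the second conic bundle
  needs no separate construction.\<close>

lemma swap_coords: "linear_coords (\<lambda>y0 y1 y2 y3 y4. pt y0 y2 y1 y3 y4) l0 l2 l1 l3 l4"
  by unfold_locales (use l_form in \<open>simp_all add: pt_l\<close>)

text \<open>For \<open>h = c * (s - z * t) ^ k\<close> the form \<open>R\<close> of a pair of sections runs, as \<open>c\<close> varies, through a
  pencil without base points, so that its roots are simple for almost all \<open>c\<close>.\<close>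

theorem exists_section_curves:
  assumes e: "e \<noteq> 0" and n: "n0 \<noteq> 0" "n1 \<noteq> 0" "n2 \<noteq> 0" "n3 \<noteq> 0"
  obtains C1 C2 where "smooth_curve C1" "smooth_curve C2" "has_degree C1 (2 * k + 1)" "has_degree C2 (2 * l + 1)"
    "finite (C1 \<inter> C2)" "card (C1 \<inter> C2) = 2 * k * l + 1"
    "\<And>P. P \<in> C1 \<union> C2 \<Longrightarrow> \<exists>y0 y1 y2 y3 y4. P = vec.span {pt y0 y1 y2 y3 y4} \<and> pt y0 y1 y2 y3 y4 \<noteq> 0 \<and>
       y0 * y3 = y1 * y2 \<and> y4 * (e * y4 + n0 * y0 + n1 * y1 + n2 * y2 + n3 * y3) = y0 * y3"
proof -
  \<comment> \<open>The second curve is fixed before the first, because the parameters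
    \<open>z'\<close> and \<open>c\<close> of the first depend on it.\<close>
  obtain g' h' where "conic_section (\<lambda>y0 y1 y2 y3 y4. pt y0 y2 y1 y3 y4) l0 l2 l1 l3 l4 l e n0 n2 n1 n3 g' h'"
    using linear_coords.exists_conic_section[OF swap_coords e, of n0 n1 l n2 n3] n by auto
  then interpret B: conic_section "\<lambda>y0 y1 y2 y3 y4. pt y0 y2 y1 y3 y4" l0 l2 l1 l3 l4 l e n0 n2 n1 n3 g' h' .
  define \<xi> where "\<xi> \<sigma> \<tau> = g' \<sigma> \<tau> * B.theta \<sigma> \<tau>" for \<sigma> \<tau>
  define \<eta> where "\<eta> \<sigma> \<tau> = h' \<sigma> \<tau> * B.j \<sigma> \<tau>" for \<sigma> \<tau>
  define \<rho> where "\<rho> \<sigma> \<tau> = h' \<sigma> \<tau> * B.theta \<sigma> \<tau>" for \<sigma> \<tau>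
  have forms: "binary_form (2 * l) \<xi>" "binary_form (2 * l) \<eta>" "binary_form (Suc (2 * l)) \<rho>"
    unfolding \<xi>_def[abs_def] \<eta>_def[abs_def] \<rho>_def[abs_def] by (rule B.bf)+
  have "\<exists>g h P. conic_section pt l0 l1 l2 l3 l4 k e n0 n1 n2 n3 g h \<and>
      \<rho> 1 0 * g (\<xi> 1 0) (\<eta> 1 0) - h (\<xi> 1 0) (\<eta> 1 0) \<noteq> 0 \<and>
      (\<forall>r. \<rho> r 1 * g (\<xi> r 1) (\<eta> r 1) - r * h (\<xi> r 1) (\<eta> r 1) = poly P r) \<and>
      degree P = 2 * k * l + 1 \<and> rsquarefree P"
  proof (cases k)
    case 0
    \<comment> \<open>For \<open>g = 0\<close> and \<open>h = 1\<close> the form \<open>R\<close> is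
      \<open>- \<sigma>\<close>: the line meets the second curve once.\<close>
    have "rsquarefree [:0, - 1 :: complex:]" by (simp add: rsquarefree_roots pderiv_pCons)
    then show ?thesis using line_conic_section[OF e] 0
      by (intro exI[of _ "\<lambda>s t. 0"] exI[of _ "\<lambda>s t. 1"] exI[of _ "[:0, - 1:]"]) simp
  next
    case (Suc k')
    \<comment> \<open>\<open>R1\<close> vanishes at \<open>\<sigma> = 0\<close>; this choice keeps
      \<open>R0\<close> from vanishing there.\<close>
    obtain z' where z': "\<xi> 0 1 - z' * \<eta> 0 1 \<noteq> 0"
    proof (cases "\<eta> 0 1 = 0")
      case True
      then have "\<xi> 0 1 \<noteq> 0" using B.nz[of 0 1] by (auto simp: \<xi>_def \<eta>_def)
      then show ?thesis using that[of 0] by simp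
    next
      case False
      then show ?thesis using that[of "\<xi> 0 1 / \<eta> 0 1 + 1"] by (simp add: algebra_simps)
    qed
    obtain z where z: "z \<noteq> 0" "z \<noteq> z'"
      and fin1: "finite {c. \<not> conic_section pt l0 l1 l2 l3 l4 (Suc k') e n0 n1 n2 n3
       (\<lambda>s t. (s - z' * t) ^ k') (\<lambda>s t. c * (s - z * t) ^ Suc k')}"
      using generic_conic_section[of e n0 n2 z' k' n1 n3] e n by auto
    define d where "d = 2 * Suc k' * l + 1"
    \<comment> \<open>\<open>R = R0 + c * R1\<close>. Both terms have degree \<open>d\<close>,
      computed as \<open>(2 * l + 1) + k' * (2 * l)\<close> and as
      \<open>1 + (k' + 1) * (2 * l)\<close>.\<close>
    define R0 where "R0 \<sigma> \<tau> = \<rho> \<sigma> \<tau> * (\<xi> \<sigma> \<tau> - z' * \<eta> \<sigma> \<tau>) ^ k'" for \<sigma> \<tau>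
    define R1 where "R1 \<sigma> \<tau> = (- 1) * (\<sigma> * (\<xi> \<sigma> \<tau> - z * \<eta> \<sigma> \<tau>) ^ Suc k')" for \<sigma> \<tau>
    have d: "d = Suc (2 * l) + k' * (2 * l)" "d = 1 + Suc k' * (2 * l)" by (simp_all add: d_def)
    have R0: "binary_form d R0" unfolding R0_def[abs_def] d(1)
      by (intro binary_form_mult binary_form_power binary_form_diff binary_form_cmult forms)
    have R1: "binary_form d R1" unfolding R1_def[abs_def] d(2)
      by (intro binary_form_cmult[of _ _ "- 1"] binary_form_mult binary_form_power binary_form_diff
          binary_form_cmult[of _ \<eta>] binary_form_fst forms)
    have base_point_free: False if st: "\<sigma> \<noteq> 0 \<or> \<tau> \<noteq> 0" and 0: "R0 \<sigma> \<tau> = 0" "R1 \<sigma> \<tau> = 0" for \<sigma> \<tau>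
    proof (cases "\<sigma> = 0")
      case True
      then have "\<tau> \<noteq> 0" using st by simp
      have "h' \<sigma> \<tau> \<noteq> 0" using B.h_nonzero[OF st] True by simp
      then have "\<rho> \<sigma> \<tau> \<noteq> 0" using True \<open>\<tau> \<noteq> 0\<close> n by (simp add: \<rho>_def B.theta_def)
      moreover have "\<xi> \<sigma> \<tau> - z' * \<eta> \<sigma> \<tau> = \<tau> ^ (2 * l) * (\<xi> 0 1 - z' * \<eta> 0 1)"
        using binary_form_scale[OF forms(1), of \<tau> 0 1] binary_form_scale[OF forms(2), of \<tau> 0 1] True
        by (simp add: algebra_simps)
      ultimately show False using 0(1) z' \<open>\<tau> \<noteq> 0\<close> by (simp add: R0_def)
    next
      \<comment> \<open>Here \<open>\<xi> = z * \<eta>\<close> with \<open>z \<noteq> 0\<close>, so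
        neither vanishes; hence \<open>h'\<close> and \<open>B.theta\<close>, which divide them, are
        nonzero, and so is \<open>\<rho>\<close>.\<close>
      case False
      then have \<xi>: "\<xi> \<sigma> \<tau> = z * \<eta> \<sigma> \<tau>" using 0(2) by (auto simp: R1_def)
      then have \<eta>0: "\<eta> \<sigma> \<tau> \<noteq> 0" using B.nz[OF st] by (auto simp: \<xi>_def \<eta>_def)
      then have "\<xi> \<sigma> \<tau> \<noteq> 0" using \<xi> z by simp
      then have "\<rho> \<sigma> \<tau> \<noteq> 0" using \<eta>0 by (auto simp: \<xi>_def \<eta>_def \<rho>_def)
      moreover have "\<xi> \<sigma> \<tau> - z' * \<eta> \<sigma> \<tau> \<noteq> 0" using \<xi> \<eta>0 z(2) by simp
      ultimately show False using 0(1) by (simp add: R0_def)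
    qed
    obtain p where p: "degree p \<le> d" "\<And>r. R0 r 1 = poly p r" "R0 1 0 = coeff p d"
      using binary_form_polyE[OF R0] by blast
    obtain q where q: "degree q \<le> d" "\<And>r. R1 r 1 = poly q r" "R1 1 0 = coeff q d"
      using binary_form_polyE[OF R1] by blast
    have fin2: "finite {c. \<not> (degree (p + Polynomial.smult c q) = d \<and> rsquarefree (p + Polynomial.smult c q))}"
    proof (rule generic_member_squarefree[OF _ p(1) q(1)])
      show False if "poly p x = 0" "poly q x = 0" for x
        using base_point_free[of x 1] that p(2) q(2) by simp
      show "coeff p d \<noteq> 0 \<or> coeff q d \<noteq> 0"
        using base_point_free[of 1 0] p(3) q(3) by auto
    qed
    \<comment> \<open>Both requirements on \<open>c\<close> fail only finitely often, so one value
      satisfies them together.\<close>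
    obtain c where c: "conic_section pt l0 l1 l2 l3 l4 (Suc k') e n0 n1 n2 n3
         (\<lambda>s t. (s - z' * t) ^ k') (\<lambda>s t. c * (s - z * t) ^ Suc k')"
        "degree (p + Polynomial.smult c q) = d" "rsquarefree (p + Polynomial.smult c q)"
      using ex_new_if_finite[OF infinite_UNIV_char_0 finite_UnI[OF fin1 fin2]] by auto
    have "coeff (p + Polynomial.smult c q) d \<noteq> 0"
      using c(2,3) leading_coeff_neq_0 by (metis rsquarefree_def)
    then have top: "R0 1 0 + c * R1 1 0 \<noteq> 0" by (simp add: p q)
    have affine: "R0 r 1 + c * R1 r 1 = poly (p + Polynomial.smult c q) r" for r by (simp add: p q)
    have R01: "R0 \<sigma> \<tau> + c * R1 \<sigma> \<tau> = \<rho> \<sigma> \<tau> * (\<xi> \<sigma> \<tau> - z' * \<eta> \<sigma> \<tau>) ^ k'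
        - \<sigma> * (c * (\<xi> \<sigma> \<tau> - z * \<eta> \<sigma> \<tau>) ^ Suc k')" for \<sigma> \<tau>
      by (simp add: R0_def R1_def)
    show ?thesis
      unfolding Suc
      by (rule exI[of _ "\<lambda>s t. (s - z' * t) ^ k'"], rule exI[of _ "\<lambda>s t. c * (s - z * t) ^ Suc k'"],
          rule exI[of _ "p + Polynomial.smult c q"], intro conjI allI)
        (use c top affine in \<open>simp_all only: R01 mult_1_left d_def not_False_eq_True\<close>)
  qed
  then obtain g h P where A: "conic_section pt l0 l1 l2 l3 l4 k e n0 n1 n2 n3 g h"
    and P: "\<rho> 1 0 * g (\<xi> 1 0) (\<eta> 1 0) - h (\<xi> 1 0) (\<eta> 1 0) \<noteq> 0"
      "\<And>r. \<rho> r 1 * g (\<xi> r 1) (\<eta> r 1) - r * h (\<xi> r 1) (\<eta> r 1) = poly P r"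
      "degree P = 2 * k * l + 1" "rsquarefree P" by blast
  interpret A: conic_section pt l0 l1 l2 l3 l4 k e n0 n1 n2 n3 g h by (rule A)
  interpret AB: section_pair pt l0 l1 l2 l3 l4 k e n0 n1 n2 n3 g h l g' h'
    by unfold_locales (rule n)
  have R: "AB.R 1 0 \<noteq> 0" "\<And>r. AB.R r 1 = poly P r"
    using P(1,2) by (simp_all add: AB.R_def Let_def \<xi>_def \<eta>_def \<rho>_def)
  note inter = AB.card_intersection[OF R P(3,4)]
  have A_pts: "\<exists>y0 y1 y2 y3 y4. X = vec.span {pt y0 y1 y2 y3 y4} \<and> pt y0 y1 y2 y3 y4 \<noteq> 0 \<and>
       y0 * y3 = y1 * y2 \<and> y4 * (e * y4 + n0 * y0 + n1 * y1 + n2 * y2 + n3 * y3) = y0 * y3"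
    if X: "X \<in> A.curve" for X
  proof -
    obtain s t where st: "X = vec.span {A.param s t}" "s \<noteq> 0 \<or> t \<noteq> 0" using X unfolding A.curve_def by blast
    show ?thesis
      using st A.param_nonzero[OF st(2)] A.on_quadric[of s t] unfolding A.param_def
      by (intro exI conjI) (assumption, assumption, simp_all add: mult_ac)
  qed
  have B_pts: "\<exists>y0 y1 y2 y3 y4. X = vec.span {pt y0 y1 y2 y3 y4} \<and> pt y0 y1 y2 y3 y4 \<noteq> 0 \<and>
       y0 * y3 = y1 * y2 \<and> y4 * (e * y4 + n0 * y0 + n1 * y1 + n2 * y2 + n3 * y3) = y0 * y3"
    if X: "X \<in> B.curve" for X
  proof -
    obtain s t where st: "X = vec.span {B.param s t}" "s \<noteq> 0 \<or> t \<noteq> 0" using X unfolding B.curve_def by blast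
    show ?thesis
      using st B.param_nonzero[OF st(2)] B.on_quadric[of s t] unfolding B.param_def
      by (intro exI conjI) (assumption, assumption, simp_all add: add_ac mult_ac)
  qed
  show ?thesis
  proof (rule that[of A.curve B.curve])
    show "smooth_curve A.curve" "smooth_curve B.curve" by (rule A.smooth_curve, rule B.smooth_curve)
    show "has_degree A.curve (2 * k + 1)" "has_degree B.curve (2 * l + 1)"
      using A.has_degree B.has_degree by simp_all
  qed (use inter A_pts B_pts in auto)
qed

end

theorem proposition3p7:
  fixes p :: "5 \<Rightarrow> (complex ^ 3) set"
    and f :: "5 \<Rightarrow> complex ^ 3 \<Rightarrow> complex"
    and S :: "(complex ^ 5) set set"
    and d1 d2 k l :: nat
  assumes "general_points p"
    and "cubics_basis p f"
    and "S = del_pezzo_quartic p f"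
    and "d1 = 2 * k + 1"
    and "d2 = 2 * l + 1"
  shows "\<exists>C1 C2. C1 \<subseteq> S \<and> C2 \<subseteq> S \<and> smooth_curve C1 \<and> smooth_curve C2 \<and>
           has_degree C1 d1 \<and> has_degree C2 d2 \<and>
           finite (C1 \<inter> C2) \<and>
           real (card (C1 \<inter> C2)) = (real d1 - 1) * (real d2 - 1) / 2 + 1"
proof -
  obtain b1 b2 b3 W U V a b c where "five_points p b1 b2 b3 W U V a b c"
    using general_points_imp_five_points[OF assms(1)] by blast
  then interpret five_points p b1 b2 b3 W U V a b c .
  obtain pt l0 l1 l2 l3 l4 where "del_pezzo p b1 b2 b3 W U V a b c pt l0 l1 l2 l3 l4 f"
    using del_pezzo_coordinates[OF assms(2)] by blast
  then interpret del_pezzo p b1 b2 b3 W U V a b c pt l0 l1 l2 l3 l4 f .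
  \<comment> \<open>The linear relation solved for \<open>y5\<close>, which becomes
    \<open>- a * y4 + n0 * y0 + n1 * y1 + n2 * y2 + n3 * y3\<close>; so \<open>- a\<close> takes the
    place of \<open>e\<close>.\<close>
  define n0 where "n0 = c * (b - a) / (b - c)"
  define n1 where "n1 = b * (a - c) / (b - c)"
  define n2 where "n2 = (a - c) / (b - c)"
  define n3 where "n3 = (b - a) / (b - c)"
  have n: "- a \<noteq> 0" "n0 \<noteq> 0" "n1 \<noteq> 0" "n2 \<noteq> 0" "n3 \<noteq> 0"
    using abc by (simp_all add: n0_def n1_def n2_def n3_def)
  have bc: "(b - c) * n0 = c * (b - a)" "(b - c) * n1 = b * (a - c)" "(b - c) * n2 = a - c" "(b - c) * n3 = b - a"
    using abc by (simp_all add: n0_def n1_def n2_def n3_def)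
  obtain C1 C2 where C: "smooth_curve C1" "smooth_curve C2" "has_degree C1 (2 * k + 1)" "has_degree C2 (2 * l + 1)"
    "finite (C1 \<inter> C2)" "card (C1 \<inter> C2) = 2 * k * l + 1"
    and pts: "\<And>P. P \<in> C1 \<union> C2 \<Longrightarrow> \<exists>y0 y1 y2 y3 y4. P = vec.span {pt y0 y1 y2 y3 y4} \<and> pt y0 y1 y2 y3 y4 \<noteq> 0 \<and>
       y0 * y3 = y1 * y2 \<and> y4 * (- a * y4 + n0 * y0 + n1 * y1 + n2 * y2 + n3 * y3) = y0 * y3"
    using exists_section_curves[OF n, of k l] by blast
  have "P \<in> S" if P: "P \<in> C1 \<union> C2" for P
  proof -
    obtain y0 y1 y2 y3 y4 where y: "P = vec.span {pt y0 y1 y2 y3 y4}" "pt y0 y1 y2 y3 y4 \<noteq> 0"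
      "y0 * y3 = y1 * y2" "y4 * (- a * y4 + n0 * y0 + n1 * y1 + n2 * y2 + n3 * y3) = y0 * y3"
      using pts[OF P] by blast
    have "(b - c) * ((- a * y4 + n0 * y0 + n1 * y1 + n2 * y2 + n3 * y3) + a * y4)
        = ((b - c) * n0) * y0 + ((b - c) * n1) * y1 + ((b - c) * n2) * y2 + ((b - c) * n3) * y3"
      by (simp add: algebra_simps)
    then show ?thesis
      unfolding assms(3) y(1) bc by (intro model_point_in_S[OF y(2-4)])
  qed
  moreover have "real (2 * k * l + 1) = (real d1 - 1) * (real d2 - 1) / 2 + 1"
    by (simp add: assms(4,5))
  ultimately show ?thesis using C unfolding assms(4,5) by (intro exI[of _ C1] exI[of _ C2]) auto
qed

end
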